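(* Let $A$ be a ring, $\mathcal{C}$ an $A$-coring, and $\Sigma$ a right $\mathcal{C}$-comodule that is finitely generated and projective as a right $A$-module. The inclusion $T=\mathrm{End}^{\mathcal{C}}(\Sigma)\subset\widetilde{T}=\mathrm{End}_{{}^*\mathcal{C}}(\Sigma)$, the identity maps of ${}^*\mathcal{C}$ and $\Sigma$, and the map $\alpha:Q={}^{\mathcal{C}}\mathrm{Hom}(\mathcal{C},\Sigma^* )\to\widetilde{Q}=\mathrm{Hom}_{{}^*\mathcal{C}}(\Sigma,{}^*\mathcal{C})$, $\alpha(q)(u)(c)=q(c)(u)$, define a morphism of Morita contexts $$(T,{}^*\mathcal{C},\Sigma,Q,\tau,\mu)\to(\widetilde{T},{}^*\mathcal{C},\Sigma,\widetilde{Q},\widetilde{\tau},\widetilde{\mu}).$$ It is an isomorphism if $\mathcal{C}$ is locally projective as a left $A$-module.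
   Context: An $A$-coring is an $A$-bimodule $\mathcal{C}$ with $A$-bimodule maps $\Delta:\mathcal{C}\to\mathcal{C}\otimes_A\mathcal{C}$, $\Delta(c)=c_{(1)}\otimes_A c_{(2)}$ (coassociative) and $\varepsilon:\mathcal{C}\to A$ (counit). A right $\mathcal{C}$-comodule is a right $A$-module with a right $A$-linear, coassociative and counital coaction $m\mapsto m_{[0]}\otimes_A m_{[1]}$; colinear maps are $A$-linear maps commuting with coactions; $\mathrm{Hom}^{\mathcal{C}}$, $\mathrm{End}^{\mathcal{C}}$ denote right colinear maps, ${}^{\mathcal{C}}\mathrm{Hom}$ left colinear maps between left comodules (defined symmetrically). $\mathcal{C}$ is a left comodule via $\Delta$. ${}^*\mathcal{C}={}_A\mathrm{Hom}(\mathcal{C},A)$ is a ring with $(f\#g)(c)=g(c_{(1)}f(c_{(2)}))$. $\Sigma^*=\mathrm{Hom}_A(\Sigma,A)$; if $\sum_i e_i\otimes_A f_i\in\Sigma\otimes_A\Sigma^*$ is the dual basis of $\Sigma$ then $\Sigma^*$ is a left $\mathcal{C}$-comodule via $\rho^l(f)=\sum_i f(e_{i[0]})e_{i[1]}\otimes_A f_i$. First context: $\Sigma$ is a $(T,{}^*\mathcal{C})$-bimodule via $t\cdot u=t(u)$, $u\cdot f=u_{[0]}f(u_{[1]})$; $Q$ is a $({}^*\mathcal{C},T)$-bimodule via $(f\cdot q)(c)=q(c_{(1)}f(c_{(2)}))$, $(q\cdot t)(c)=q(c)\circ t$; $\mu:Q\otimes_T\Sigma\to{}^*\mathcal{C}$,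 $\mu(q\otimes u)(c)=q(c)(u)$; $\tau:\Sigma\otimes_{{}^*\mathcal{C}}Q\to T$, $\tau(u\otimes q)(v)=u_{[0]}(q(u_{[1]})(v))$. Second context (the classical Morita context of the right ${}^*\mathcal{C}$-module $\Sigma$): $\widetilde{Q}$ is a $({}^*\mathcal{C},\widetilde{T})$-bimodule via $(f\cdot\lambda)(u)=f\#\lambda(u)$, $\lambda\cdot t=\lambda\circ t$; $\widetilde{\mu}:\widetilde{Q}\otimes_{\widetilde{T}}\Sigma\to{}^*\mathcal{C}$, $\widetilde{\mu}(\lambda\otimes u)=\lambda(u)$; $\widetilde{\tau}:\Sigma\otimes_{{}^*\mathcal{C}}\widetilde{Q}\to\widetilde{T}$, $\widetilde{\tau}(u\otimes\lambda)(v)=u\cdot\lambda(v)$. A morphism of Morita contexts consists of two ring morphisms and two additive maps between the connecting bimodules, compatible with the bimodule structures and with the connecting maps; it is an isomorphism if all four maps are bijective. $\mathcal{C}$ is locally projective as a left $A$-module if for every finite subset $D\subset\mathcal{C}$ there are finitely many $c_i^*\in{}^*\mathcal{C}$, $c_i\in\mathcal{C}$ with $d=\sum_i c_i^*(d)c_i$ for all $d\in D$. *)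

theory Defs
  imports "HOL-Algebra.Ring" "HOL-Algebra.Coset" "HOL-Algebra.Generated_Groups"
    "HOL-Algebra.Free_Abelian_Groups"
begin

section \<open>Modules and bimodules over noncommutative rings\<close>

text \<open>The additive group is carried by the \<open>ring\<close> part of the record, as in the library's
  \<open>module\<close>; its multiplication and unit are irrelevant. The same record serves left modules, right
  modules and bimodules: a one-sided module does not constrain its other action field.\<close>

record ('l, 'r, 'm) bimod = "'m ring" +
  lsm :: "'l \<Rightarrow> 'm \<Rightarrow> 'm" (infixr \<open>\<triangleright>\<index>\<close> 72)
  rsm :: "'m \<Rightarrow> 'r \<Rightarrow> 'm" (infixl \<open>\<triangleleft>\<index>\<close> 72)

locale left_module = R?: ring R + M?: abelian_group M for R (structure) and M (structure) +
  assumes lsm_closed: "\<lbrakk>a \<in> carrier R; x \<in> carrier M\<rbrakk> \<Longrightarrow> a \<triangleright>\<^bsub>M\<^esub> x \<in> carrier M"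
    and lsm_l_distr: "\<lbrakk>a \<in> carrier R; b \<in> carrier R; x \<in> carrier M\<rbrakk>
          \<Longrightarrow> (a \<oplus>\<^bsub>R\<^esub> b) \<triangleright>\<^bsub>M\<^esub> x = a \<triangleright>\<^bsub>M\<^esub> x \<oplus>\<^bsub>M\<^esub> b \<triangleright>\<^bsub>M\<^esub> x"
    and lsm_r_distr: "\<lbrakk>a \<in> carrier R; x \<in> carrier M; y \<in> carrier M\<rbrakk>
          \<Longrightarrow> a \<triangleright>\<^bsub>M\<^esub> (x \<oplus>\<^bsub>M\<^esub> y) = a \<triangleright>\<^bsub>M\<^esub> x \<oplus>\<^bsub>M\<^esub> a \<triangleright>\<^bsub>M\<^esub> y"
    and lsm_assoc: "\<lbrakk>a \<in> carrier R; b \<in> carrier R; x \<in> carrier M\<rbrakk>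
          \<Longrightarrow> (a \<otimes>\<^bsub>R\<^esub> b) \<triangleright>\<^bsub>M\<^esub> x = a \<triangleright>\<^bsub>M\<^esub> (b \<triangleright>\<^bsub>M\<^esub> x)"
    and lsm_one: "x \<in> carrier M \<Longrightarrow> \<one>\<^bsub>R\<^esub> \<triangleright>\<^bsub>M\<^esub> x = x"

locale right_module = S?: ring S + M?: abelian_group M for S (structure) and M (structure) +
  assumes rsm_closed: "\<lbrakk>x \<in> carrier M; a \<in> carrier S\<rbrakk> \<Longrightarrow> x \<triangleleft>\<^bsub>M\<^esub> a \<in> carrier M"
    and rsm_r_distr: "\<lbrakk>x \<in> carrier M; a \<in> carrier S; b \<in> carrier S\<rbrakk>
          \<Longrightarrow> x \<triangleleft>\<^bsub>M\<^esub> (a \<oplus>\<^bsub>S\<^esub> b) = x \<triangleleft>\<^bsub>M\<^esub> a \<oplus>\<^bsub>M\<^esub> x \<triangleleft>\<^bsub>M\<^esub> b"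
    and rsm_l_distr: "\<lbrakk>x \<in> carrier M; y \<in> carrier M; a \<in> carrier S\<rbrakk>
          \<Longrightarrow> (x \<oplus>\<^bsub>M\<^esub> y) \<triangleleft>\<^bsub>M\<^esub> a = x \<triangleleft>\<^bsub>M\<^esub> a \<oplus>\<^bsub>M\<^esub> y \<triangleleft>\<^bsub>M\<^esub> a"
    and rsm_assoc: "\<lbrakk>x \<in> carrier M; a \<in> carrier S; b \<in> carrier S\<rbrakk>
          \<Longrightarrow> x \<triangleleft>\<^bsub>M\<^esub> (a \<otimes>\<^bsub>S\<^esub> b) = (x \<triangleleft>\<^bsub>M\<^esub> a) \<triangleleft>\<^bsub>M\<^esub> b"
    and rsm_one: "x \<in> carrier M \<Longrightarrow> x \<triangleleft>\<^bsub>M\<^esub> \<one>\<^bsub>S\<^esub> = x"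

locale bimodule = left_module R M + right_module S M
  for R (structure) and S (structure) and M (structure) +
  assumes lsm_rsm: "\<lbrakk>a \<in> carrier R; x \<in> carrier M; b \<in> carrier S\<rbrakk>
          \<Longrightarrow> (a \<triangleright>\<^bsub>M\<^esub> x) \<triangleleft>\<^bsub>M\<^esub> b = a \<triangleright>\<^bsub>M\<^esub> (x \<triangleleft>\<^bsub>M\<^esub> b)"

definition regular_bimod :: "('a, 'k) ring_scheme \<Rightarrow> ('a, 'a, 'a) bimod" where
  "regular_bimod R = \<lparr>carrier = carrier R, mult = mult R, one = one R,
     ring.zero = ring.zero R, add = add R,
     lsm = mult R, rsm = mult R\<rparr>"

abbreviation additive_maps ::
  "('m, 'k) ring_scheme \<Rightarrow> ('n, 'l) ring_scheme \<Rightarrow> ('m \<Rightarrow> 'n) set" where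
  "additive_maps M N \<equiv> hom (add_monoid M) (add_monoid N)"

definition left_linear :: "('r, 'k) ring_scheme \<Rightarrow> ('r, 's, 'm, 'z) bimod_scheme \<Rightarrow>
    ('r, 't, 'n, 'y) bimod_scheme \<Rightarrow> ('m \<Rightarrow> 'n) set" where
  "left_linear R M N = {f \<in> additive_maps M N.
     \<forall>a\<in>carrier R. \<forall>x\<in>carrier M. f (a \<triangleright>\<^bsub>M\<^esub> x) = a \<triangleright>\<^bsub>N\<^esub> f x}"

definition right_linear :: "('r, 'k) ring_scheme \<Rightarrow> ('s, 'r, 'm, 'z) bimod_scheme \<Rightarrow>
    ('t, 'r, 'n, 'y) bimod_scheme \<Rightarrow> ('m \<Rightarrow> 'n) set" where
  "right_linear R M N = {f \<in> additive_maps M N.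
     \<forall>a\<in>carrier R. \<forall>x\<in>carrier M. f (x \<triangleleft>\<^bsub>M\<^esub> a) = f x \<triangleleft>\<^bsub>N\<^esub> a}"

definition bilinear :: "('r, 'k) ring_scheme \<Rightarrow> ('s, 'l) ring_scheme \<Rightarrow>
    ('r, 's, 'm, 'z) bimod_scheme \<Rightarrow> ('r, 's, 'n, 'y) bimod_scheme \<Rightarrow> ('m \<Rightarrow> 'n) set" where
  "bilinear R S M N = left_linear R M N \<inter> right_linear S M N"

definition finitely_generated_right ::
  "('a, 'k) ring_scheme \<Rightarrow> ('l, 'a, 'm, 'z) bimod_scheme \<Rightarrow> bool" where
  "finitely_generated_right A M \<longleftrightarrow> (\<exists>G. finite G \<and> G \<subseteq> carrier M \<and>
     (\<forall>x\<in>carrier M. \<exists>a. a \<in> G \<rightarrow> carrier A \<and> x = (\<Oplus>\<^bsub>M\<^esub>g\<in>G. g \<triangleleft>\<^bsub>M\<^esub> a g)))"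

definition free_bimod :: "('a, 'k) ring_scheme \<Rightarrow> 'i set \<Rightarrow> ('a, 'a, 'i \<Rightarrow> 'a) bimod" where
  "free_bimod A I =
     \<lparr>carrier = {v \<in> I \<rightarrow>\<^sub>E carrier A. finite {i \<in> I. v i \<noteq> \<zero>\<^bsub>A\<^esub>}},
      mult = undefined, one = undefined,
      ring.zero = (\<lambda>i\<in>I. \<zero>\<^bsub>A\<^esub>), add = (\<lambda>v w. \<lambda>i\<in>I. v i \<oplus>\<^bsub>A\<^esub> w i),
      lsm = (\<lambda>a v. \<lambda>i\<in>I. a \<otimes>\<^bsub>A\<^esub> v i), rsm = (\<lambda>v a. \<lambda>i\<in>I. v i \<otimes>\<^bsub>A\<^esub> a)\<rparr>"

text \<open>Projective: a direct summand of a free module. Restricting the index set to the type of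
  elements of \<open>M\<close> loses nothing, since \<open>M\<close> is a quotient of the free module on its own
  carrier.\<close>

definition projective_right ::
  "('a, 'k) ring_scheme \<Rightarrow> ('l, 'a, 'm, 'z) bimod_scheme \<Rightarrow> bool" where
  "projective_right A M \<longleftrightarrow> (\<exists>(I :: 'm set) i p.
     i \<in> right_linear A M (free_bimod A I) \<and> p \<in> right_linear A (free_bimod A I) M \<and>
     (\<forall>x\<in>carrier M. p (i x) = x))"

section \<open>Tensor products\<close>

text \<open>\<open>M \<otimes>\<^sub>R N\<close> is the free abelian group on \<open>M \<times> N\<close> modulo the relations making
  \<open>(x, y) \<mapsto> x \<otimes> y\<close> biadditive and \<open>R\<close>-balanced.\<close>

definition tensor_relations :: "('r, 'k) ring_scheme \<Rightarrow> ('l, 'r, 'm, 'z) bimod_scheme \<Rightarrow>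
    ('r, 's, 'n, 'y) bimod_scheme \<Rightarrow> (('m \<times> 'n) \<Rightarrow>\<^sub>0 int) set" where
  "tensor_relations R M N =
     {frag_of (x \<oplus>\<^bsub>M\<^esub> x', y) - frag_of (x, y) - frag_of (x', y) | x x' y.
        x \<in> carrier M \<and> x' \<in> carrier M \<and> y \<in> carrier N} \<union>
     {frag_of (x, y \<oplus>\<^bsub>N\<^esub> y') - frag_of (x, y) - frag_of (x, y') | x y y'.
        x \<in> carrier M \<and> y \<in> carrier N \<and> y' \<in> carrier N} \<union>
     {frag_of (x \<triangleleft>\<^bsub>M\<^esub> a, y) - frag_of (x, a \<triangleright>\<^bsub>N\<^esub> y) | x a y.
        x \<in> carrier M \<and> a \<in> carrier R \<and> y \<in> carrier N}"

definition tensor_null :: "('r, 'k) ring_scheme \<Rightarrow> ('l, 'r, 'm, 'z) bimod_scheme \<Rightarrow>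
    ('r, 's, 'n, 'y) bimod_scheme \<Rightarrow> (('m \<times> 'n) \<Rightarrow>\<^sub>0 int) set" where
  "tensor_null R M N =
     generate (free_Abelian_group (carrier M \<times> carrier N)) (tensor_relations R M N)"

definition pure_tensor :: "('r, 'k) ring_scheme \<Rightarrow> ('l, 'r, 'm, 'z) bimod_scheme \<Rightarrow>
    ('r, 's, 'n, 'y) bimod_scheme \<Rightarrow> 'm \<Rightarrow> 'n \<Rightarrow> (('m \<times> 'n) \<Rightarrow>\<^sub>0 int) set" where
  "pure_tensor R M N x y =
     tensor_null R M N #>\<^bsub>free_Abelian_group (carrier M \<times> carrier N)\<^esub> frag_of (x, y)"

definition tensor_group :: "('r, 'k) ring_scheme \<Rightarrow> ('l, 'r, 'm, 'z) bimod_scheme \<Rightarrow>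
    ('r, 's, 'n, 'y) bimod_scheme \<Rightarrow> (('m \<times> 'n) \<Rightarrow>\<^sub>0 int) set ring" where
  "tensor_group R M N =
     (let G = free_Abelian_group (carrier M \<times> carrier N) Mod tensor_null R M N
      in \<lparr>carrier = carrier G, mult = undefined, one = undefined,
            ring.zero = one G, add = mult G\<rparr>)"

text \<open>The additive map \<open>M \<otimes>\<^sub>R N \<rightarrow> P\<close> induced by a biadditive \<open>R\<close>-balanced map \<open>b\<close>; for such
  \<open>b\<close> the choice of the representative \<open>w\<close> is immaterial. In Sweedler notation, if
  \<open>X = x\<^sub>1 \<otimes> x\<^sub>2\<close> (sum understood) then \<open>tensor_lift P b X\<close> is \<open>b x\<^sub>1 x\<^sub>2\<close>.\<close>

definition tensor_lift ::
  "('p, 'k) ring_scheme \<Rightarrow> ('m \<Rightarrow> 'n \<Rightarrow> 'p) \<Rightarrow> (('m \<times> 'n) \<Rightarrow>\<^sub>0 int) set \<Rightarrow> 'p" where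
  "tensor_lift P b X =
     (let w = (SOME w. w \<in> X)
      in \<Oplus>\<^bsub>P\<^esub>p\<in>Poly_Mapping.keys w. [Poly_Mapping.lookup w p] \<cdot>\<^bsub>P\<^esub> b (fst p) (snd p))"

text \<open>The map \<open>f \<otimes> g\<close>; the arguments \<open>R M N\<close> describe its codomain \<open>M \<otimes>\<^sub>R N\<close>.\<close>

definition tensor_map :: "('r, 'k) ring_scheme \<Rightarrow> ('l, 'r, 'm, 'z) bimod_scheme \<Rightarrow>
    ('r, 's, 'n, 'y) bimod_scheme \<Rightarrow> ('x \<Rightarrow> 'm) \<Rightarrow> ('v \<Rightarrow> 'n) \<Rightarrow>
    (('x \<times> 'v) \<Rightarrow>\<^sub>0 int) set \<Rightarrow> (('m \<times> 'n) \<Rightarrow>\<^sub>0 int) set" where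
  "tensor_map R M N f g =
     tensor_lift (tensor_group R M N) (\<lambda>x y. pure_tensor R M N (f x) (g y))"

definition tensor :: "('r, 'k) ring_scheme \<Rightarrow> ('l, 'r, 'm, 'z) bimod_scheme \<Rightarrow>
    ('r, 's, 'n, 'y) bimod_scheme \<Rightarrow> ('l, 's, (('m \<times> 'n) \<Rightarrow>\<^sub>0 int) set) bimod" where
  "tensor R M N =
     \<lparr>carrier = carrier (tensor_group R M N), mult = undefined, one = undefined,
      ring.zero = ring.zero (tensor_group R M N), add = add (tensor_group R M N),
      lsm = (\<lambda>a. tensor_map R M N (\<lambda>x. a \<triangleright>\<^bsub>M\<^esub> x) (\<lambda>y. y)),
      rsm = (\<lambda>z b. tensor_map R M N (\<lambda>x. x) (\<lambda>y. y \<triangleleft>\<^bsub>N\<^esub> b) z)\<rparr>"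

text \<open>The canonical map \<open>(M \<otimes>\<^sub>A N) \<otimes>\<^sub>A P \<rightarrow> M \<otimes>\<^sub>A (N \<otimes>\<^sub>A P)\<close>.\<close>

definition tensor_assoc :: "('a, 'k) ring_scheme \<Rightarrow> ('l, 'a, 'm, 'z) bimod_scheme \<Rightarrow>
    ('a, 'a, 'n, 'y) bimod_scheme \<Rightarrow> ('a, 's, 'p, 'x) bimod_scheme \<Rightarrow>
    (((('m \<times> 'n) \<Rightarrow>\<^sub>0 int) set \<times> 'p) \<Rightarrow>\<^sub>0 int) set \<Rightarrow>
    (('m \<times> (('n \<times> 'p) \<Rightarrow>\<^sub>0 int) set) \<Rightarrow>\<^sub>0 int) set" where
  "tensor_assoc A M N P =
     tensor_lift (tensor A M (tensor A N P))
       (\<lambda>z p. tensor_lift (tensor A M (tensor A N P))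
          (\<lambda>m n. pure_tensor A M (tensor A N P) m (pure_tensor A N P n p)) z)"

section \<open>Corings and comodules\<close>

locale coring = bimodule A A C for A (structure) and C (structure) +
  fixes \<Delta> and \<epsilon>
  assumes comult_bilinear: "\<Delta> \<in> bilinear A A C (tensor A C C)"
    and counit_bilinear: "\<epsilon> \<in> bilinear A A C (regular_bimod A)"
    and coassoc: "c \<in> carrier C \<Longrightarrow>
      tensor_assoc A C C C (tensor_map A (tensor A C C) C \<Delta> (\<lambda>x. x) (\<Delta> c))
      = tensor_map A C (tensor A C C) (\<lambda>x. x) \<Delta> (\<Delta> c)"
    and counit_left: "c \<in> carrier C \<Longrightarrow> tensor_lift C (\<lambda>x y. \<epsilon> x \<triangleright>\<^bsub>C\<^esub> y) (\<Delta> c) = c"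
    and counit_right: "c \<in> carrier C \<Longrightarrow> tensor_lift C (\<lambda>x y. x \<triangleleft>\<^bsub>C\<^esub> \<epsilon> y) (\<Delta> c) = c"

locale right_comodule = coring A C \<Delta> \<epsilon> + P?: right_module A \<Sigma>
  for A (structure) and C (structure) and \<Delta> and \<epsilon> and \<Sigma> (structure) +
  fixes \<rho>
  assumes coact_linear: "\<rho> \<in> right_linear A \<Sigma> (tensor A \<Sigma> C)"
    and coact_coassoc: "u \<in> carrier \<Sigma> \<Longrightarrow>
      tensor_assoc A \<Sigma> C C (tensor_map A (tensor A \<Sigma> C) C \<rho> (\<lambda>x. x) (\<rho> u))
      = tensor_map A \<Sigma> (tensor A C C) (\<lambda>x. x) \<Delta> (\<rho> u)"
    and coact_counit: "u \<in> carrier \<Sigma> \<Longrightarrow> tensor_lift \<Sigma> (\<lambda>v c. v \<triangleleft>\<^bsub>\<Sigma>\<^esub> \<epsilon> c) (\<rho> u) = u"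

text \<open>Homomorphisms are functions that are \<open>undefined\<close> outside the carrier of their domain, so
  that equality of homomorphisms is equality of functions.\<close>

definition right_colinear_maps :: "('a, 'k) ring_scheme \<Rightarrow> ('a, 'a, 'c, 'z) bimod_scheme \<Rightarrow>
    ('l, 'a, 'm, 'y) bimod_scheme \<Rightarrow> ('m \<Rightarrow> (('m \<times> 'c) \<Rightarrow>\<^sub>0 int) set) \<Rightarrow>
    ('t, 'a, 'n, 'x) bimod_scheme \<Rightarrow> ('n \<Rightarrow> (('n \<times> 'c) \<Rightarrow>\<^sub>0 int) set) \<Rightarrow> ('m \<Rightarrow> 'n) set" where
  "right_colinear_maps A C M \<rho>\<^sub>M N \<rho>\<^sub>N = {f \<in> right_linear A M N \<inter> extensional (carrier M).
     \<forall>m\<in>carrier M. \<rho>\<^sub>N (f m) = tensor_map A N C f (\<lambda>c. c) (\<rho>\<^sub>M m)}"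

definition left_colinear_maps :: "('a, 'k) ring_scheme \<Rightarrow> ('a, 'a, 'c, 'z) bimod_scheme \<Rightarrow>
    ('a, 'l, 'm, 'y) bimod_scheme \<Rightarrow> ('m \<Rightarrow> (('c \<times> 'm) \<Rightarrow>\<^sub>0 int) set) \<Rightarrow>
    ('a, 't, 'n, 'x) bimod_scheme \<Rightarrow> ('n \<Rightarrow> (('c \<times> 'n) \<Rightarrow>\<^sub>0 int) set) \<Rightarrow> ('m \<Rightarrow> 'n) set" where
  "left_colinear_maps A C M \<rho>\<^sub>M N \<rho>\<^sub>N = {f \<in> left_linear A M N \<inter> extensional (carrier M).
     \<forall>m\<in>carrier M. \<rho>\<^sub>N (f m) = tensor_map A C N (\<lambda>c. c) f (\<rho>\<^sub>M m)}"

text \<open>The element \<open>c\<^sub>1 f(c\<^sub>2)\<close> of \<open>C\<close>.\<close>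

definition coring_hit :: "('a, 'a, 'c, 'z) bimod_scheme \<Rightarrow> ('c \<Rightarrow> (('c \<times> 'c) \<Rightarrow>\<^sub>0 int) set) \<Rightarrow>
    ('c \<Rightarrow> 'a) \<Rightarrow> 'c \<Rightarrow> 'c" where
  "coring_hit C \<Delta> f c = tensor_lift C (\<lambda>x y. x \<triangleleft>\<^bsub>C\<^esub> f y) (\<Delta> c)"

text \<open>The ring \<open>\<^sup>*C\<close>; its unit is the counit.\<close>

definition left_dual_ring :: "('a, 'k) ring_scheme \<Rightarrow> ('a, 'a, 'c, 'z) bimod_scheme \<Rightarrow>
    ('c \<Rightarrow> (('c \<times> 'c) \<Rightarrow>\<^sub>0 int) set) \<Rightarrow> ('c \<Rightarrow> 'a) \<Rightarrow> ('c \<Rightarrow> 'a) ring" where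
  "left_dual_ring A C \<Delta> \<epsilon> =
     \<lparr>carrier = left_linear A C (regular_bimod A) \<inter> extensional (carrier C),
      mult = (\<lambda>f g. \<lambda>c\<in>carrier C. g (coring_hit C \<Delta> f c)),
      one = (\<lambda>c\<in>carrier C. \<epsilon> c),
      ring.zero = (\<lambda>c\<in>carrier C. \<zero>\<^bsub>A\<^esub>),
      add = (\<lambda>f g. \<lambda>c\<in>carrier C. f c \<oplus>\<^bsub>A\<^esub> g c)\<rparr>"

definition locally_projective_left ::
  "('a, 'k) ring_scheme \<Rightarrow> ('a, 'r, 'c, 'z) bimod_scheme \<Rightarrow> bool" where
  "locally_projective_left A C \<longleftrightarrow> (\<forall>D. finite D \<and> D \<subseteq> carrier C \<longrightarrow>
     (\<exists>(n::nat) f x.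
        (\<forall>i<n. f i \<in> left_linear A C (regular_bimod A) \<inter> extensional (carrier C) \<and>
               x i \<in> carrier C) \<and>
        (\<forall>d\<in>D. d = (\<Oplus>\<^bsub>C\<^esub>i\<in>{..<n}. f i d \<triangleright>\<^bsub>C\<^esub> x i))))"

section \<open>The dual of a comodule\<close>

text \<open>\<open>\<Sigma>\<^sup>*\<close>, with its left \<open>A\<close>-action and the right action \<open>f \<circ> t\<close> of endomorphisms \<open>t\<close> of
  \<open>\<Sigma>\<close>.\<close>

definition right_dual :: "('a, 'k) ring_scheme \<Rightarrow> ('l, 'a, 's, 'z) bimod_scheme \<Rightarrow>
    ('a, 's \<Rightarrow> 's, 's \<Rightarrow> 'a) bimod" where
  "right_dual A \<Sigma> =
     \<lparr>carrier = right_linear A \<Sigma> (regular_bimod A) \<inter> extensional (carrier \<Sigma>),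
      mult = undefined, one = undefined,
      ring.zero = (\<lambda>u\<in>carrier \<Sigma>. \<zero>\<^bsub>A\<^esub>),
      add = (\<lambda>f g. \<lambda>u\<in>carrier \<Sigma>. f u \<oplus>\<^bsub>A\<^esub> g u),
      lsm = (\<lambda>a f. \<lambda>u\<in>carrier \<Sigma>. a \<otimes>\<^bsub>A\<^esub> f u),
      rsm = (\<lambda>f t. compose (carrier \<Sigma>) f t)\<rparr>"

definition is_dual_basis :: "('a, 'k) ring_scheme \<Rightarrow> ('l, 'a, 's, 'z) bimod_scheme \<Rightarrow>
    nat \<Rightarrow> (nat \<Rightarrow> 's) \<Rightarrow> (nat \<Rightarrow> 's \<Rightarrow> 'a) \<Rightarrow> bool" where
  "is_dual_basis A \<Sigma> n e \<phi> \<longleftrightarrow>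
     (\<forall>i<n. e i \<in> carrier \<Sigma> \<and> \<phi> i \<in> carrier (right_dual A \<Sigma>)) \<and>
     (\<forall>u\<in>carrier \<Sigma>. u = (\<Oplus>\<^bsub>\<Sigma>\<^esub>i\<in>{..<n}. e i \<triangleleft>\<^bsub>\<Sigma>\<^esub> \<phi> i u))"

text \<open>The left coaction \<open>\<rho>\<^sup>l\<close> on \<open>\<Sigma>\<^sup>*\<close>. All dual bases represent the same element of
  \<open>\<Sigma> \<otimes>\<^sub>A \<Sigma>\<^sup>*\<close>, so the choice is immaterial.\<close>

definition dual_coaction :: "('a, 'k) ring_scheme \<Rightarrow> ('a, 'a, 'c, 'y) bimod_scheme \<Rightarrow>
    ('l, 'a, 's, 'z) bimod_scheme \<Rightarrow> ('s \<Rightarrow> (('s \<times> 'c) \<Rightarrow>\<^sub>0 int) set) \<Rightarrow>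
    ('s \<Rightarrow> 'a) \<Rightarrow> (('c \<times> ('s \<Rightarrow> 'a)) \<Rightarrow>\<^sub>0 int) set" where
  "dual_coaction A C \<Sigma> \<rho> f =
     (case (SOME (n, e, \<phi>). is_dual_basis A \<Sigma> n e \<phi>) of (n, e, \<phi>) \<Rightarrow>
        \<Oplus>\<^bsub>tensor A C (right_dual A \<Sigma>)\<^esub>i\<in>{..<n}.
          pure_tensor A C (right_dual A \<Sigma>)
            (tensor_lift C (\<lambda>v c. f v \<triangleright>\<^bsub>C\<^esub> c) (\<rho> (e i))) (\<phi> i))"

section \<open>Morita contexts\<close>

record ('r, 's, 'm, 'n) morita =
  ring1 :: "'r ring"
  ring2 :: "'s ring"
  bimod12 :: "('r, 's, 'm) bimod"
  bimod21 :: "('s, 'r, 'n) bimod"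
  conn1 :: "(('m \<times> 'n) \<Rightarrow>\<^sub>0 int) set \<Rightarrow> 'r"
  conn2 :: "(('n \<times> 'm) \<Rightarrow>\<^sub>0 int) set \<Rightarrow> 's"

definition morita_context :: "('r, 's, 'm, 'n) morita \<Rightarrow> bool" where
  "morita_context X \<longleftrightarrow>
     (let R = ring1 X; S = ring2 X; M = bimod12 X; N = bimod21 X; \<tau> = conn1 X; \<mu> = conn2 X in
        ring R \<and> ring S \<and> bimodule R S M \<and> bimodule S R N \<and>
        \<tau> \<in> bilinear R R (tensor S M N) (regular_bimod R) \<and>
        \<mu> \<in> bilinear S S (tensor R N M) (regular_bimod S) \<and>
        (\<forall>m\<in>carrier M. \<forall>n\<in>carrier N. \<forall>m'\<in>carrier M.
           \<tau> (pure_tensor S M N m n) \<triangleright>\<^bsub>M\<^esub> m' = m \<triangleleft>\<^bsub>M\<^esub> \<mu> (pure_tensor R N M n m')) \<and>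
        (\<forall>n\<in>carrier N. \<forall>m\<in>carrier M. \<forall>n'\<in>carrier N.
           \<mu> (pure_tensor R N M n m) \<triangleright>\<^bsub>N\<^esub> n' = n \<triangleleft>\<^bsub>N\<^esub> \<tau> (pure_tensor S M N m n')))"

definition morita_morphism :: "('r, 's, 'm, 'n) morita \<Rightarrow> ('r', 's', 'm', 'n') morita \<Rightarrow>
    ('r \<Rightarrow> 'r') \<Rightarrow> ('s \<Rightarrow> 's') \<Rightarrow> ('m \<Rightarrow> 'm') \<Rightarrow> ('n \<Rightarrow> 'n') \<Rightarrow> bool" where
  "morita_morphism X Y \<phi> \<psi> f g \<longleftrightarrow>
     (let R = ring1 X; S = ring2 X; M = bimod12 X; N = bimod21 X;
          R' = ring1 Y; S' = ring2 Y; M' = bimod12 Y; N' = bimod21 Y in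
        morita_context X \<and> morita_context Y \<and>
        \<phi> \<in> ring_hom R R' \<and> \<psi> \<in> ring_hom S S' \<and>
        f \<in> additive_maps M M' \<and> g \<in> additive_maps N N' \<and>
        (\<forall>r\<in>carrier R. \<forall>m\<in>carrier M. f (r \<triangleright>\<^bsub>M\<^esub> m) = \<phi> r \<triangleright>\<^bsub>M'\<^esub> f m) \<and>
        (\<forall>m\<in>carrier M. \<forall>s\<in>carrier S. f (m \<triangleleft>\<^bsub>M\<^esub> s) = f m \<triangleleft>\<^bsub>M'\<^esub> \<psi> s) \<and>
        (\<forall>s\<in>carrier S. \<forall>n\<in>carrier N. g (s \<triangleright>\<^bsub>N\<^esub> n) = \<psi> s \<triangleright>\<^bsub>N'\<^esub> g n) \<and>
        (\<forall>n\<in>carrier N. \<forall>r\<in>carrier R. g (n \<triangleleft>\<^bsub>N\<^esub> r) = g n \<triangleleft>\<^bsub>N'\<^esub> \<phi> r) \<and>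
        (\<forall>z\<in>carrier (tensor S M N). \<phi> (conn1 X z) = conn1 Y (tensor_map S' M' N' f g z)) \<and>
        (\<forall>z\<in>carrier (tensor R N M). \<psi> (conn2 X z) = conn2 Y (tensor_map R' N' M' g f z)))"

definition morita_isomorphism :: "('r, 's, 'm, 'n) morita \<Rightarrow> ('r', 's', 'm', 'n') morita \<Rightarrow>
    ('r \<Rightarrow> 'r') \<Rightarrow> ('s \<Rightarrow> 's') \<Rightarrow> ('m \<Rightarrow> 'm') \<Rightarrow> ('n \<Rightarrow> 'n') \<Rightarrow> bool" where
  "morita_isomorphism X Y \<phi> \<psi> f g \<longleftrightarrow>
     morita_morphism X Y \<phi> \<psi> f g \<and>
     bij_betw \<phi> (carrier (ring1 X)) (carrier (ring1 Y)) \<and>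
     bij_betw \<psi> (carrier (ring2 X)) (carrier (ring2 Y)) \<and>
     bij_betw f (carrier (bimod12 X)) (carrier (bimod12 Y)) \<and>
     bij_betw g (carrier (bimod21 X)) (carrier (bimod21 Y))"

section \<open>The two Morita contexts of a comodule\<close>

text \<open>\<open>\<Sigma>\<close> as a bimodule over a ring of endomorphisms of \<open>\<Sigma>\<close> (acting by evaluation) and the ring
  \<open>\<^sup>*C\<close> (acting by \<open>u \<cdot> f = u\<^sub>0 f(u\<^sub>1)\<close>).\<close>

definition comodule_bimod :: "('l, 'a, 's, 'z) bimod_scheme \<Rightarrow>
    ('s \<Rightarrow> (('s \<times> 'c) \<Rightarrow>\<^sub>0 int) set) \<Rightarrow> ('s \<Rightarrow> 's, 'c \<Rightarrow> 'a, 's) bimod" where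
  "comodule_bimod \<Sigma> \<rho> =
     \<lparr>carrier = carrier \<Sigma>, mult = undefined, one = undefined,
      ring.zero = ring.zero \<Sigma>, add = add \<Sigma>,
      lsm = (\<lambda>t u. t u),
      rsm = (\<lambda>u f. tensor_lift \<Sigma> (\<lambda>v c. v \<triangleleft>\<^bsub>\<Sigma>\<^esub> f c) (\<rho> u))\<rparr>"

definition endo_ring :: "('s, 'z) ring_scheme \<Rightarrow> ('s \<Rightarrow> 's) set \<Rightarrow> ('s \<Rightarrow> 's) ring" where
  "endo_ring \<Sigma> K =
     \<lparr>carrier = K, mult = compose (carrier \<Sigma>), one = (\<lambda>u\<in>carrier \<Sigma>. u),
      ring.zero = (\<lambda>u\<in>carrier \<Sigma>. \<zero>\<^bsub>\<Sigma>\<^esub>), add = (\<lambda>s t. \<lambda>u\<in>carrier \<Sigma>. s u \<oplus>\<^bsub>\<Sigma>\<^esub> t u)\<rparr>"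

definition T_ring :: "('a, 'k) ring_scheme \<Rightarrow> ('a, 'a, 'c, 'y) bimod_scheme \<Rightarrow>
    ('l, 'a, 's, 'z) bimod_scheme \<Rightarrow> ('s \<Rightarrow> (('s \<times> 'c) \<Rightarrow>\<^sub>0 int) set) \<Rightarrow> ('s \<Rightarrow> 's) ring" where
  "T_ring A C \<Sigma> \<rho> = endo_ring \<Sigma> (right_colinear_maps A C \<Sigma> \<rho> \<Sigma> \<rho>)"

definition Q_bimod :: "('a, 'k) ring_scheme \<Rightarrow> ('a, 'a, 'c, 'y) bimod_scheme \<Rightarrow>
    ('c \<Rightarrow> (('c \<times> 'c) \<Rightarrow>\<^sub>0 int) set) \<Rightarrow>
    ('l, 'a, 's, 'z) bimod_scheme \<Rightarrow> ('s \<Rightarrow> (('s \<times> 'c) \<Rightarrow>\<^sub>0 int) set) \<Rightarrow>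
    ('c \<Rightarrow> 'a, 's \<Rightarrow> 's, 'c \<Rightarrow> 's \<Rightarrow> 'a) bimod" where
  "Q_bimod A C \<Delta> \<Sigma> \<rho> =
     \<lparr>carrier = left_colinear_maps A C C \<Delta> (right_dual A \<Sigma>) (dual_coaction A C \<Sigma> \<rho>),
      mult = undefined, one = undefined,
      ring.zero = (\<lambda>c\<in>carrier C. \<zero>\<^bsub>right_dual A \<Sigma>\<^esub>),
      add = (\<lambda>q q'. \<lambda>c\<in>carrier C. q c \<oplus>\<^bsub>right_dual A \<Sigma>\<^esub> q' c),
      lsm = (\<lambda>f q. \<lambda>c\<in>carrier C. q (coring_hit C \<Delta> f c)),
      rsm = (\<lambda>q t. \<lambda>c\<in>carrier C. compose (carrier \<Sigma>) (q c) t)\<rparr>"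

definition comodule_context :: "('a, 'k) ring_scheme \<Rightarrow> ('a, 'a, 'c, 'y) bimod_scheme \<Rightarrow>
    ('c \<Rightarrow> (('c \<times> 'c) \<Rightarrow>\<^sub>0 int) set) \<Rightarrow> ('c \<Rightarrow> 'a) \<Rightarrow>
    ('l, 'a, 's, 'z) bimod_scheme \<Rightarrow> ('s \<Rightarrow> (('s \<times> 'c) \<Rightarrow>\<^sub>0 int) set) \<Rightarrow>
    ('s \<Rightarrow> 's, 'c \<Rightarrow> 'a, 's, 'c \<Rightarrow> 's \<Rightarrow> 'a) morita" where
  "comodule_context A C \<Delta> \<epsilon> \<Sigma> \<rho> =
     \<lparr>ring1 = T_ring A C \<Sigma> \<rho>,
      ring2 = left_dual_ring A C \<Delta> \<epsilon>,
      bimod12 = comodule_bimod \<Sigma> \<rho>,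
      bimod21 = Q_bimod A C \<Delta> \<Sigma> \<rho>,
      conn1 = tensor_lift (T_ring A C \<Sigma> \<rho>)
        (\<lambda>u q. \<lambda>v\<in>carrier \<Sigma>. tensor_lift \<Sigma> (\<lambda>w c. w \<triangleleft>\<^bsub>\<Sigma>\<^esub> q c v) (\<rho> u)),
      conn2 = tensor_lift (left_dual_ring A C \<Delta> \<epsilon>) (\<lambda>q u. \<lambda>c\<in>carrier C. q c u)\<rparr>"

definition T_tilde_ring :: "('a, 'k) ring_scheme \<Rightarrow> ('a, 'a, 'c, 'y) bimod_scheme \<Rightarrow>
    ('c \<Rightarrow> (('c \<times> 'c) \<Rightarrow>\<^sub>0 int) set) \<Rightarrow> ('c \<Rightarrow> 'a) \<Rightarrow>
    ('l, 'a, 's, 'z) bimod_scheme \<Rightarrow> ('s \<Rightarrow> (('s \<times> 'c) \<Rightarrow>\<^sub>0 int) set) \<Rightarrow> ('s \<Rightarrow> 's) ring" where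
  "T_tilde_ring A C \<Delta> \<epsilon> \<Sigma> \<rho> = endo_ring \<Sigma>
     (right_linear (left_dual_ring A C \<Delta> \<epsilon>) (comodule_bimod \<Sigma> \<rho>) (comodule_bimod \<Sigma> \<rho>)
      \<inter> extensional (carrier \<Sigma>))"

definition Q_tilde_bimod :: "('a, 'k) ring_scheme \<Rightarrow> ('a, 'a, 'c, 'y) bimod_scheme \<Rightarrow>
    ('c \<Rightarrow> (('c \<times> 'c) \<Rightarrow>\<^sub>0 int) set) \<Rightarrow> ('c \<Rightarrow> 'a) \<Rightarrow>
    ('l, 'a, 's, 'z) bimod_scheme \<Rightarrow> ('s \<Rightarrow> (('s \<times> 'c) \<Rightarrow>\<^sub>0 int) set) \<Rightarrow>
    ('c \<Rightarrow> 'a, 's \<Rightarrow> 's, 's \<Rightarrow> 'c \<Rightarrow> 'a) bimod" where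
  "Q_tilde_bimod A C \<Delta> \<epsilon> \<Sigma> \<rho> =
     (let S = left_dual_ring A C \<Delta> \<epsilon> in
      \<lparr>carrier = right_linear S (comodule_bimod \<Sigma> \<rho>) (regular_bimod S) \<inter> extensional (carrier \<Sigma>),
       mult = undefined, one = undefined,
       ring.zero = (\<lambda>u\<in>carrier \<Sigma>. \<zero>\<^bsub>S\<^esub>),
       add = (\<lambda>k l. \<lambda>u\<in>carrier \<Sigma>. k u \<oplus>\<^bsub>S\<^esub> l u),
       lsm = (\<lambda>f k. \<lambda>u\<in>carrier \<Sigma>. f \<otimes>\<^bsub>S\<^esub> k u),
       rsm = (\<lambda>k t. compose (carrier \<Sigma>) k t)\<rparr>)"

definition dual_module_context :: "('a, 'k) ring_scheme \<Rightarrow> ('a, 'a, 'c, 'y) bimod_scheme \<Rightarrow>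
    ('c \<Rightarrow> (('c \<times> 'c) \<Rightarrow>\<^sub>0 int) set) \<Rightarrow> ('c \<Rightarrow> 'a) \<Rightarrow>
    ('l, 'a, 's, 'z) bimod_scheme \<Rightarrow> ('s \<Rightarrow> (('s \<times> 'c) \<Rightarrow>\<^sub>0 int) set) \<Rightarrow>
    ('s \<Rightarrow> 's, 'c \<Rightarrow> 'a, 's, 's \<Rightarrow> 'c \<Rightarrow> 'a) morita" where
  "dual_module_context A C \<Delta> \<epsilon> \<Sigma> \<rho> =
     \<lparr>ring1 = T_tilde_ring A C \<Delta> \<epsilon> \<Sigma> \<rho>,
      ring2 = left_dual_ring A C \<Delta> \<epsilon>,
      bimod12 = comodule_bimod \<Sigma> \<rho>,
      bimod21 = Q_tilde_bimod A C \<Delta> \<epsilon> \<Sigma> \<rho>,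
      conn1 = tensor_lift (T_tilde_ring A C \<Delta> \<epsilon> \<Sigma> \<rho>)
        (\<lambda>u k. \<lambda>v\<in>carrier \<Sigma>. u \<triangleleft>\<^bsub>comodule_bimod \<Sigma> \<rho>\<^esub> k v),
      conn2 = tensor_lift (left_dual_ring A C \<Delta> \<epsilon>) (\<lambda>k u. k u)\<rparr>"

definition alpha_map :: "('a, 'a, 'c, 'y) bimod_scheme \<Rightarrow> ('l, 'a, 's, 'z) bimod_scheme \<Rightarrow>
    ('c \<Rightarrow> 's \<Rightarrow> 'a) \<Rightarrow> 's \<Rightarrow> 'c \<Rightarrow> 'a" where
  "alpha_map C \<Sigma> q = (\<lambda>u\<in>carrier \<Sigma>. \<lambda>c\<in>carrier C. q c u)"

end

theory Submission
  imports Defs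
begin

text \<open>
  The two Morita contexts share the ring \<open>\<^sup>*C\<close> and the bimodule \<open>\<Sigma>\<close>, so the first one can be realized
  inside the second, which is a Morita context by general module theory (\<open>morita_context_module\<close>). It is
  enough to know that \<open>T\<close> is a subring of \<open>End(\<Sigma>)\<close>, that \<open>Q\<close> is a group stable under the actions of \<open>\<^sup>*C\<close> and
  \<open>T\<close>, that \<open>\<alpha>\<close> is injective and compatible with the actions, and that \<open>\<tau>\<close> takes values in \<open>T\<close>
  (\<open>morita_morphism_subcontext\<close>).

  The key is a pointwise description of \<open>Q\<close>. A finite dual basis of \<open>\<Sigma>\<close> exists (\<open>ex_dual_basis\<close>), hence
  \<open>C \<otimes>\<^sub>A \<Sigma>\<^sup>*\<close> embeds into the maps \<open>\<Sigma> \<rightarrow> C\<close> by \<open>c \<otimes> f \<mapsto> (u \<mapsto> c f(u))\<close>, and the coaction of \<open>\<Sigma>\<^sup>*\<close> becomes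
  \<open>f \<mapsto> (u \<mapsto> f(u\<^sub>0) u\<^sub>1)\<close>. So a left linear map \<open>q\<close> is colinear iff \<open>q(c)(u\<^sub>0) u\<^sub>1 = c\<^sub>1 q(c\<^sub>2)(u)\<close> for all \<open>c\<close> and \<open>u\<close>
  (\<open>Q_iff\<close>). Applying \<open>f \<in> \<^sup>*C\<close> to this equation gives \<open>\<alpha>(q)(u \<cdot> f) = \<alpha>(q)(u) # f\<close>, and tensoring it with
  \<open>u'\<^sub>0\<close>, at \<open>c = u'\<^sub>1\<close>, gives the colinearity of \<open>\<tau>(u' \<otimes> q)\<close> (\<open>tau_colinear\<close>). Coassociativity enters through
  \<open>\<rho>(u \<cdot> f) = u\<^sub>0 \<otimes> u\<^sub>1 f(u\<^sub>2)\<close> (\<open>coact_act\<close>).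

  If \<open>C\<close> is locally projective, then functionals separate the elements of \<open>C\<close> and of \<open>\<Sigma> \<otimes>\<^sub>A C\<close>. Thus
  \<open>\<^sup>*C\<close>-linearity, which is colinearity after applying all functionals, implies colinearity: \<open>T\<close> is all of
  \<open>End(\<Sigma>)\<close> (\<open>endos_eq_T\<close>) and \<open>\<alpha>\<close> is onto (\<open>alpha_surj\<close>).
\<close>

section \<open>Additive maps\<close>

lemma additive_mapsI:
  assumes "\<And>x. x \<in> carrier M \<Longrightarrow> h x \<in> carrier N"
    and "\<And>x y. \<lbrakk>x \<in> carrier M; y \<in> carrier M\<rbrakk> \<Longrightarrow> h (x \<oplus>\<^bsub>M\<^esub> y) = h x \<oplus>\<^bsub>N\<^esub> h y"
  shows "h \<in> additive_maps M N"
  using assms by (auto simp: hom_def)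

lemma additive_maps_closed:
  "\<lbrakk>h \<in> additive_maps M N; x \<in> carrier M\<rbrakk> \<Longrightarrow> h x \<in> carrier N"
  by (auto simp: hom_def)

lemma additive_maps_add:
  "\<lbrakk>h \<in> additive_maps M N; x \<in> carrier M; y \<in> carrier M\<rbrakk> \<Longrightarrow> h (x \<oplus>\<^bsub>M\<^esub> y) = h x \<oplus>\<^bsub>N\<^esub> h y"
  by (auto simp: hom_def)

lemma additive_maps_group_hom:
  assumes "abelian_group M" "abelian_group N" "h \<in> additive_maps M N"
  shows "group_hom (add_monoid M) (add_monoid N) h"
  using assms by (simp add: group_hom_def group_hom_axioms_def abelian_group.a_group)

lemma additive_maps_zero:
  assumes "abelian_group M" "abelian_group N" "h \<in> additive_maps M N"
  shows "h \<zero>\<^bsub>M\<^esub> = \<zero>\<^bsub>N\<^esub>"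
  using group_hom.hom_one[OF additive_maps_group_hom[OF assms]] by simp

lemma additive_maps_minus:
  assumes "abelian_group M" "abelian_group N" "h \<in> additive_maps M N" "x \<in> carrier M"
  shows "h (\<ominus>\<^bsub>M\<^esub> x) = \<ominus>\<^bsub>N\<^esub> h x"
  using group_hom.hom_inv[OF additive_maps_group_hom[OF assms(1-3)]] assms(4)
  by (simp add: a_inv_def)

lemma additive_maps_comp:
  assumes "g \<in> additive_maps M N" "h \<in> additive_maps N P"
  shows "(\<lambda>x. h (g x)) \<in> additive_maps M P"
  using hom_compose[OF assms] by (simp add: comp_def)

lemma additive_maps_plus:
  assumes "abelian_group N" "g \<in> additive_maps M N" "h \<in> additive_maps M N"
  shows "(\<lambda>x. g x \<oplus>\<^bsub>N\<^esub> h x) \<in> additive_maps M N"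
proof -
  interpret N: abelian_group N by fact
  show ?thesis
    by (rule additive_mapsI) (use assms(2,3) in \<open>auto simp: additive_maps_add additive_maps_closed N.add.m_ac\<close>)
qed

lemma additive_maps_finsum:
  assumes M: "abelian_group M" and N: "abelian_group N" and h: "h \<in> additive_maps M N"
    and fin: "finite I" and g: "\<And>i. i \<in> I \<Longrightarrow> g i \<in> carrier M"
  shows "h (\<Oplus>\<^bsub>M\<^esub>i\<in>I. g i) = (\<Oplus>\<^bsub>N\<^esub>i\<in>I. h (g i))"
proof -
  interpret M: abelian_group M by fact
  interpret N: abelian_group N by fact
  show ?thesis using fin g
  proof (induction I rule: finite_induct)
    case empty
    then show ?case using additive_maps_zero[OF M N h] by simp
  next
    case (insert i I)
    then show ?case
      by (simp add: M.finsum_insert N.finsum_insert additive_maps_add[OF h] additive_maps_closed[OF h])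
  qed
qed

section \<open>The universal property of the tensor product\<close>

text \<open>Biadditive maps that are balanced over the middle ring.\<close>

definition balanced :: "('r, 'k) ring_scheme \<Rightarrow> ('l, 'r, 'm, 'z) bimod_scheme \<Rightarrow>
    ('r, 's, 'n, 'y) bimod_scheme \<Rightarrow> ('p, 'q) ring_scheme \<Rightarrow> ('m \<Rightarrow> 'n \<Rightarrow> 'p) \<Rightarrow> bool" where
  "balanced R M N P b \<longleftrightarrow>
     (\<forall>x\<in>carrier M. b x \<in> additive_maps N P) \<and>
     (\<forall>y\<in>carrier N. (\<lambda>x. b x y) \<in> additive_maps M P) \<and>
     (\<forall>x\<in>carrier M. \<forall>a\<in>carrier R. \<forall>y\<in>carrier N. b (x \<triangleleft>\<^bsub>M\<^esub> a) y = b x (a \<triangleright>\<^bsub>N\<^esub> y))"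

lemma balancedI:
  assumes "\<And>x y. \<lbrakk>x \<in> carrier M; y \<in> carrier N\<rbrakk> \<Longrightarrow> b x y \<in> carrier P"
    and "\<And>x y y'. \<lbrakk>x \<in> carrier M; y \<in> carrier N; y' \<in> carrier N\<rbrakk>
      \<Longrightarrow> b x (y \<oplus>\<^bsub>N\<^esub> y') = b x y \<oplus>\<^bsub>P\<^esub> b x y'"
    and "\<And>x x' y. \<lbrakk>x \<in> carrier M; x' \<in> carrier M; y \<in> carrier N\<rbrakk>
      \<Longrightarrow> b (x \<oplus>\<^bsub>M\<^esub> x') y = b x y \<oplus>\<^bsub>P\<^esub> b x' y"
    and "\<And>x a y. \<lbrakk>x \<in> carrier M; a \<in> carrier R; y \<in> carrier N\<rbrakk>
      \<Longrightarrow> b (x \<triangleleft>\<^bsub>M\<^esub> a) y = b x (a \<triangleright>\<^bsub>N\<^esub> y)"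
  shows "balanced R M N P b"
  unfolding balanced_def using assms by (auto intro!: additive_mapsI)

lemma balancedD:
  assumes "balanced R M N P b"
  shows balanced_closed: "\<lbrakk>x \<in> carrier M; y \<in> carrier N\<rbrakk> \<Longrightarrow> b x y \<in> carrier P"
    and balanced_right: "\<lbrakk>x \<in> carrier M; y \<in> carrier N; y' \<in> carrier N\<rbrakk>
      \<Longrightarrow> b x (y \<oplus>\<^bsub>N\<^esub> y') = b x y \<oplus>\<^bsub>P\<^esub> b x y'"
    and balanced_left: "\<lbrakk>x \<in> carrier M; x' \<in> carrier M; y \<in> carrier N\<rbrakk>
      \<Longrightarrow> b (x \<oplus>\<^bsub>M\<^esub> x') y = b x y \<oplus>\<^bsub>P\<^esub> b x' y"
    and balanced_middle: "\<lbrakk>x \<in> carrier M; a \<in> carrier R; y \<in> carrier N\<rbrakk>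
      \<Longrightarrow> b (x \<triangleleft>\<^bsub>M\<^esub> a) y = b x (a \<triangleright>\<^bsub>N\<^esub> y)"
  using assms unfolding balanced_def
  by (auto simp: additive_maps_closed dest: bspec additive_maps_add[of _ N P] additive_maps_add[of _ M P])

lemma balanced_additive_right: "balanced R M N P b \<Longrightarrow> x \<in> carrier M \<Longrightarrow> b x \<in> additive_maps N P"
  and balanced_additive_left: "balanced R M N P b \<Longrightarrow> y \<in> carrier N \<Longrightarrow> (\<lambda>x. b x y) \<in> additive_maps M P"
  by (auto simp: balanced_def)

lemma balanced_comp:
  assumes "balanced R M N P b" "h \<in> additive_maps P Q"
  shows "balanced R M N Q (\<lambda>x y. h (b x y))"
  by (rule balancedI)
    (simp_all add: balancedD[OF assms(1)] additive_maps_add[OF assms(2)] additive_maps_closed[OF assms(2)])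

lemma balanced_cong:
  assumes "balanced R M N P b" "\<And>x y. \<lbrakk>x \<in> carrier M; y \<in> carrier N\<rbrakk> \<Longrightarrow> b x y = b' x y"
    "right_module R M" "left_module R N"
  shows "balanced R M N P b'"
proof -
  interpret M: right_module R M by fact
  interpret N: left_module R N by fact
  show ?thesis
    using assms(1,2) by (intro balancedI)
     (simp_all flip: assms(2) add: balancedD[OF assms(1)] M.rsm_closed N.lsm_closed)
qed

text \<open>A right and a left module over the same ring \<open>R\<close>. The group \<open>M \<otimes>\<^sub>R N\<close> consists of the cosets
  \<open>cls w\<close> of the subgroup \<open>K\<close> of relations in the free abelian group \<open>F\<close> on \<open>M \<times> N\<close>.\<close>

locale tensor_pair = L: right_module R M + N: left_module R N for R and M and N
begin

abbreviation MN where "MN \<equiv> tensor R M N"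
abbreviation pure where "pure \<equiv> pure_tensor R M N"
abbreviation F where "F \<equiv> free_Abelian_group (carrier M \<times> carrier N)"
abbreviation K where "K \<equiv> tensor_null R M N"
abbreviation cls where "cls w \<equiv> K #>\<^bsub>F\<^esub> w"

lemma keys_diff_subset:
  "Poly_Mapping.keys a \<subseteq> S \<Longrightarrow> Poly_Mapping.keys b \<subseteq> S \<Longrightarrow> Poly_Mapping.keys (a - b) \<subseteq> S"
  using keys_diff[of a b] by blast

lemma tensor_relations_subset: "tensor_relations R M N \<subseteq> carrier F"
  unfolding tensor_relations_def
  by (auto intro!: keys_diff_subset simp: L.rsm_closed N.lsm_closed simp del: keys_diff
      dest!: subsetD[OF keys_diff])

lemma subgroup_null: "subgroup K F"
  unfolding tensor_null_def
  by (rule group.generate_is_subgroup[OF group_free_Abelian_group tensor_relations_subset])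

lemma normal_null: "K \<lhd> F"
  by (rule comm_group.subgroup_imp_normal[OF abelian_free_Abelian_group subgroup_null])

lemma cls_add: "\<lbrakk>w \<in> carrier F; w' \<in> carrier F\<rbrakk> \<Longrightarrow> cls w <#>\<^bsub>F\<^esub> cls w' = cls (w + w')"
  using normal.rcos_sum[OF normal_null] by simp

lemma cls_eqI:
  assumes "w \<in> carrier F" "w' \<in> carrier F" "w' - w \<in> K"
  shows "cls w = cls w'"
proof (rule group.repr_independence[OF group_free_Abelian_group _ assms(1) subgroup_null])
  show "w' \<in> cls w"
    using group.rcosI[OF group_free_Abelian_group assms(3) subgroup.subset[OF subgroup_null] assms(1)]
    by simp
qed

lemma cls_mem:
  assumes "w \<in> carrier F" "w' \<in> cls w"
  shows "w' \<in> carrier F" "w' - w \<in> K"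
proof -
  obtain k where k: "k \<in> K" "w' = k + w" using assms(2) by (auto simp: r_coset_def)
  then show "w' - w \<in> K" by simp
  have "k \<in> carrier F" using subgroup.subset[OF subgroup_null] k(1) by blast
  then show "w' \<in> carrier F" using k(2) assms(1) keys_add[of k w] by auto
qed

lemma carrier_tensor: "carrier MN = cls ` carrier F"
  by (simp add: tensor_def tensor_group_def Let_def carrier_FactGroup)

lemma add_tensor: "X \<oplus>\<^bsub>MN\<^esub> Y = X <#>\<^bsub>F\<^esub> Y"
  by (simp add: tensor_def tensor_group_def Let_def)

lemma zero_tensor: "\<zero>\<^bsub>MN\<^esub> = cls 0"
  using group.coset_mult_one[OF group_free_Abelian_group subgroup.subset[OF subgroup_null]]
  by (simp add: tensor_def tensor_group_def Let_def)

lemma abelian_group_tensor: "abelian_group MN"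
proof -
  let ?G = "F Mod K"
  interpret G: comm_group ?G
    by (rule comm_group.abelian_FactGroup[OF abelian_free_Abelian_group subgroup_null])
  have c: "carrier MN = carrier ?G" and a: "add MN = mult ?G"
    and z: "\<zero>\<^bsub>MN\<^esub> = \<one>\<^bsub>?G\<^esub>"
    by (simp_all add: tensor_def tensor_group_def Let_def)
  show ?thesis
  proof (rule abelian_groupI, unfold c a z)
    fix x assume "x \<in> carrier ?G"
    then show "\<exists>y\<in>carrier ?G. y \<otimes>\<^bsub>?G\<^esub> x = \<one>\<^bsub>?G\<^esub>" using G.l_inv_ex by blast
  qed (simp_all add: G.m_ac del: mult_FactGroup one_FactGroup)
qed

lemma abelian_group_tensor_group: "abelian_group (tensor_group R M N)"
proof -
  interpret T: abelian_group MN by (rule abelian_group_tensor)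
  have e: "carrier (tensor_group R M N) = carrier MN"
    "add (tensor_group R M N) = add MN" "\<zero>\<^bsub>tensor_group R M N\<^esub> = \<zero>\<^bsub>MN\<^esub>"
    by (simp_all add: tensor_def)
  show ?thesis
  proof (rule abelian_groupI, unfold e)
    fix x assume "x \<in> carrier MN"
    then show "\<exists>y\<in>carrier MN. y \<oplus>\<^bsub>MN\<^esub> x = \<zero>\<^bsub>MN\<^esub>"
      using T.l_neg by blast
  qed (auto simp: T.a_ac)
qed

lemma pure_tensor_eq_cls: "pure x y = cls (frag_of (x, y))"
  by (simp add: pure_tensor_def)

lemma pure_tensor_closed:
  "\<lbrakk>x \<in> carrier M; y \<in> carrier N\<rbrakk> \<Longrightarrow> pure x y \<in> carrier MN"
  unfolding carrier_tensor pure_tensor_eq_cls by (rule imageI) simp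

lemma relation_in_null: "w \<in> tensor_relations R M N \<Longrightarrow> w \<in> K"
  unfolding tensor_null_def by (rule generate.incl)

lemma pure_tensor_add_left:
  assumes "x \<in> carrier M" "x' \<in> carrier M" "y \<in> carrier N"
  shows "pure (x \<oplus>\<^bsub>M\<^esub> x') y = pure x y \<oplus>\<^bsub>MN\<^esub> pure x' y"
proof -
  have "frag_of (x \<oplus>\<^bsub>M\<^esub> x', y) - frag_of (x, y) - frag_of (x', y) \<in> K"
    using assms by (intro relation_in_null) (auto simp: tensor_relations_def)
  then show ?thesis
    using assms unfolding pure_tensor_eq_cls add_tensor
    by (subst cls_add, simp, simp, intro cls_eqI[symmetric])
      (auto simp: diff_diff_add dest!: subsetD[OF keys_add])
qed

lemma pure_tensor_add_right:
  assumes "x \<in> carrier M" "y \<in> carrier N" "y' \<in> carrier N"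
  shows "pure x (y \<oplus>\<^bsub>N\<^esub> y') = pure x y \<oplus>\<^bsub>MN\<^esub> pure x y'"
proof -
  have "frag_of (x, y \<oplus>\<^bsub>N\<^esub> y') - frag_of (x, y) - frag_of (x, y') \<in> K"
    using assms by (intro relation_in_null) (auto simp: tensor_relations_def)
  then show ?thesis
    using assms unfolding pure_tensor_eq_cls add_tensor
    by (subst cls_add, simp, simp, intro cls_eqI[symmetric])
      (auto simp: diff_diff_add dest!: subsetD[OF keys_add])
qed

lemma pure_tensor_middle:
  assumes "x \<in> carrier M" "a \<in> carrier R" "y \<in> carrier N"
  shows "pure (x \<triangleleft>\<^bsub>M\<^esub> a) y = pure x (a \<triangleright>\<^bsub>N\<^esub> y)"
proof -
  have "frag_of (x \<triangleleft>\<^bsub>M\<^esub> a, y) - frag_of (x, a \<triangleright>\<^bsub>N\<^esub> y) \<in> K"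
    using assms by (intro relation_in_null) (auto simp: tensor_relations_def)
  then show ?thesis
    using assms unfolding pure_tensor_eq_cls
    by (intro cls_eqI[symmetric]) (auto simp: L.rsm_closed N.lsm_closed)
qed

lemma balanced_pure_tensor: "balanced R M N MN pure"
  by (rule balancedI)
    (simp_all add: pure_tensor_closed pure_tensor_add_left pure_tensor_add_right pure_tensor_middle)

text \<open>Pure tensors generate \<open>M \<otimes>\<^sub>R N\<close> under addition alone, since \<open>-(x \<otimes> y) = (-x) \<otimes> y\<close> and
  \<open>0 = 0 \<otimes> 0\<close>.\<close>

lemma tensor_induct [consumes 1, case_names pure add]:
  assumes z: "z \<in> carrier MN"
    and pure: "\<And>x y. \<lbrakk>x \<in> carrier M; y \<in> carrier N\<rbrakk> \<Longrightarrow> P (pure x y)"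
    and add: "\<And>z z'. \<lbrakk>z \<in> carrier MN; z' \<in> carrier MN; P z; P z'\<rbrakk>
      \<Longrightarrow> P (z \<oplus>\<^bsub>MN\<^esub> z')"
  shows "P z"
proof -
  interpret T: abelian_group MN by (rule abelian_group_tensor)
  obtain w where w: "w \<in> carrier F" "z = cls w" using z carrier_tensor by blast
  have cc: "cls w \<in> carrier MN" if "w \<in> carrier F" for w
    using that carrier_tensor by blast
  have padd: "P (cls (w + w'))" if "w \<in> carrier F" "w' \<in> carrier F" "P (cls w)" "P (cls w')" for w w'
    using add[OF cc[OF that(1)] cc[OF that(2)] that(3,4)] cls_add[OF that(1,2)]
    by (simp add: add_tensor)
  have pz: "pure \<zero>\<^bsub>M\<^esub> \<zero>\<^bsub>N\<^esub> = cls 0"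
    using additive_maps_zero[OF N.M.abelian_group_axioms abelian_group_tensor
        balanced_additive_right[OF balanced_pure_tensor L.M.zero_closed]]
    by (simp add: zero_tensor)
  have pm: "pure (\<ominus>\<^bsub>M\<^esub> x) y = cls (- frag_of (x, y))"
    if xy: "x \<in> carrier M" "y \<in> carrier N" for x y
  proof -
    have "pure (\<ominus>\<^bsub>M\<^esub> x) y = \<ominus>\<^bsub>MN\<^esub> pure x y"
      by (rule additive_maps_minus[OF L.M.abelian_group_axioms abelian_group_tensor
        balanced_additive_left[OF balanced_pure_tensor xy(2)] xy(1)])
    also have "\<dots> = cls (- frag_of (x, y))"
      using xy unfolding pure_tensor_eq_cls
      by (intro T.minus_equality) (auto simp: add_tensor cls_add zero_tensor intro!: cc)
    finally show ?thesis .
  qed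
  have "P (cls w) \<and> P (cls (- w))"
  proof (rule free_Abelian_group_induct[of w "carrier M \<times> carrier N"])
    show "Poly_Mapping.keys w \<subseteq> carrier M \<times> carrier N" using w(1) by simp
    show "P (cls 0) \<and> P (cls (- 0))"
      using pure[of "\<zero>\<^bsub>M\<^esub>" "\<zero>\<^bsub>N\<^esub>"] pz by simp
  next
    fix x y
    assume "Poly_Mapping.keys x \<subseteq> carrier M \<times> carrier N" "Poly_Mapping.keys y \<subseteq> carrier M \<times> carrier N"
      "P (cls x) \<and> P (cls (- x))" "P (cls y) \<and> P (cls (- y))"
    then have "P (cls (x + - y))" "P (cls (- x + y))"
      by (intro padd; simp)+
    then show "P (cls (x - y)) \<and> P (cls (- (x - y)))" by simp
  next
    fix a assume "a \<in> carrier M \<times> carrier N"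
    then obtain x y where a: "a = (x, y)" "x \<in> carrier M" "y \<in> carrier N" by (cases a) auto
    show "P (cls (frag_of a)) \<and> P (cls (- frag_of a))"
      using pure[OF a(2,3)] pure[OF L.M.a_inv_closed[OF a(2)] a(3)] pm[OF a(2,3)]
      by (simp add: a(1) pure_tensor_eq_cls)
  qed
  then show ?thesis using w by simp
qed

lemma tensor_hom_ext:
  assumes "h \<in> additive_maps MN P" "h' \<in> additive_maps MN P"
    and "\<And>x y. \<lbrakk>x \<in> carrier M; y \<in> carrier N\<rbrakk> \<Longrightarrow> h (pure x y) = h' (pure x y)"
    and "z \<in> carrier MN"
  shows "h z = h' z"
  using assms(4)
  by (induction rule: tensor_induct)
    (simp_all add: assms(3) additive_maps_add[OF assms(1)] additive_maps_add[OF assms(2)])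

text \<open>The universal property. In particular the value of \<open>tensor_lift P b\<close> at a coset does not
  depend on the representative that its definition picks.\<close>

lemma tensor_lift_universal:
  assumes P: "abelian_group P" and b: "balanced R M N P b"
  shows "tensor_lift P b \<in> additive_maps MN P \<and>
    (\<forall>x\<in>carrier M. \<forall>y\<in>carrier N. tensor_lift P b (pure x y) = b x y)"
proof -
  interpret P: abelian_group P by fact
  have bc: "(\<lambda>p. b (fst p) (snd p)) ` (carrier M \<times> carrier N) \<subseteq> carrier (add_monoid P)"
    using balanced_closed[OF b] by auto
  \<comment> \<open>\<open>h\<close> extends \<open>b\<close> to \<open>F\<close>; it is the formal sum of the definition and it kills \<open>K\<close>.\<close>
  obtain h where h: "h \<in> hom F (add_monoid P)"
    and hf: "\<And>p. p \<in> carrier M \<times> carrier N \<Longrightarrow> h (frag_of p) = b (fst p) (snd p)"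
    using comm_group.free_Abelian_group_universal[OF P.a_comm_group bc] by blast
  interpret h: group_hom F "add_monoid P" h
    by (simp add: group_hom_def group_hom_axioms_def P.a_group h)
  have hadd: "h (w + w') = h w \<oplus>\<^bsub>P\<^esub> h w'" if "w \<in> carrier F" "w' \<in> carrier F" for w w'
    using h.hom_mult[OF that] by simp
  have hneg: "h (- w) = \<ominus>\<^bsub>P\<^esub> h w" if "w \<in> carrier F" for w
    using h.hom_inv[OF that] that by (simp add: a_inv_def)
  have hdiff: "h (w - w') = h w \<ominus>\<^bsub>P\<^esub> h w'" if "w \<in> carrier F" "w' \<in> carrier F" for w w'
    using that hadd[of w "- w'"] hneg[of w'] by (simp add: a_minus_def)
  have hc: "h w \<in> carrier P" if "w \<in> carrier F" for w
    using h.hom_closed[OF that] by simp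
  have hcmul: "h (frag_cmul k (frag_of p)) = [k] \<cdot>\<^bsub>P\<^esub> b (fst p) (snd p)"
    if p: "p \<in> carrier M \<times> carrier N" for k :: int and p
  proof -
    have "h (frag_of p [^]\<^bsub>F\<^esub> k) = h (frag_of p) [^]\<^bsub>add_monoid P\<^esub> k"
      using p by (intro hom_int_pow[OF h]) (simp_all add: P.a_group)
    then show ?thesis using p by (simp add: hf add_pow_def)
  qed
  have hsum: "h (\<Sum>p\<in>I. frag_cmul (k p) (frag_of p)) = (\<Oplus>\<^bsub>P\<^esub>p\<in>I. [k p] \<cdot>\<^bsub>P\<^esub> b (fst p) (snd p))
      \<and> (\<Sum>p\<in>I. frag_cmul (k p) (frag_of p)) \<in> carrier F"
    if "finite I" "I \<subseteq> carrier M \<times> carrier N" for I and k :: "_ \<Rightarrow> int"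
    using that
  proof (induction I rule: finite_induct)
    case empty
    then show ?case using h.hom_one by simp
  next
    case (insert p I)
    have 1: "frag_cmul (k p) (frag_of p) \<in> carrier F" using insert by (auto dest!: subsetD[OF keys_cmul])
    have 2: "(\<lambda>p. [k p] \<cdot>\<^bsub>P\<^esub> b (fst p) (snd p)) \<in> I \<rightarrow> carrier P"
      using insert.prems balanced_closed[OF b] by fastforce
    have 3: "[k p] \<cdot>\<^bsub>P\<^esub> b (fst p) (snd p) \<in> carrier P"
      using insert.prems balanced_closed[OF b] by (cases p) auto
    have IH: "h (\<Sum>p\<in>I. frag_cmul (k p) (frag_of p)) = (\<Oplus>\<^bsub>P\<^esub>p\<in>I. [k p] \<cdot>\<^bsub>P\<^esub> b (fst p) (snd p))"
      "(\<Sum>p\<in>I. frag_cmul (k p) (frag_of p)) \<in> carrier F"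
      using insert by blast+
    have 4: "(\<Sum>p\<in>insert p I. frag_cmul (k p) (frag_of p))
      = frag_cmul (k p) (frag_of p) + (\<Sum>p\<in>I. frag_cmul (k p) (frag_of p))"
      using insert.hyps by simp
    have 5: "p \<in> carrier M \<times> carrier N" using insert.prems by blast
    show ?case unfolding 4 hadd[OF 1 IH(2)] hcmul[OF 5] IH(1) P.finsum_insert[OF insert.hyps 2 3]
      using 1 IH(2) keys_add[of "frag_cmul (k p) (frag_of p)" "\<Sum>p\<in>I. frag_cmul (k p) (frag_of p)"]
      by auto
  qed
  have heq: "(\<Oplus>\<^bsub>P\<^esub>p\<in>Poly_Mapping.keys w. [Poly_Mapping.lookup w p] \<cdot>\<^bsub>P\<^esub> b (fst p) (snd p)) = h w"
    if "w \<in> carrier F" for w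
  proof -
    have "w = (\<Sum>p\<in>Poly_Mapping.keys w. frag_cmul (Poly_Mapping.lookup w p) (frag_of p))"
      using frag_expansion[of w] by (simp add: frag_extend_def)
    then have "h w = h (\<Sum>p\<in>Poly_Mapping.keys w. frag_cmul (Poly_Mapping.lookup w p) (frag_of p))"
      by (rule arg_cong)
    also have "\<dots> = (\<Oplus>\<^bsub>P\<^esub>p\<in>Poly_Mapping.keys w. [Poly_Mapping.lookup w p] \<cdot>\<^bsub>P\<^esub> b (fst p) (snd p))"
      using that by (intro hsum[THEN conjunct1]) simp_all
    finally show ?thesis by (rule sym)
  qed
  have diff_carrier: "w - w' \<in> carrier F" if "w \<in> carrier F" "w' \<in> carrier F" for w w'
    using that keys_diff_subset by simp
  have hdiff2: "h (w - w' - w'') = h w \<ominus>\<^bsub>P\<^esub> h w' \<ominus>\<^bsub>P\<^esub> h w''"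
    if "w \<in> carrier F" "w' \<in> carrier F" "w'' \<in> carrier F" for w w' w''
    unfolding hdiff[OF diff_carrier[OF that(1,2)] that(3)] hdiff[OF that(1,2)] by (rule refl)
  have sub3: "p \<oplus>\<^bsub>P\<^esub> q \<ominus>\<^bsub>P\<^esub> p \<ominus>\<^bsub>P\<^esub> q = \<zero>\<^bsub>P\<^esub>" if "p \<in> carrier P" "q \<in> carrier P" for p q
    using that by (simp add: P.minus_eq P.a_assoc P.a_lcomm[of p] P.r_neg)
  have hnull: "h k = \<zero>\<^bsub>P\<^esub>" if "k \<in> K" for k
  proof -
    let ?S = "{w \<in> carrier F. h w = \<zero>\<^bsub>P\<^esub>}"
    have S: "subgroup ?S F"
      using h.subgroup_kernel by (simp add: kernel_def)
    have "tensor_relations R M N \<subseteq> ?S"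
    proof
      fix r assume r: "r \<in> tensor_relations R M N"
      have "h r = \<zero>\<^bsub>P\<^esub>"
        using r unfolding tensor_relations_def
      proof (elim UnE CollectE exE conjE)
        fix x x' y assume r: "r = frag_of (x \<oplus>\<^bsub>M\<^esub> x', y) - frag_of (x, y) - frag_of (x', y)"
          and c: "x \<in> carrier M" "x' \<in> carrier M" "y \<in> carrier N"
        show ?thesis using c unfolding r
          by (subst hdiff2) (simp_all add: hf balancedD[OF b] sub3)
      next
        fix x y y' assume r: "r = frag_of (x, y \<oplus>\<^bsub>N\<^esub> y') - frag_of (x, y) - frag_of (x, y')"
          and c: "x \<in> carrier M" "y \<in> carrier N" "y' \<in> carrier N"
        show ?thesis using c unfolding r
          by (subst hdiff2) (simp_all add: hf balancedD[OF b] sub3)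
      next
        fix x a y assume r: "r = frag_of (x \<triangleleft>\<^bsub>M\<^esub> a, y) - frag_of (x, a \<triangleright>\<^bsub>N\<^esub> y)"
          and c: "x \<in> carrier M" "a \<in> carrier R" "y \<in> carrier N"
        show ?thesis using c unfolding r
          by (subst hdiff) (simp_all add: hf balancedD[OF b] L.rsm_closed N.lsm_closed P.minus_eq P.r_neg)
      qed
      then show "r \<in> ?S" using r tensor_relations_subset by blast
    qed
    then have "K \<subseteq> ?S" unfolding tensor_null_def
      by (rule group.generate_subgroup_incl[OF group_free_Abelian_group _ S])
    then show ?thesis using that by blast
  qed
  have lift: "tensor_lift P b (cls w) = h w" if w: "w \<in> carrier F" for w
  proof -
    define w' where "w' = (SOME w'. w' \<in> cls w)"
    have "w' \<in> cls w" unfolding w'_def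
      by (rule someI[of _ w], rule group.rcos_self[OF group_free_Abelian_group w subgroup_null])
    then have w': "w' \<in> carrier F" "w' - w \<in> K" using cls_mem[OF w] by auto
    have "w' - w \<in> carrier F" using subgroup.subset[OF subgroup_null] w'(2) by blast
    then have "h w' = h w"
      using hnull[OF w'(2)] hadd[of "w' - w" w] w hc[OF w] by simp
    then show ?thesis
      unfolding tensor_lift_def using heq[OF w'(1)] by (simp add: w'_def[symmetric])
  qed
  have "tensor_lift P b \<in> additive_maps MN P"
  proof (rule additive_mapsI)
    fix x assume "x \<in> carrier MN"
    then obtain w where w: "w \<in> carrier F" "x = cls w" unfolding carrier_tensor by blast
    show "tensor_lift P b x \<in> carrier P" unfolding w(2) lift[OF w(1)] by (rule hc[OF w(1)])
    fix y assume "y \<in> carrier MN"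
    then obtain w' where w': "w' \<in> carrier F" "y = cls w'" unfolding carrier_tensor by blast
    have s: "w + w' \<in> carrier F" using w w' keys_add[of w w'] by auto
    show "tensor_lift P b (x \<oplus>\<^bsub>MN\<^esub> y) = tensor_lift P b x \<oplus>\<^bsub>P\<^esub> tensor_lift P b y"
      unfolding w(2) w'(2) add_tensor cls_add[OF w(1) w'(1)] lift[OF w(1)] lift[OF w'(1)] lift[OF s]
      by (rule hadd[OF w(1) w'(1)])
  qed
  moreover have "tensor_lift P b (pure x y) = b x y"
    if "x \<in> carrier M" "y \<in> carrier N" for x y
    using that by (simp add: pure_tensor_eq_cls lift hf)
  ultimately show ?thesis by blast
qed

lemmas tensor_lift_additive = tensor_lift_universal[THEN conjunct1]
lemmas tensor_lift_pure = tensor_lift_universal[THEN conjunct2, rule_format]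

lemma tensor_lift_cong:
  assumes P: "abelian_group P" and b: "balanced R M N P b"
    and eq: "\<And>x y. \<lbrakk>x \<in> carrier M; y \<in> carrier N\<rbrakk> \<Longrightarrow> b x y = b' x y"
    and z: "z \<in> carrier MN"
  shows "tensor_lift P b z = tensor_lift P b' z"
proof -
  have b': "balanced R M N P b'"
    by (rule balanced_cong[OF b eq]) unfold_locales
  show ?thesis
    by (rule tensor_hom_ext[OF tensor_lift_additive[OF P b] tensor_lift_additive[OF P b'] _ z])
      (simp add: tensor_lift_pure[OF P b] tensor_lift_pure[OF P b'] eq)
qed

lemma tensor_lift_closed:
  assumes "abelian_group P" "balanced R M N P b" "z \<in> carrier MN"
  shows "tensor_lift P b z \<in> carrier P"
  using additive_maps_closed[OF tensor_lift_additive[OF assms(1,2)] assms(3)] .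

text \<open>Lifts are natural in the target; this moves additive maps past Sweedler components.\<close>

lemma additive_tensor_lift:
  assumes P: "abelian_group P" and Q: "abelian_group Q" and b: "balanced R M N P b"
    and h: "h \<in> additive_maps P Q" and z: "z \<in> carrier MN"
  shows "h (tensor_lift P b z) = tensor_lift Q (\<lambda>x y. h (b x y)) z"
  by (rule tensor_hom_ext[OF additive_maps_comp[OF tensor_lift_additive[OF P b] h]
        tensor_lift_additive[OF Q balanced_comp[OF b h]] _ z])
    (simp add: tensor_lift_pure[OF P b] tensor_lift_pure[OF Q balanced_comp[OF b h]])

lemma tensor_lift_pure_tensor:
  assumes z: "z \<in> carrier MN"
  shows "tensor_lift MN pure z = z"
  by (rule tensor_hom_ext[OF tensor_lift_additive[OF abelian_group_tensor balanced_pure_tensor] _ _ z])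
    (auto intro!: additive_mapsI simp: tensor_lift_pure[OF abelian_group_tensor balanced_pure_tensor])

text \<open>Sums of balanced maps are lifted to sums.\<close>

lemma balanced_plus:
  assumes "abelian_group P" "balanced R M N P b" "balanced R M N P b'"
  shows "balanced R M N P (\<lambda>x y. b x y \<oplus>\<^bsub>P\<^esub> b' x y)"
proof -
  interpret P: abelian_group P by fact
  show ?thesis
    by (rule balancedI) (simp_all add: balancedD[OF assms(2)] balancedD[OF assms(3)] P.a_ac)
qed

lemma tensor_lift_plus:
  assumes P: "abelian_group P" and b: "balanced R M N P b" and b': "balanced R M N P b'"
    and z: "z \<in> carrier MN"
  shows "tensor_lift P (\<lambda>x y. b x y \<oplus>\<^bsub>P\<^esub> b' x y) z = tensor_lift P b z \<oplus>\<^bsub>P\<^esub> tensor_lift P b' z"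
  by (rule tensor_hom_ext[OF tensor_lift_additive[OF P balanced_plus[OF P b b']]
        additive_maps_plus[OF P tensor_lift_additive[OF P b] tensor_lift_additive[OF P b']] _ z])
    (simp add: tensor_lift_pure[OF P b] tensor_lift_pure[OF P b']
      tensor_lift_pure[OF P balanced_plus[OF P b b']])

end

text \<open>The map \<open>f \<otimes> g\<close> is defined by lifting into the group \<open>tensor_group\<close>, which has the same carrier and
  addition as the record \<open>tensor\<close> with its outer actions.\<close>

lemma tensor_map_eq_lift:
  assumes "tensor_pair R M N" "tensor_pair R' M' N'"
    and b: "balanced R' M' N' (tensor R M N) (\<lambda>x y. pure_tensor R M N (f x) (g y))"
    and z: "z \<in> carrier (tensor R' M' N')"
  shows "tensor_map R M N f g z
    = tensor_lift (tensor R M N) (\<lambda>x y. pure_tensor R M N (f x) (g y)) z"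
proof -
  interpret T: tensor_pair R M N by fact
  interpret T': tensor_pair R' M' N' by fact
  have e: "carrier (tensor_group R M N) = carrier (tensor R M N)"
    "add (tensor_group R M N) = add (tensor R M N)"
    by (simp_all add: tensor_def)
  have b': "balanced R' M' N' (tensor_group R M N) (\<lambda>x y. pure_tensor R M N (f x) (g y))"
    by (rule balancedI) (simp_all add: e balancedD[OF b])
  have "tensor_map R M N f g \<in> additive_maps (tensor R' M' N') (tensor R M N)"
    using T'.tensor_lift_additive[OF T.abelian_group_tensor_group b']
    by (simp add: tensor_map_def hom_def e)
  then show ?thesis
    by (rule T'.tensor_hom_ext[OF _ T'.tensor_lift_additive[OF T.abelian_group_tensor b] _ z])
     (simp add: tensor_map_def T'.tensor_lift_pure[OF T.abelian_group_tensor_group b']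
       T'.tensor_lift_pure[OF T.abelian_group_tensor b])
qed

lemma tensor_lift_tensor_map:
  assumes T: "tensor_pair R M N" and T': "tensor_pair R' M' N'" and P: "abelian_group P"
    and b: "balanced R' M' N' (tensor R M N) (\<lambda>x y. pure_tensor R M N (f x) (g y))"
    and c: "balanced R M N P c"
    and fg: "\<And>x. x \<in> carrier M' \<Longrightarrow> f x \<in> carrier M" "\<And>y. y \<in> carrier N' \<Longrightarrow> g y \<in> carrier N"
    and z: "z \<in> carrier (tensor R' M' N')"
  shows "tensor_lift P c (tensor_map R M N f g z) = tensor_lift P (\<lambda>x y. c (f x) (g y)) z"
proof -
  interpret T: tensor_pair R M N by fact
  interpret T': tensor_pair R' M' N' by fact
  have "tensor_lift P c (tensor_map R M N f g z)
    = tensor_lift P (\<lambda>x y. tensor_lift P c (pure_tensor R M N (f x) (g y))) z"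
    unfolding tensor_map_eq_lift[OF T T' b z]
    by (rule T'.additive_tensor_lift[OF T.abelian_group_tensor P b T.tensor_lift_additive[OF P c] z])
  also have "\<dots> = tensor_lift P (\<lambda>x y. c (f x) (g y)) z"
    by (rule T'.tensor_lift_cong[OF P balanced_comp[OF b T.tensor_lift_additive[OF P c]] _ z])
      (simp add: T.tensor_lift_pure[OF P c] fg)
  finally show ?thesis .
qed

text \<open>The outer actions on a tensor product.\<close>

lemma tensor_lsm:
  assumes M: "bimodule L R M" and N: "left_module R N" and a: "a \<in> carrier L"
  shows "balanced R M N (tensor R M N) (\<lambda>x y. pure_tensor R M N (a \<triangleright>\<^bsub>M\<^esub> x) y)"
    and "z \<in> carrier (tensor R M N) \<Longrightarrow> a \<triangleright>\<^bsub>tensor R M N\<^esub> z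
      = tensor_lift (tensor R M N) (\<lambda>x y. pure_tensor R M N (a \<triangleright>\<^bsub>M\<^esub> x) y) z"
proof -
  let ?T = "tensor R M N"
  interpret M: bimodule L R M by fact
  interpret T: tensor_pair R M N
    by (rule tensor_pair.intro[OF _ N]) unfold_locales
  show b: "balanced R M N ?T (\<lambda>x y. pure_tensor R M N (a \<triangleright>\<^bsub>M\<^esub> x) y)"
    by (rule balancedI) (simp_all add: a M.lsm_closed M.lsm_r_distr T.pure_tensor_closed T.pure_tensor_add_left
       T.pure_tensor_add_right T.pure_tensor_middle flip: M.lsm_rsm)
  show "a \<triangleright>\<^bsub>?T\<^esub> z
      = tensor_lift ?T (\<lambda>x y. pure_tensor R M N (a \<triangleright>\<^bsub>M\<^esub> x) y) z"
    if z: "z \<in> carrier ?T"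
    using tensor_map_eq_lift[OF T.tensor_pair_axioms T.tensor_pair_axioms b z] by (simp add: tensor_def)
qed

lemma tensor_rsm:
  assumes M: "right_module R M" and N: "bimodule R S N" and a: "a \<in> carrier S"
  shows "balanced R M N (tensor R M N) (\<lambda>x y. pure_tensor R M N x (y \<triangleleft>\<^bsub>N\<^esub> a))"
    and "z \<in> carrier (tensor R M N) \<Longrightarrow> z \<triangleleft>\<^bsub>tensor R M N\<^esub> a
      = tensor_lift (tensor R M N) (\<lambda>x y. pure_tensor R M N x (y \<triangleleft>\<^bsub>N\<^esub> a)) z"
proof -
  let ?T = "tensor R M N"
  interpret N: bimodule R S N by fact
  interpret T: tensor_pair R M N
    by (rule tensor_pair.intro[OF M]) unfold_locales
  show b: "balanced R M N ?T (\<lambda>x y. pure_tensor R M N x (y \<triangleleft>\<^bsub>N\<^esub> a))"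
    by (rule balancedI) (simp_all add: a N.rsm_closed N.rsm_l_distr T.pure_tensor_closed T.pure_tensor_add_left
       T.pure_tensor_add_right T.pure_tensor_middle N.lsm_rsm)
  show "z \<triangleleft>\<^bsub>?T\<^esub> a
      = tensor_lift ?T (\<lambda>x y. pure_tensor R M N x (y \<triangleleft>\<^bsub>N\<^esub> a)) z"
    if z: "z \<in> carrier ?T"
    using tensor_map_eq_lift[OF T.tensor_pair_axioms T.tensor_pair_axioms b z] by (simp add: tensor_def)
qed

lemma tensor_lsm_additive:
  assumes M: "bimodule L R M" and N: "left_module R N" and a: "a \<in> carrier L"
  shows "(\<lambda>z. a \<triangleright>\<^bsub>tensor R M N\<^esub> z) \<in> additive_maps (tensor R M N) (tensor R M N)"
    and "\<lbrakk>x \<in> carrier M; y \<in> carrier N\<rbrakk>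
      \<Longrightarrow> a \<triangleright>\<^bsub>tensor R M N\<^esub> pure_tensor R M N x y = pure_tensor R M N (a \<triangleright>\<^bsub>M\<^esub> x) y"
proof -
  let ?T = "tensor R M N"
  interpret T: tensor_pair R M N
    using M N by (simp add: tensor_pair_def bimodule_def)
  note l = tensor_lsm[OF M N a]
  interpret A: abelian_group ?T by (rule T.abelian_group_tensor)
  show "(\<lambda>z. a \<triangleright>\<^bsub>?T\<^esub> z) \<in> additive_maps ?T ?T"
    using T.tensor_lift_additive[OF T.abelian_group_tensor l(1)]
    by (auto simp: hom_def l(2))
  show "a \<triangleright>\<^bsub>?T\<^esub> pure_tensor R M N x y = pure_tensor R M N (a \<triangleright>\<^bsub>M\<^esub> x) y"
    if "x \<in> carrier M" "y \<in> carrier N"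
    using that by (simp add: l(2) T.pure_tensor_closed T.tensor_lift_pure[OF T.abelian_group_tensor l(1)])
qed

lemma tensor_rsm_additive:
  assumes M: "right_module R M" and N: "bimodule R S N" and a: "a \<in> carrier S"
  shows "(\<lambda>z. z \<triangleleft>\<^bsub>tensor R M N\<^esub> a) \<in> additive_maps (tensor R M N) (tensor R M N)"
    and "\<lbrakk>x \<in> carrier M; y \<in> carrier N\<rbrakk>
      \<Longrightarrow> pure_tensor R M N x y \<triangleleft>\<^bsub>tensor R M N\<^esub> a = pure_tensor R M N x (y \<triangleleft>\<^bsub>N\<^esub> a)"
proof -
  let ?T = "tensor R M N"
  interpret T: tensor_pair R M N
    using M N by (simp add: tensor_pair_def bimodule_def)
  note l = tensor_rsm[OF M N a]
  interpret A: abelian_group ?T by (rule T.abelian_group_tensor)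
  show "(\<lambda>z. z \<triangleleft>\<^bsub>?T\<^esub> a) \<in> additive_maps ?T ?T"
    using T.tensor_lift_additive[OF T.abelian_group_tensor l(1)]
    by (auto simp: hom_def l(2))
  show "pure_tensor R M N x y \<triangleleft>\<^bsub>?T\<^esub> a = pure_tensor R M N x (y \<triangleleft>\<^bsub>N\<^esub> a)"
    if "x \<in> carrier M" "y \<in> carrier N"
    using that by (simp add: l(2) T.pure_tensor_closed T.tensor_lift_pure[OF T.abelian_group_tensor l(1)])
qed

lemma left_module_tensor:
  assumes M: "bimodule L R M" and N: "left_module R N"
  shows "left_module L (tensor R M N)"
proof -
  let ?T = "tensor R M N"
  interpret M: bimodule L R M by fact
  interpret T: tensor_pair R M N
    by (rule tensor_pair.intro[OF _ N]) unfold_locales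
  interpret A: abelian_group ?T by (rule T.abelian_group_tensor)
  note add = tensor_lsm_additive(1)[OF M N]
  note simps = tensor_lsm_additive(2)[OF M N] additive_maps_closed[OF add] additive_maps_add[OF add]
    M.lsm_closed T.pure_tensor_closed A.a_ac
  show ?thesis
  proof (intro left_module.intro left_module_axioms.intro)
    show "ring L" "abelian_group ?T" by unfold_locales
    fix a x assume a: "a \<in> carrier L" and x: "x \<in> carrier ?T"
    then show "a \<triangleright>\<^bsub>?T\<^esub> x \<in> carrier ?T" by (simp add: simps)
    show "a \<triangleright>\<^bsub>?T\<^esub> (x \<oplus>\<^bsub>?T\<^esub> y)
        = a \<triangleright>\<^bsub>?T\<^esub> x \<oplus>\<^bsub>?T\<^esub> a \<triangleright>\<^bsub>?T\<^esub> y"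
      if "y \<in> carrier ?T" for y using a x that by (simp add: simps)
    fix b assume b: "b \<in> carrier L"
    show "(a \<oplus>\<^bsub>L\<^esub> b) \<triangleright>\<^bsub>?T\<^esub> x
        = a \<triangleright>\<^bsub>?T\<^esub> x \<oplus>\<^bsub>?T\<^esub> b \<triangleright>\<^bsub>?T\<^esub> x"
      using x a b by (induction rule: T.tensor_induct)
        (simp_all add: simps M.lsm_l_distr T.pure_tensor_add_left)
    show "(a \<otimes>\<^bsub>L\<^esub> b) \<triangleright>\<^bsub>?T\<^esub> x = a \<triangleright>\<^bsub>?T\<^esub> (b \<triangleright>\<^bsub>?T\<^esub> x)"
      using x a b by (induction rule: T.tensor_induct) (simp_all add: simps M.lsm_assoc)
  next
    fix x assume x: "x \<in> carrier ?T"
    show "\<one>\<^bsub>L\<^esub> \<triangleright>\<^bsub>?T\<^esub> x = x"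
      using x by (induction rule: T.tensor_induct) (simp_all add: simps M.lsm_one)
  qed
qed

lemma right_module_tensor:
  assumes M: "right_module R M" and N: "bimodule R S N"
  shows "right_module S (tensor R M N)"
proof -
  let ?T = "tensor R M N"
  interpret N: bimodule R S N by fact
  interpret T: tensor_pair R M N
    by (rule tensor_pair.intro[OF M]) unfold_locales
  interpret A: abelian_group ?T by (rule T.abelian_group_tensor)
  note add = tensor_rsm_additive(1)[OF M N]
  note simps = tensor_rsm_additive(2)[OF M N] additive_maps_closed[OF add] additive_maps_add[OF add]
    N.rsm_closed T.pure_tensor_closed A.a_ac
  show ?thesis
  proof (intro right_module.intro right_module_axioms.intro)
    show "ring S" "abelian_group ?T" by unfold_locales
    fix a x assume a: "a \<in> carrier S" and x: "x \<in> carrier ?T"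
    then show "x \<triangleleft>\<^bsub>?T\<^esub> a \<in> carrier ?T" by (simp add: simps)
    show "(x \<oplus>\<^bsub>?T\<^esub> y) \<triangleleft>\<^bsub>?T\<^esub> a
        = x \<triangleleft>\<^bsub>?T\<^esub> a \<oplus>\<^bsub>?T\<^esub> y \<triangleleft>\<^bsub>?T\<^esub> a"
      if "y \<in> carrier ?T" for y using a x that by (simp add: simps)
    fix b assume b: "b \<in> carrier S"
    show "x \<triangleleft>\<^bsub>?T\<^esub> (a \<oplus>\<^bsub>S\<^esub> b)
        = x \<triangleleft>\<^bsub>?T\<^esub> a \<oplus>\<^bsub>?T\<^esub> x \<triangleleft>\<^bsub>?T\<^esub> b"
      using x a b by (induction rule: T.tensor_induct)
        (simp_all add: simps N.rsm_r_distr T.pure_tensor_add_right)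
    show "x \<triangleleft>\<^bsub>?T\<^esub> (a \<otimes>\<^bsub>S\<^esub> b) = x \<triangleleft>\<^bsub>?T\<^esub> a \<triangleleft>\<^bsub>?T\<^esub> b"
      using x a b by (induction rule: T.tensor_induct) (simp_all add: simps N.rsm_assoc)
  next
    fix x assume x: "x \<in> carrier ?T"
    show "x \<triangleleft>\<^bsub>?T\<^esub> \<one>\<^bsub>S\<^esub> = x"
      using x by (induction rule: T.tensor_induct) (simp_all add: simps N.rsm_one)
  qed
qed

text \<open>Two lifts along independent tensors may be interchanged.\<close>

lemma tensor_lift_swap:
  assumes "tensor_pair R M N" "tensor_pair R' M' N'" and P: "abelian_group P"
    and b: "\<And>x y. \<lbrakk>x \<in> carrier M; y \<in> carrier N\<rbrakk> \<Longrightarrow> balanced R' M' N' P (b x y)"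
    and b': "\<And>x y. \<lbrakk>x \<in> carrier M'; y \<in> carrier N'\<rbrakk> \<Longrightarrow> balanced R M N P (\<lambda>v w. b v w x y)"
    and z: "z \<in> carrier (tensor R M N)" and z': "z' \<in> carrier (tensor R' M' N')"
  shows "tensor_lift P (\<lambda>x y. tensor_lift P (b x y) z') z
    = tensor_lift P (\<lambda>v w. tensor_lift P (\<lambda>x y. b x y v w) z) z'"
proof -
  interpret T: tensor_pair R M N by fact
  interpret T': tensor_pair R' M' N' by fact
  interpret P: abelian_group P by fact
  have bal: "balanced R M N P (\<lambda>x y. tensor_lift P (b x y) z')"
    using z'
  proof (induction rule: T'.tensor_induct)
    case (pure v w)
    show ?case
      by (rule balanced_cong[OF b'[OF pure]])
        (simp_all add: T'.tensor_lift_pure[OF P b] pure T.L.right_module_axioms T.N.left_module_axioms)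
  next
    case (add z z')
    show ?case
      by (rule balanced_cong[OF T.balanced_plus[OF P add(3,4)]])
        (simp_all add: additive_maps_add[OF T'.tensor_lift_additive[OF P b]] add T.L.right_module_axioms T.N.left_module_axioms)
  qed
  have bal': "balanced R' M' N' P (\<lambda>v w. tensor_lift P (\<lambda>x y. b x y v w) z)"
    if "z \<in> carrier (tensor R M N)" for z
    using that
  proof (induction rule: T.tensor_induct)
    case (pure v w)
    show ?case
      by (rule balanced_cong[OF b[OF pure]])
        (simp_all add: T.tensor_lift_pure[OF P b'] pure T'.L.right_module_axioms T'.N.left_module_axioms)
  next
    case (add z z')
    show ?case
      by (rule balanced_cong[OF T'.balanced_plus[OF P add(3,4)]])
        (simp_all add: additive_maps_add[OF T.tensor_lift_additive[OF P b']] add T'.L.right_module_axioms T'.N.left_module_axioms)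
  qed
  show ?thesis using z
  proof (induction rule: T.tensor_induct)
    case (pure x y)
    have "tensor_lift P (\<lambda>v w. tensor_lift P (\<lambda>x y. b x y v w) (pure_tensor R M N x y)) z' = tensor_lift P (b x y) z'"
      by (rule T'.tensor_lift_cong[OF P bal'[OF T.pure_tensor_closed[OF pure]] _ z'])
        (simp add: T.tensor_lift_pure[OF P b'] pure)
    then show ?case using T.tensor_lift_pure[OF P bal pure] by simp
  next
    case (add z1 z2)
    have "tensor_lift P (\<lambda>v w. tensor_lift P (\<lambda>x y. b x y v w) (z1 \<oplus>\<^bsub>tensor R M N\<^esub> z2)) z'
      = tensor_lift P (\<lambda>v w. tensor_lift P (\<lambda>x y. b x y v w) z1 \<oplus>\<^bsub>P\<^esub> tensor_lift P (\<lambda>x y. b x y v w) z2) z'"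
      using add abelian_groupE(1)[OF T.abelian_group_tensor add(1,2)]
      by (intro T'.tensor_lift_cong[OF P bal' _ z'])
        (simp_all add: additive_maps_add[OF T.tensor_lift_additive[OF P b']])
    also have "\<dots> = tensor_lift P (\<lambda>v w. tensor_lift P (\<lambda>x y. b x y v w) z1) z'
      \<oplus>\<^bsub>P\<^esub> tensor_lift P (\<lambda>v w. tensor_lift P (\<lambda>x y. b x y v w) z2) z'"
      by (rule T'.tensor_lift_plus[OF P bal'[OF add(1)] bal'[OF add(2)] z'])
    finally show ?case
      using add by (simp add: additive_maps_add[OF T.tensor_lift_additive[OF P bal]])
  qed
qed

section \<open>Groups of linear maps\<close>

text \<open>A set of functions with pointwise addition.\<close>

lemma abelian_group_pointwise:
  assumes N: "abelian_group N"
    and carr: "\<And>f x. \<lbrakk>f \<in> carrier P; x \<in> X\<rbrakk> \<Longrightarrow> f x \<in> carrier N"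
    and ext: "carrier P \<subseteq> extensional X"
    and zero: "\<zero>\<^bsub>P\<^esub> = (\<lambda>x\<in>X. \<zero>\<^bsub>N\<^esub>)" "\<zero>\<^bsub>P\<^esub> \<in> carrier P"
    and add: "\<And>f g. f \<oplus>\<^bsub>P\<^esub> g = (\<lambda>x\<in>X. f x \<oplus>\<^bsub>N\<^esub> g x)"
      "\<And>f g. \<lbrakk>f \<in> carrier P; g \<in> carrier P\<rbrakk> \<Longrightarrow> f \<oplus>\<^bsub>P\<^esub> g \<in> carrier P"
    and minus: "\<And>f. f \<in> carrier P \<Longrightarrow> (\<lambda>x\<in>X. \<ominus>\<^bsub>N\<^esub> f x) \<in> carrier P"
  shows "abelian_group P"
proof -
  interpret N: abelian_group N by fact
  show ?thesis
  proof (rule abelian_groupI)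
    show "f \<oplus>\<^bsub>P\<^esub> g \<oplus>\<^bsub>P\<^esub> h = f \<oplus>\<^bsub>P\<^esub> (g \<oplus>\<^bsub>P\<^esub> h)"
      if "f \<in> carrier P" "g \<in> carrier P" "h \<in> carrier P" for f g h
      using that by (auto simp: add(1) carr N.a_assoc intro!: restrict_ext)
    show "f \<oplus>\<^bsub>P\<^esub> g = g \<oplus>\<^bsub>P\<^esub> f" if "f \<in> carrier P" "g \<in> carrier P" for f g
      using that by (auto simp: add(1) carr N.a_comm intro!: restrict_ext)
    show "\<zero>\<^bsub>P\<^esub> \<oplus>\<^bsub>P\<^esub> f = f" if "f \<in> carrier P" for f
      using that subsetD[OF ext that]
      by (auto simp: add(1) zero(1) carr intro!: extensionalityI[of _ X])
    show "\<exists>g\<in>carrier P. g \<oplus>\<^bsub>P\<^esub> f = \<zero>\<^bsub>P\<^esub>" if "f \<in> carrier P" for f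
      by (rule bexI[OF _ minus[OF that]])
        (use that in \<open>auto simp: add(1) zero(1) carr N.l_neg intro!: restrict_ext\<close>)
  qed (use zero add in auto)
qed

lemma finsum_pointwise:
  assumes "abelian_group P" "abelian_group N"
    and carr: "\<And>f. f \<in> carrier P \<Longrightarrow> f x \<in> carrier N"
    and add: "\<And>f g. f \<oplus>\<^bsub>P\<^esub> g = (\<lambda>x\<in>X. f x \<oplus>\<^bsub>N\<^esub> g x)"
    and x: "x \<in> X" and fin: "finite I" "\<And>i. i \<in> I \<Longrightarrow> f i \<in> carrier P"
  shows "(\<Oplus>\<^bsub>P\<^esub>i\<in>I. f i) x = (\<Oplus>\<^bsub>N\<^esub>i\<in>I. f i x)"
  by (rule additive_maps_finsum[OF assms(1,2) _ fin, where h = "\<lambda>f. f x"])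
    (auto intro!: additive_mapsI simp: add carr x)

lemma regular_bimod_simps [simp]:
  "carrier (regular_bimod R) = carrier R" "x \<oplus>\<^bsub>regular_bimod R\<^esub> y = x \<oplus>\<^bsub>R\<^esub> y"
  "\<zero>\<^bsub>regular_bimod R\<^esub> = \<zero>\<^bsub>R\<^esub>" "a \<triangleright>\<^bsub>regular_bimod R\<^esub> x = a \<otimes>\<^bsub>R\<^esub> x"
  "x \<triangleleft>\<^bsub>regular_bimod R\<^esub> a = x \<otimes>\<^bsub>R\<^esub> a"
  by (simp_all add: regular_bimod_def)

lemma (in ring) bimodule_regular: "bimodule R R (regular_bimod R)"
proof -
  have "abelian_group (regular_bimod R)"
  proof (rule abelian_groupI)
    show "\<exists>y\<in>carrier (regular_bimod R). y \<oplus>\<^bsub>regular_bimod R\<^esub> x = \<zero>\<^bsub>regular_bimod R\<^esub>"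
      if "x \<in> carrier (regular_bimod R)" for x
      using that by (intro bexI[of _ "\<ominus> x"]) (auto simp: l_neg)
  qed (auto simp: a_ac)
  then show ?thesis
    by (intro bimodule.intro left_module.intro right_module.intro left_module_axioms.intro
        right_module_axioms.intro bimodule_axioms.intro ring_axioms)
      (auto simp: m_assoc l_distr r_distr)
qed

lemma left_linearI:
  assumes "\<And>x. x \<in> carrier M \<Longrightarrow> f x \<in> carrier N"
    and "\<And>x y. \<lbrakk>x \<in> carrier M; y \<in> carrier M\<rbrakk> \<Longrightarrow> f (x \<oplus>\<^bsub>M\<^esub> y) = f x \<oplus>\<^bsub>N\<^esub> f y"
    and "\<And>a x. \<lbrakk>a \<in> carrier R; x \<in> carrier M\<rbrakk> \<Longrightarrow> f (a \<triangleright>\<^bsub>M\<^esub> x) = a \<triangleright>\<^bsub>N\<^esub> f x"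
  shows "f \<in> left_linear R M N"
  using assms by (auto simp: left_linear_def intro: additive_mapsI)

lemma right_linearI:
  assumes "\<And>x. x \<in> carrier M \<Longrightarrow> f x \<in> carrier N"
    and "\<And>x y. \<lbrakk>x \<in> carrier M; y \<in> carrier M\<rbrakk> \<Longrightarrow> f (x \<oplus>\<^bsub>M\<^esub> y) = f x \<oplus>\<^bsub>N\<^esub> f y"
    and "\<And>a x. \<lbrakk>a \<in> carrier R; x \<in> carrier M\<rbrakk> \<Longrightarrow> f (x \<triangleleft>\<^bsub>M\<^esub> a) = f x \<triangleleft>\<^bsub>N\<^esub> a"
  shows "f \<in> right_linear R M N"
  using assms by (auto simp: right_linear_def intro: additive_mapsI)

lemma left_linearD:
  assumes "f \<in> left_linear R M N"
  shows left_linear_additive: "f \<in> additive_maps M N"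
    and left_linear_closed: "x \<in> carrier M \<Longrightarrow> f x \<in> carrier N"
    and left_linear_add: "\<lbrakk>x \<in> carrier M; y \<in> carrier M\<rbrakk> \<Longrightarrow> f (x \<oplus>\<^bsub>M\<^esub> y) = f x \<oplus>\<^bsub>N\<^esub> f y"
    and left_linear_lsm: "\<lbrakk>a \<in> carrier R; x \<in> carrier M\<rbrakk> \<Longrightarrow> f (a \<triangleright>\<^bsub>M\<^esub> x) = a \<triangleright>\<^bsub>N\<^esub> f x"
proof -
  show f: "f \<in> additive_maps M N" using assms by (simp add: left_linear_def)
qed (use assms in \<open>auto simp: left_linear_def additive_maps_closed additive_maps_add\<close>)

lemma right_linearD:
  assumes "f \<in> right_linear R M N"
  shows right_linear_additive: "f \<in> additive_maps M N"
    and right_linear_closed: "x \<in> carrier M \<Longrightarrow> f x \<in> carrier N"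
    and right_linear_add: "\<lbrakk>x \<in> carrier M; y \<in> carrier M\<rbrakk> \<Longrightarrow> f (x \<oplus>\<^bsub>M\<^esub> y) = f x \<oplus>\<^bsub>N\<^esub> f y"
    and right_linear_rsm: "\<lbrakk>a \<in> carrier R; x \<in> carrier M\<rbrakk> \<Longrightarrow> f (x \<triangleleft>\<^bsub>M\<^esub> a) = f x \<triangleleft>\<^bsub>N\<^esub> a"
proof -
  show f: "f \<in> additive_maps M N" using assms by (simp add: right_linear_def)
qed (use assms in \<open>auto simp: right_linear_def additive_maps_closed additive_maps_add\<close>)

lemma (in left_module) lsm_zero: "a \<in> carrier R \<Longrightarrow> a \<triangleright>\<^bsub>M\<^esub> \<zero>\<^bsub>M\<^esub> = \<zero>\<^bsub>M\<^esub>"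
  and lsm_minus: "\<lbrakk>a \<in> carrier R; x \<in> carrier M\<rbrakk> \<Longrightarrow> a \<triangleright>\<^bsub>M\<^esub> (\<ominus>\<^bsub>M\<^esub> x) = \<ominus>\<^bsub>M\<^esub> (a \<triangleright>\<^bsub>M\<^esub> x)"
proof -
  have *: "(\<lambda>x. a \<triangleright>\<^bsub>M\<^esub> x) \<in> additive_maps M M" if "a \<in> carrier R"
    using that by (intro additive_mapsI) (auto simp: lsm_closed lsm_r_distr)
  show "a \<triangleright>\<^bsub>M\<^esub> \<zero>\<^bsub>M\<^esub> = \<zero>\<^bsub>M\<^esub>" if "a \<in> carrier R"
    using additive_maps_zero[OF M.abelian_group_axioms M.abelian_group_axioms *[OF that]] .
  show "a \<triangleright>\<^bsub>M\<^esub> (\<ominus>\<^bsub>M\<^esub> x) = \<ominus>\<^bsub>M\<^esub> (a \<triangleright>\<^bsub>M\<^esub> x)" if "a \<in> carrier R" "x \<in> carrier M"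
    using additive_maps_minus[OF M.abelian_group_axioms M.abelian_group_axioms *[OF that(1)] that(2)] .
qed

lemma (in right_module) rsm_zero: "a \<in> carrier S \<Longrightarrow> \<zero>\<^bsub>M\<^esub> \<triangleleft>\<^bsub>M\<^esub> a = \<zero>\<^bsub>M\<^esub>"
  and rsm_minus: "\<lbrakk>a \<in> carrier S; x \<in> carrier M\<rbrakk> \<Longrightarrow> (\<ominus>\<^bsub>M\<^esub> x) \<triangleleft>\<^bsub>M\<^esub> a = \<ominus>\<^bsub>M\<^esub> (x \<triangleleft>\<^bsub>M\<^esub> a)"
proof -
  have *: "(\<lambda>x. x \<triangleleft>\<^bsub>M\<^esub> a) \<in> additive_maps M M" if "a \<in> carrier S"
    using that by (intro additive_mapsI) (auto simp: rsm_closed rsm_l_distr)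
  show "\<zero>\<^bsub>M\<^esub> \<triangleleft>\<^bsub>M\<^esub> a = \<zero>\<^bsub>M\<^esub>" if "a \<in> carrier S"
    using additive_maps_zero[OF M.abelian_group_axioms M.abelian_group_axioms *[OF that]] .
  show "(\<ominus>\<^bsub>M\<^esub> x) \<triangleleft>\<^bsub>M\<^esub> a = \<ominus>\<^bsub>M\<^esub> (x \<triangleleft>\<^bsub>M\<^esub> a)" if "a \<in> carrier S" "x \<in> carrier M"
    using additive_maps_minus[OF M.abelian_group_axioms M.abelian_group_axioms *[OF that(1)] that(2)] .
qed

lemma left_linear_pointwise:
  assumes "left_module R M" "left_module R N"
  shows "(\<lambda>x\<in>carrier M. \<zero>\<^bsub>N\<^esub>) \<in> left_linear R M N"
    and "\<lbrakk>f \<in> left_linear R M N; g \<in> left_linear R M N\<rbrakk> \<Longrightarrow> (\<lambda>x\<in>carrier M. f x \<oplus>\<^bsub>N\<^esub> g x) \<in> left_linear R M N"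
    and "f \<in> left_linear R M N \<Longrightarrow> (\<lambda>x\<in>carrier M. \<ominus>\<^bsub>N\<^esub> f x) \<in> left_linear R M N"
proof -
  interpret M: left_module R M by fact
  interpret N: left_module R N by fact
  show "(\<lambda>x\<in>carrier M. \<zero>\<^bsub>N\<^esub>) \<in> left_linear R M N"
    by (rule left_linearI) (auto simp: M.lsm_closed N.lsm_zero)
  show "(\<lambda>x\<in>carrier M. f x \<oplus>\<^bsub>N\<^esub> g x) \<in> left_linear R M N"
    if "f \<in> left_linear R M N" "g \<in> left_linear R M N"
    by (rule left_linearI)
      (auto simp: M.lsm_closed N.lsm_r_distr left_linearD[OF that(1)] left_linearD[OF that(2)] N.M.a_ac)
  show "(\<lambda>x\<in>carrier M. \<ominus>\<^bsub>N\<^esub> f x) \<in> left_linear R M N" if "f \<in> left_linear R M N"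
    by (rule left_linearI)
      (auto simp: M.lsm_closed N.lsm_minus left_linearD[OF that] N.M.minus_add)
qed

lemma right_linear_pointwise:
  assumes "right_module R M" "right_module R N"
  shows "(\<lambda>x\<in>carrier M. \<zero>\<^bsub>N\<^esub>) \<in> right_linear R M N"
    and "\<lbrakk>f \<in> right_linear R M N; g \<in> right_linear R M N\<rbrakk> \<Longrightarrow> (\<lambda>x\<in>carrier M. f x \<oplus>\<^bsub>N\<^esub> g x) \<in> right_linear R M N"
    and "f \<in> right_linear R M N \<Longrightarrow> (\<lambda>x\<in>carrier M. \<ominus>\<^bsub>N\<^esub> f x) \<in> right_linear R M N"
proof -
  interpret M: right_module R M by fact
  interpret N: right_module R N by fact
  show "(\<lambda>x\<in>carrier M. \<zero>\<^bsub>N\<^esub>) \<in> right_linear R M N"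
    by (rule right_linearI) (auto simp: M.rsm_closed N.rsm_zero)
  show "(\<lambda>x\<in>carrier M. f x \<oplus>\<^bsub>N\<^esub> g x) \<in> right_linear R M N"
    if "f \<in> right_linear R M N" "g \<in> right_linear R M N"
    by (rule right_linearI)
      (auto simp: M.rsm_closed N.rsm_l_distr right_linearD[OF that(1)] right_linearD[OF that(2)] N.M.a_ac)
  show "(\<lambda>x\<in>carrier M. \<ominus>\<^bsub>N\<^esub> f x) \<in> right_linear R M N" if "f \<in> right_linear R M N"
    by (rule right_linearI)
      (auto simp: M.rsm_closed N.rsm_minus right_linearD[OF that] N.M.minus_add)
qed

lemma endo_ring_simps [simp]:
  "carrier (endo_ring M K) = K" "s \<otimes>\<^bsub>endo_ring M K\<^esub> t = compose (carrier M) s t"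
  "\<one>\<^bsub>endo_ring M K\<^esub> = (\<lambda>u\<in>carrier M. u)" "\<zero>\<^bsub>endo_ring M K\<^esub> = (\<lambda>u\<in>carrier M. \<zero>\<^bsub>M\<^esub>)"
  "s \<oplus>\<^bsub>endo_ring M K\<^esub> t = (\<lambda>u\<in>carrier M. s u \<oplus>\<^bsub>M\<^esub> t u)"
  by (simp_all add: endo_ring_def)

text \<open>A set of additive maps that is closed under the ring operations.\<close>

lemma ring_endo_ring:
  assumes M: "abelian_group M" and K: "K \<subseteq> additive_maps M M \<inter> extensional (carrier M)"
    and zero: "(\<lambda>u\<in>carrier M. \<zero>\<^bsub>M\<^esub>) \<in> K"
    and add: "\<And>s t. \<lbrakk>s \<in> K; t \<in> K\<rbrakk> \<Longrightarrow> (\<lambda>u\<in>carrier M. s u \<oplus>\<^bsub>M\<^esub> t u) \<in> K"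
    and minus: "\<And>s. s \<in> K \<Longrightarrow> (\<lambda>u\<in>carrier M. \<ominus>\<^bsub>M\<^esub> s u) \<in> K"
    and one: "(\<lambda>u\<in>carrier M. u) \<in> K"
    and comp: "\<And>s t. \<lbrakk>s \<in> K; t \<in> K\<rbrakk> \<Longrightarrow> compose (carrier M) s t \<in> K"
  shows "ring (endo_ring M K)"
proof -
  interpret M: abelian_group M by fact
  have h: "s \<in> additive_maps M M" if "s \<in> K" for s
    using subsetD[OF K that] by (rule IntD1)
  note c = additive_maps_closed[OF h] and a = additive_maps_add[OF h]
  have e: "s \<in> extensional (carrier M)" if "s \<in> K" for s
    using subsetD[OF K that] by (rule IntD2)
  show ?thesis
  proof (rule ringI)
    show "abelian_group (endo_ring M K)"
    proof (rule abelian_group_pointwise[OF M, where X = "carrier M"], unfold endo_ring_simps)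
      show "K \<subseteq> extensional (carrier M)" using K by blast
    qed (fact c zero add minus refl)+
    show "monoid (endo_ring M K)"
    proof (rule monoidI)
      fix s t r assume st: "s \<in> carrier (endo_ring M K)" "t \<in> carrier (endo_ring M K)"
        and r: "r \<in> carrier (endo_ring M K)"
      show "s \<otimes>\<^bsub>endo_ring M K\<^esub> t \<otimes>\<^bsub>endo_ring M K\<^esub> r
          = s \<otimes>\<^bsub>endo_ring M K\<^esub> (t \<otimes>\<^bsub>endo_ring M K\<^esub> r)"
        using r by (auto simp: compose_def c intro!: restrict_ext)
    next
      fix s assume s: "s \<in> carrier (endo_ring M K)"
      then show "\<one>\<^bsub>endo_ring M K\<^esub> \<otimes>\<^bsub>endo_ring M K\<^esub> s = s" "s \<otimes>\<^bsub>endo_ring M K\<^esub> \<one>\<^bsub>endo_ring M K\<^esub> = s"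
        by (auto simp: compose_def c e intro!: extensionalityI[of _ "carrier M"])
    qed (simp_all add: one comp)
  next
    fix s t r assume "s \<in> carrier (endo_ring M K)" "t \<in> carrier (endo_ring M K)"
      and "r \<in> carrier (endo_ring M K)"
    then have k: "s \<in> K" "t \<in> K" "r \<in> K" by simp_all
    show "(s \<oplus>\<^bsub>endo_ring M K\<^esub> t) \<otimes>\<^bsub>endo_ring M K\<^esub> r
        = s \<otimes>\<^bsub>endo_ring M K\<^esub> r \<oplus>\<^bsub>endo_ring M K\<^esub> t \<otimes>\<^bsub>endo_ring M K\<^esub> r"
      by (simp add: compose_def c[OF k(3)] cong: restrict_cong)
    show "r \<otimes>\<^bsub>endo_ring M K\<^esub> (s \<oplus>\<^bsub>endo_ring M K\<^esub> t)
        = r \<otimes>\<^bsub>endo_ring M K\<^esub> s \<oplus>\<^bsub>endo_ring M K\<^esub> r \<otimes>\<^bsub>endo_ring M K\<^esub> t"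
      by (simp add: compose_def c[OF k(1)] c[OF k(2)] a[OF k(3)] cong: restrict_cong)
  qed
qed

text \<open>A criterion for the connecting maps of a Morita context to be bilinear.\<close>

lemma tensor_lift_bilinear:
  assumes R: "ring R" and M: "bimodule R S M" and N: "bimodule S R N"
    and b: "balanced S M N R b"
    and l: "\<And>r x y. \<lbrakk>r \<in> carrier R; x \<in> carrier M; y \<in> carrier N\<rbrakk> \<Longrightarrow> b (r \<triangleright>\<^bsub>M\<^esub> x) y = r \<otimes>\<^bsub>R\<^esub> b x y"
    and r: "\<And>r x y. \<lbrakk>r \<in> carrier R; x \<in> carrier M; y \<in> carrier N\<rbrakk> \<Longrightarrow> b x (y \<triangleleft>\<^bsub>N\<^esub> r) = b x y \<otimes>\<^bsub>R\<^esub> r"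
  shows "tensor_lift R b \<in> bilinear R R (tensor S M N) (regular_bimod R)"
proof -
  let ?T = "tensor S M N"
  interpret R: ring R by fact
  interpret M: bimodule R S M by fact
  interpret N: bimodule S R N by fact
  interpret T: tensor_pair S M N by unfold_locales
  note P = R.abelian_group_axioms
  note lift = T.tensor_lift_additive[OF P b]
  note simps = T.tensor_lift_pure[OF P b] additive_maps_closed[OF lift] additive_maps_add[OF lift]
    tensor_lsm_additive(2)[OF M N.left_module_axioms] tensor_rsm_additive(2)[OF M.right_module_axioms N]
    additive_maps_closed[OF tensor_lsm_additive(1)[OF M N.left_module_axioms]]
    additive_maps_closed[OF tensor_rsm_additive(1)[OF M.right_module_axioms N]]
    additive_maps_add[OF tensor_lsm_additive(1)[OF M N.left_module_axioms]]
    additive_maps_add[OF tensor_rsm_additive(1)[OF M.right_module_axioms N]]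
    l r M.lsm_closed N.rsm_closed R.r_distr R.l_distr
  have "tensor_lift R b \<in> left_linear R ?T (regular_bimod R)"
  proof (rule left_linearI)
    fix a x assume a: "a \<in> carrier R" and x: "x \<in> carrier ?T"
    show "tensor_lift R b (a \<triangleright>\<^bsub>?T\<^esub> x) = a \<triangleright>\<^bsub>regular_bimod R\<^esub> tensor_lift R b x"
      using x a by (induction rule: T.tensor_induct) (simp_all add: simps)
  qed (simp_all add: simps)
  moreover have "tensor_lift R b \<in> right_linear R ?T (regular_bimod R)"
  proof (rule right_linearI)
    fix a x assume a: "a \<in> carrier R" and x: "x \<in> carrier ?T"
    show "tensor_lift R b (x \<triangleleft>\<^bsub>?T\<^esub> a) = tensor_lift R b x \<triangleleft>\<^bsub>regular_bimod R\<^esub> a"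
      using x a by (induction rule: T.tensor_induct) (simp_all add: simps)
  qed (simp_all add: simps)
  ultimately show ?thesis by (simp add: bilinear_def)
qed

section \<open>The Morita context of a module\<close>

text \<open>\<open>Hom\<^sub>S(M, S)\<close> for a right \<open>S\<close>-module \<open>M\<close>, with composition as right action of endomorphisms of \<open>M\<close>.
  Its elements are \<open>undefined\<close> outside of \<open>M\<close>.\<close>

definition hom_bimod :: "('r, 'k) ring_scheme \<Rightarrow> ('l, 'r, 'm, 'z) bimod_scheme \<Rightarrow>
    ('r, 'm \<Rightarrow> 'm, 'm \<Rightarrow> 'r) bimod" where
  "hom_bimod S M =
     \<lparr>carrier = right_linear S M (regular_bimod S) \<inter> extensional (carrier M),
      mult = undefined, one = undefined,
      ring.zero = (\<lambda>u\<in>carrier M. \<zero>\<^bsub>S\<^esub>), add = (\<lambda>k l. \<lambda>u\<in>carrier M. k u \<oplus>\<^bsub>S\<^esub> l u),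
      lsm = (\<lambda>f k. \<lambda>u\<in>carrier M. f \<otimes>\<^bsub>S\<^esub> k u), rsm = (\<lambda>k t. compose (carrier M) k t)\<rparr>"

text \<open>The ring \<open>End\<^sub>S(M)\<close>, the bimodule \<open>Hom\<^sub>S(M, S)\<close> and the evaluation maps. The left action field of \<open>M\<close>
  is meant to be evaluation of endomorphisms.\<close>

definition module_context :: "'r ring \<Rightarrow> ('m \<Rightarrow> 'm, 'r, 'm) bimod \<Rightarrow>
    ('m \<Rightarrow> 'm, 'r, 'm, 'm \<Rightarrow> 'r) morita" where
  "module_context S M =
     (let E = endo_ring M (right_linear S M M \<inter> extensional (carrier M)) in
      \<lparr>ring1 = E, ring2 = S, bimod12 = M, bimod21 = hom_bimod S M,
       conn1 = tensor_lift E (\<lambda>u k. \<lambda>v\<in>carrier M. u \<triangleleft>\<^bsub>M\<^esub> k v),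
       conn2 = tensor_lift S (\<lambda>k u. k u)\<rparr>)"

lemma hom_bimod_simps:
  "carrier (hom_bimod S M) = right_linear S M (regular_bimod S) \<inter> extensional (carrier M)"
  "\<zero>\<^bsub>hom_bimod S M\<^esub> = (\<lambda>u\<in>carrier M. \<zero>\<^bsub>S\<^esub>)"
  "k \<oplus>\<^bsub>hom_bimod S M\<^esub> l = (\<lambda>u\<in>carrier M. k u \<oplus>\<^bsub>S\<^esub> l u)"
  "f \<triangleright>\<^bsub>hom_bimod S M\<^esub> k = (\<lambda>u\<in>carrier M. f \<otimes>\<^bsub>S\<^esub> k u)"
  "k \<triangleleft>\<^bsub>hom_bimod S M\<^esub> t = compose (carrier M) k t"
  by (simp_all add: hom_bimod_def)

lemma ring_endomorphisms:
  assumes "right_module S M"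
  shows "ring (endo_ring M (right_linear S M M \<inter> extensional (carrier M)))"
proof -
  interpret M: right_module S M by fact
  note p = right_linear_pointwise[OF assms assms]
  show ?thesis
  proof (rule ring_endo_ring[OF M.M.abelian_group_axioms])
    show "(\<lambda>u\<in>carrier M. u) \<in> right_linear S M M \<inter> extensional (carrier M)"
      by (auto intro!: right_linearI simp: M.rsm_closed)
    show "compose (carrier M) s t \<in> right_linear S M M \<inter> extensional (carrier M)"
      if st: "s \<in> right_linear S M M \<inter> extensional (carrier M)"
        "t \<in> right_linear S M M \<inter> extensional (carrier M)" for s t
    proof -
      note s = right_linearD[OF IntD1[OF st(1)]] and t = right_linearD[OF IntD1[OF st(2)]]
      show ?thesis
        by (intro IntI right_linearI compose_extensional)
          (simp_all add: compose_def M.rsm_closed s t)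
    qed
  qed (use p right_linear_additive in \<open>auto simp: right_linear_additive\<close>)
qed

text \<open>The classical Morita context of a module, with the values of its connecting maps.\<close>

lemma morita_context_module:
  fixes S :: "'r ring" and M :: "('m \<Rightarrow> 'm, 'r, 'm) bimod"
  assumes M: "right_module S M" and ev: "\<And>t u. t \<triangleright>\<^bsub>M\<^esub> u = t u"
  shows "morita_context (module_context S M)"
    and "\<And>u k. \<lbrakk>u \<in> carrier M; k \<in> carrier (hom_bimod S M)\<rbrakk>
      \<Longrightarrow> conn1 (module_context S M) (pure_tensor S M (hom_bimod S M) u k) = (\<lambda>v\<in>carrier M. u \<triangleleft>\<^bsub>M\<^esub> k v)"
    and "\<And>u k. \<lbrakk>u \<in> carrier M; k \<in> carrier (hom_bimod S M)\<rbrakk>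
      \<Longrightarrow> conn2 (module_context S M) (pure_tensor (ring1 (module_context S M)) (hom_bimod S M) M k u) = k u"
proof -
  interpret M: right_module S M by (rule M)
  define E where "E = endo_ring M (right_linear S M M \<inter> extensional (carrier M))"
  define N where "N = hom_bimod S M"
  have E: "ring E" unfolding E_def by (rule ring_endomorphisms[OF M])
  interpret E: ring E by (rule E)
  interpret reg: bimodule S S "regular_bimod S" by (rule M.S.bimodule_regular)
  have Es: "carrier E = right_linear S M M \<inter> extensional (carrier M)"
    "\<And>s t. s \<otimes>\<^bsub>E\<^esub> t = compose (carrier M) s t" "\<one>\<^bsub>E\<^esub> = (\<lambda>u\<in>carrier M. u)"
    "\<And>s t. s \<oplus>\<^bsub>E\<^esub> t = (\<lambda>u\<in>carrier M. s u \<oplus>\<^bsub>M\<^esub> t u)"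
    by (simp_all add: E_def)
  have Ns: "carrier N = right_linear S M (regular_bimod S) \<inter> extensional (carrier M)"
    "\<zero>\<^bsub>N\<^esub> = (\<lambda>u\<in>carrier M. \<zero>\<^bsub>S\<^esub>)"
    "\<And>k l. k \<oplus>\<^bsub>N\<^esub> l = (\<lambda>u\<in>carrier M. k u \<oplus>\<^bsub>S\<^esub> l u)"
    "\<And>f k. f \<triangleright>\<^bsub>N\<^esub> k = (\<lambda>u\<in>carrier M. f \<otimes>\<^bsub>S\<^esub> k u)"
    "\<And>k t. k \<triangleleft>\<^bsub>N\<^esub> t = compose (carrier M) k t"
    by (simp_all add: N_def hom_bimod_simps)
  have Er: "t \<in> right_linear S M M" and Ee: "t \<in> extensional (carrier M)" if "t \<in> carrier E" for t
    using that by (simp_all add: Es)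
  have Nr: "k \<in> right_linear S M (regular_bimod S)" and Ne: "k \<in> extensional (carrier M)"
    if "k \<in> carrier N" for k using that by (simp_all add: Ns)
  have t: "t u \<in> carrier M" "t (u \<triangleleft>\<^bsub>M\<^esub> a) = t u \<triangleleft>\<^bsub>M\<^esub> a"
    if "t \<in> carrier E" "u \<in> carrier M" "a \<in> carrier S" for t u a
    using right_linearD[OF Er[OF that(1)]] that by auto
  have tc: "t u \<in> carrier M" if "t \<in> carrier E" "u \<in> carrier M" for t u
    using right_linearD[OF Er[OF that(1)]] that by auto
  have ta: "t (u \<oplus>\<^bsub>M\<^esub> v) = t u \<oplus>\<^bsub>M\<^esub> t v" if "t \<in> carrier E" "u \<in> carrier M" "v \<in> carrier M" for t u v
    using right_linearD[OF Er[OF that(1)]] that by auto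
  have kc: "k u \<in> carrier S" if "k \<in> carrier N" "u \<in> carrier M" for k u
    using right_linearD[OF Nr[OF that(1)]] that by auto
  have ka: "k (u \<oplus>\<^bsub>M\<^esub> v) = k u \<oplus>\<^bsub>S\<^esub> k v" if "k \<in> carrier N" "u \<in> carrier M" "v \<in> carrier M" for k u v
    using right_linearD[OF Nr[OF that(1)]] that by auto
  have kr: "k (u \<triangleleft>\<^bsub>M\<^esub> a) = k u \<otimes>\<^bsub>S\<^esub> a" if "k \<in> carrier N" "u \<in> carrier M" "a \<in> carrier S" for k u a
    using right_linearD[OF Nr[OF that(1)]] that by auto
  have Elem: "t \<in> carrier E" if "t \<in> extensional (carrier M)" "t \<in> right_linear S M M" for t
    using that by (simp add: Es)
  have Nlem: "k \<in> carrier N" if "k \<in> extensional (carrier M)" "k \<in> right_linear S M (regular_bimod S)" for k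
    using that by (simp add: Ns)
  have bM: "bimodule E S M"
    by (intro bimodule.intro left_module.intro left_module_axioms.intro bimodule_axioms.intro
        M E M.M.abelian_group_axioms)
      (simp_all add: ev tc ta t Es(2-) compose_def)
  have aN: "abelian_group N"
    using right_linear_pointwise[OF M reg.right_module_axioms]
    by (intro abelian_group_pointwise[OF reg.M.abelian_group_axioms, where X = "carrier M"])
      (auto simp: Ns right_linear_closed[of _ S M "regular_bimod S", simplified])
  interpret N: abelian_group N by (rule aN)
  have Nl: "f \<triangleright>\<^bsub>N\<^esub> k \<in> carrier N" if "f \<in> carrier S" "k \<in> carrier N" for f k
    using that unfolding Ns(4)
    by (intro Nlem right_linearI) (simp_all add: M.rsm_closed kc ka kr M.S.r_distr M.S.m_assoc)
  have Nt: "k \<triangleleft>\<^bsub>N\<^esub> t \<in> carrier N" if "t \<in> carrier E" "k \<in> carrier N" for t k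
    using that unfolding Ns(5)
    by (intro Nlem right_linearI) (simp_all add: compose_def M.rsm_closed kc ka kr tc ta t)
  have bN: "bimodule S E N"
  proof (intro bimodule.intro left_module.intro right_module.intro left_module_axioms.intro
        right_module_axioms.intro bimodule_axioms.intro M.S.ring_axioms E aN)
    show "\<one>\<^bsub>S\<^esub> \<triangleright>\<^bsub>N\<^esub> k = k" if "k \<in> carrier N" for k
      using that Ne[OF that] by (auto simp: Ns(4) kc intro!: extensionalityI[of _ "carrier M"])
    show "k \<triangleleft>\<^bsub>N\<^esub> \<one>\<^bsub>E\<^esub> = k" if "k \<in> carrier N" for k
      using that Ne[OF that] by (auto simp: Ns(5) Es(3) compose_def intro!: extensionalityI[of _ "carrier M"])
  qed (simp_all add: Nl Nt, simp_all add: Ns(3-) Es(2-) compose_def kc ka tc ta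
      M.S.l_distr M.S.r_distr M.S.m_assoc cong: restrict_cong)
  interpret bN: bimodule S E N by (rule bN)
  interpret bM: bimodule E S M by (rule bM)
  interpret T1: tensor_pair S M N by unfold_locales
  interpret T2: tensor_pair E N M by unfold_locales
  define b1 where "b1 = (\<lambda>u k. \<lambda>v\<in>carrier M. u \<triangleleft>\<^bsub>M\<^esub> k v)"
  define b2 where "b2 = (\<lambda>(k :: 'm \<Rightarrow> 'r) u. k u)"
  have b1: "balanced S M N E b1"
  proof (rule balancedI)
    show "b1 u k \<in> carrier E" if "u \<in> carrier M" "k \<in> carrier N" for u k
      unfolding b1_def using that
      by (intro Elem right_linearI) (simp_all add: M.rsm_closed kc ka kr M.rsm_r_distr M.rsm_assoc)
  qed (simp_all add: b1_def Es(4) Ns kc M.rsm_l_distr M.rsm_r_distr M.rsm_assoc cong: restrict_cong)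
  have b2: "balanced E N M S b2"
    by (rule balancedI) (simp_all add: b2_def kc ka Ns(3-) compose_def ev)
  have eq: "module_context S M = \<lparr>ring1 = E, ring2 = S, bimod12 = M, bimod21 = N,
       conn1 = tensor_lift E b1, conn2 = tensor_lift S b2\<rparr>"
    by (simp add: module_context_def E_def N_def b1_def b2_def Let_def)
  have c1: "tensor_lift E b1 \<in> bilinear E E (tensor S M N) (regular_bimod E)"
    by (rule tensor_lift_bilinear[OF E bM bN b1])
      (simp_all add: b1_def ev Es(2) Ns(5) compose_def t kc tc M.rsm_closed cong: restrict_cong)
  have c2: "tensor_lift S b2 \<in> bilinear S S (tensor E N M) (regular_bimod S)"
    by (rule tensor_lift_bilinear[OF M.S.ring_axioms bN bM b2]) (simp_all add: b2_def Ns(4) kr)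
  note pure = T1.tensor_lift_pure[OF E.abelian_group_axioms b1]
    T2.tensor_lift_pure[OF M.S.abelian_group_axioms b2]
  show "morita_context (module_context S M)"
    unfolding morita_context_def eq Let_def morita.simps
    using E M.S.ring_axioms bM bN c1 c2
    by (simp add: pure ev) (simp add: b1_def b2_def Ns(4,5) compose_def kr kc cong: restrict_cong)
  show "conn1 (module_context S M) (pure_tensor S M (hom_bimod S M) u k) = (\<lambda>v\<in>carrier M. u \<triangleleft>\<^bsub>M\<^esub> k v)"
    "conn2 (module_context S M) (pure_tensor (ring1 (module_context S M)) (hom_bimod S M) M k u) = k u"
    if "u \<in> carrier M" "k \<in> carrier (hom_bimod S M)" for u k
    using that unfolding eq N_def[symmetric] by (simp_all add: pure, simp_all add: b1_def b2_def)
qed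

section \<open>Morita contexts inside Morita contexts\<close>

lemma morita_contextD:
  assumes "morita_context X"
  shows "ring (ring1 X)" "ring (ring2 X)" "bimodule (ring1 X) (ring2 X) (bimod12 X)"
    "bimodule (ring2 X) (ring1 X) (bimod21 X)"
    "conn1 X \<in> bilinear (ring1 X) (ring1 X) (tensor (ring2 X) (bimod12 X) (bimod21 X)) (regular_bimod (ring1 X))"
    "conn2 X \<in> bilinear (ring2 X) (ring2 X) (tensor (ring1 X) (bimod21 X) (bimod12 X)) (regular_bimod (ring2 X))"
    "\<And>m n m'. \<lbrakk>m \<in> carrier (bimod12 X); n \<in> carrier (bimod21 X); m' \<in> carrier (bimod12 X)\<rbrakk> \<Longrightarrow>
       conn1 X (pure_tensor (ring2 X) (bimod12 X) (bimod21 X) m n) \<triangleright>\<^bsub>bimod12 X\<^esub> m'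
       = m \<triangleleft>\<^bsub>bimod12 X\<^esub> conn2 X (pure_tensor (ring1 X) (bimod21 X) (bimod12 X) n m')"
    "\<And>n m n'. \<lbrakk>n \<in> carrier (bimod21 X); m \<in> carrier (bimod12 X); n' \<in> carrier (bimod21 X)\<rbrakk> \<Longrightarrow>
       conn2 X (pure_tensor (ring1 X) (bimod21 X) (bimod12 X) n m) \<triangleright>\<^bsub>bimod21 X\<^esub> n'
       = n \<triangleleft>\<^bsub>bimod21 X\<^esub> conn1 X (pure_tensor (ring2 X) (bimod12 X) (bimod21 X) m n')"
  using assms by (simp_all add: morita_context_def Let_def)

text \<open>If the first ring of a Morita context is replaced by a subring \<open>T\<close>, and \<open>N'\<close> by a group \<open>N\<close>
  that embeds into it compatibly with the actions of \<open>S\<close> and \<open>T\<close>, and if \<open>\<tau>(M \<otimes> N)\<close> is contained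
  in \<open>T\<close>, then the result is again a Morita context, and the embeddings form a morphism.\<close>

lemma morita_morphism_subcontext:
  fixes Y :: "('t, 's, 'm, 'n') morita" and T :: "'t ring" and N :: "('s, 't, 'n) bimod"
  assumes Y: "morita_context Y"
    and T: "ring T" "carrier T \<subseteq> carrier (ring1 Y)" "add T = add (ring1 Y)"
      "mult T = mult (ring1 Y)" "\<one>\<^bsub>T\<^esub> = \<one>\<^bsub>ring1 Y\<^esub>"
    and N: "abelian_group N"
    and Nl: "\<And>s n. \<lbrakk>s \<in> carrier (ring2 Y); n \<in> carrier N\<rbrakk> \<Longrightarrow> s \<triangleright>\<^bsub>N\<^esub> n \<in> carrier N"
    and Nr: "\<And>n t. \<lbrakk>n \<in> carrier N; t \<in> carrier T\<rbrakk> \<Longrightarrow> n \<triangleleft>\<^bsub>N\<^esub> t \<in> carrier N"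
    and g: "g \<in> additive_maps N (bimod21 Y)" "inj_on g (carrier N)"
    and gl: "\<And>s n. \<lbrakk>s \<in> carrier (ring2 Y); n \<in> carrier N\<rbrakk> \<Longrightarrow> g (s \<triangleright>\<^bsub>N\<^esub> n) = s \<triangleright>\<^bsub>bimod21 Y\<^esub> g n"
    and gr: "\<And>n t. \<lbrakk>n \<in> carrier N; t \<in> carrier T\<rbrakk> \<Longrightarrow> g (n \<triangleleft>\<^bsub>N\<^esub> t) = g n \<triangleleft>\<^bsub>bimod21 Y\<^esub> t"
    and b1: "\<And>u n. \<lbrakk>u \<in> carrier (bimod12 Y); n \<in> carrier N\<rbrakk> \<Longrightarrow> b1 u n \<in> carrier T"
      "\<And>u n. \<lbrakk>u \<in> carrier (bimod12 Y); n \<in> carrier N\<rbrakk>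
        \<Longrightarrow> b1 u n = conn1 Y (pure_tensor (ring2 Y) (bimod12 Y) (bimod21 Y) u (g n))"
    and b2: "\<And>u n. \<lbrakk>u \<in> carrier (bimod12 Y); n \<in> carrier N\<rbrakk>
        \<Longrightarrow> b2 n u = conn2 Y (pure_tensor (ring1 Y) (bimod21 Y) (bimod12 Y) (g n) u)"
  shows "morita_morphism \<lparr>ring1 = T, ring2 = ring2 Y, bimod12 = bimod12 Y, bimod21 = N,
      conn1 = tensor_lift T b1, conn2 = tensor_lift (ring2 Y) b2\<rparr> Y (\<lambda>t. t) (\<lambda>f. f) (\<lambda>u. u) g"
proof -
  define R S M N' where d: "R = ring1 Y" "S = ring2 Y" "M = bimod12 Y" "N' = bimod21 Y"
  note YD = morita_contextD[OF Y, folded d]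
  note T = T[folded d] and Nl = Nl[folded d] and g = g[folded d] and gl = gl[folded d]
    and gr = gr[folded d] and b1 = b1[folded d] and b2 = b2[folded d]
  interpret T: ring T by (rule T(1))
  interpret M: bimodule R S M by (rule YD(3))
  interpret N': bimodule S R N' by (rule YD(4))
  interpret N: abelian_group N by (rule N)
  have TR: "t \<in> carrier R" if "t \<in> carrier T" for t using T(2) that by blast
  note gc = additive_maps_closed[OF g(1)] and ga = additive_maps_add[OF g(1)]
  have bM: "bimodule T S M"
    by (intro bimodule.intro left_module.intro left_module_axioms.intro bimodule_axioms.intro
        M.right_module_axioms T(1) M.M.abelian_group_axioms)
      (simp_all add: TR T(3-5) M.lsm_closed M.lsm_l_distr M.lsm_r_distr M.lsm_assoc M.lsm_one M.lsm_rsm)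
  note gsimps = Nl Nr gl gr gc ga TR T(3-5) N'.lsm_l_distr N'.lsm_r_distr N'.lsm_assoc N'.lsm_one
    N'.rsm_l_distr N'.rsm_r_distr N'.rsm_assoc N'.rsm_one N'.lsm_rsm
  have bN: "bimodule S T N"
    \<comment> \<open>The axioms for \<open>N\<close> may be checked after applying the injective map \<open>g\<close>.\<close>
    by (intro bimodule.intro left_module.intro right_module.intro left_module_axioms.intro
        right_module_axioms.intro bimodule_axioms.intro M.S.ring_axioms T(1) N inj_onD[OF g(2)])
      (simp_all add: Nl Nr gl gr gc ga, simp_all add: gsimps)
  interpret bN: bimodule S T N by (rule bN)
  interpret bM: bimodule T S M by (rule bM)
  interpret T1: tensor_pair S M N by unfold_locales
  interpret T2: tensor_pair T N M by unfold_locales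
  interpret T1': tensor_pair S M N' by unfold_locales
  interpret T2': tensor_pair R N' M by unfold_locales
  have c1: "conn1 Y \<in> left_linear R (tensor S M N') (regular_bimod R)"
    "conn1 Y \<in> right_linear R (tensor S M N') (regular_bimod R)"
    and c2: "conn2 Y \<in> left_linear S (tensor R N' M) (regular_bimod S)"
    "conn2 Y \<in> right_linear S (tensor R N' M) (regular_bimod S)"
    using YD(5,6) by (simp_all add: bilinear_def)
  note p1 = T1'.pure_tensor_closed T1'.pure_tensor_add_left T1'.pure_tensor_add_right T1'.pure_tensor_middle
    and p2 = T2'.pure_tensor_closed T2'.pure_tensor_add_left T2'.pure_tensor_add_right T2'.pure_tensor_middle
  have bal1: "balanced S M N T b1"
    by (rule balancedI) (simp_all add: b1(1), simp_all add: b1(2) gsimps p1 left_linearD[OF c1(1)] M.rsm_closed)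
  have bal2: "balanced T N M S b2"
    by (rule balancedI) (simp_all add: b2 gsimps p2 left_linearD[OF c2(1), simplified] M.lsm_closed)
  let ?X = "\<lparr>ring1 = T, ring2 = S, bimod12 = M, bimod21 = N,
      conn1 = tensor_lift T b1, conn2 = tensor_lift S b2\<rparr>"
  have l1: "tensor_lift T b1 \<in> bilinear T T (tensor S M N) (regular_bimod T)"
    using left_linear_lsm[OF c1(1)] right_linear_rsm[OF c1(2)]
    by (intro tensor_lift_bilinear[OF T(1) bM bN bal1])
      (simp_all add: b1(2) gsimps p1 M.lsm_closed
        flip: tensor_lsm_additive(2)[OF YD(3) N'.left_module_axioms]
          tensor_rsm_additive(2)[OF M.right_module_axioms YD(4)])
  have l2: "tensor_lift S b2 \<in> bilinear S S (tensor T N M) (regular_bimod S)"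
    using left_linear_lsm[OF c2(1)] right_linear_rsm[OF c2(2)]
    by (intro tensor_lift_bilinear[OF M.S.ring_axioms bN bM bal2])
      (simp_all add: b2 gsimps p2 M.rsm_closed
        flip: tensor_lsm_additive(2)[OF YD(4) M.left_module_axioms]
          tensor_rsm_additive(2)[OF N'.right_module_axioms YD(3)])
  note pure = T1.tensor_lift_pure[OF T.abelian_group_axioms bal1]
    T2.tensor_lift_pure[OF M.S.abelian_group_axioms bal2]
  have b2c: "b2 n u \<in> carrier S" if "u \<in> carrier M" "n \<in> carrier N" for u n
    using that by (simp add: balanced_closed[OF bal2])
  have X: "morita_context ?X"
  proof -
    have "b2 n m \<triangleright>\<^bsub>N\<^esub> n' = n \<triangleleft>\<^bsub>N\<^esub> b1 m n'"
      if "n \<in> carrier N" "m \<in> carrier M" "n' \<in> carrier N" for n m n'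
    proof (rule inj_onD[OF g(2)])
      show "g (b2 n m \<triangleright>\<^bsub>N\<^esub> n') = g (n \<triangleleft>\<^bsub>N\<^esub> b1 m n')"
        using that by (simp add: gl gr b2c b1(1)) (simp add: b1(2) b2 YD(8) gc)
    qed (use that in \<open>simp_all add: Nl Nr b2c b1(1)\<close>)
    moreover have "b1 m n \<triangleright>\<^bsub>M\<^esub> m' = m \<triangleleft>\<^bsub>M\<^esub> b2 n m'"
      if "m \<in> carrier M" "n \<in> carrier N" "m' \<in> carrier M" for m n m'
      using that by (simp add: b1(2) b2 YD(7) gc)
    ultimately show ?thesis
      using T(1) M.S.ring_axioms bM bN l1 l2 by (simp add: morita_context_def Let_def pure)
  qed
  have q1: "balanced S M N (tensor S M N') (\<lambda>x y. pure_tensor S M N' x (g y))"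
    by (rule balancedI) (simp_all add: gsimps p1)
  have q2: "balanced T N M (tensor R N' M) (\<lambda>x y. pure_tensor R N' M (g x) y)"
    by (rule balancedI) (simp_all add: gsimps p2)
  have e1: "tensor_lift T b1 z = conn1 Y (tensor_map S M N' (\<lambda>u. u) g z)"
    if z: "z \<in> carrier (tensor S M N)" for z
  proof -
    note q = tensor_map_eq_lift[OF T1'.tensor_pair_axioms T1.tensor_pair_axioms q1]
    show ?thesis using z
    proof (induction rule: T1.tensor_induct)
      case (pure x y)
      then show ?case
        by (simp add: q T1.pure_tensor_closed T1.tensor_lift_pure[OF T1'.abelian_group_tensor q1]
            T1.tensor_lift_pure[OF T.abelian_group_axioms bal1] b1(2))
    next
      case (add z z')
      then show ?case
        using additive_maps_add[OF left_linear_additive[OF c1(1)], of "tensor_map S M N' (\<lambda>u. u) g z" "tensor_map S M N' (\<lambda>u. u) g z'"]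
        by (simp add: q T1.tensor_lift_closed[OF T1'.abelian_group_tensor q1]
            additive_maps_add[OF T1.tensor_lift_additive[OF T1'.abelian_group_tensor q1]]
            additive_maps_add[OF T1.tensor_lift_additive[OF T.abelian_group_axioms bal1]]
            abelian_groupE(1)[OF T1.abelian_group_tensor] T(3))
    qed
  qed
  have e2: "tensor_lift S b2 z = conn2 Y (tensor_map R N' M g (\<lambda>u. u) z)"
    if z: "z \<in> carrier (tensor T N M)" for z
  proof -
    note q = tensor_map_eq_lift[OF T2'.tensor_pair_axioms T2.tensor_pair_axioms q2]
    show ?thesis using z
    proof (induction rule: T2.tensor_induct)
      case (pure x y)
      then show ?case
        by (simp add: q T2.pure_tensor_closed T2.tensor_lift_pure[OF T2'.abelian_group_tensor q2]
            T2.tensor_lift_pure[OF M.S.abelian_group_axioms bal2] b2)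
    next
      case (add z z')
      then show ?case
        using additive_maps_add[OF left_linear_additive[OF c2(1)], of "tensor_map R N' M g (\<lambda>u. u) z" "tensor_map R N' M g (\<lambda>u. u) z'"]
        by (simp add: q T2.tensor_lift_closed[OF T2'.abelian_group_tensor q2]
            additive_maps_add[OF T2.tensor_lift_additive[OF T2'.abelian_group_tensor q2]]
            additive_maps_add[OF T2.tensor_lift_additive[OF M.S.abelian_group_axioms bal2]]
            abelian_groupE(1)[OF T2.abelian_group_tensor])
    qed
  qed
  show ?thesis
    using X Y g(1) e1 e2
    by (auto simp: morita_morphism_def Let_def ring_hom_def hom_def T TR gl gr simp flip: d)
qed

section \<open>Dual bases\<close>

lemma free_bimod_simps:
  "carrier (free_bimod A I) = {v \<in> I \<rightarrow>\<^sub>E carrier A. finite {i \<in> I. v i \<noteq> \<zero>\<^bsub>A\<^esub>}}"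
  "\<zero>\<^bsub>free_bimod A I\<^esub> = (\<lambda>i\<in>I. \<zero>\<^bsub>A\<^esub>)" "v \<oplus>\<^bsub>free_bimod A I\<^esub> w = (\<lambda>i\<in>I. v i \<oplus>\<^bsub>A\<^esub> w i)"
  "v \<triangleleft>\<^bsub>free_bimod A I\<^esub> a = (\<lambda>i\<in>I. v i \<otimes>\<^bsub>A\<^esub> a)"
  by (simp_all add: free_bimod_def)

lemma (in ring) abelian_group_free_bimod: "abelian_group (free_bimod R I)"
proof (rule abelian_group_pointwise[OF abelian_group_axioms, where X = I])
  fix v w assume v: "v \<in> carrier (free_bimod R I)" and w: "w \<in> carrier (free_bimod R I)"
  have "finite {i \<in> I. v i \<oplus> w i \<noteq> \<zero>}"
    by (rule finite_subset[of _ "{i \<in> I. v i \<noteq> \<zero>} \<union> {i \<in> I. w i \<noteq> \<zero>}"])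
      (use v w in \<open>auto simp: free_bimod_simps\<close>)
  moreover have "{i \<in> I. (\<lambda>i\<in>I. v i \<oplus> w i) i \<noteq> \<zero>} = {i \<in> I. v i \<oplus> w i \<noteq> \<zero>}" by auto
  ultimately show "v \<oplus>\<^bsub>free_bimod R I\<^esub> w \<in> carrier (free_bimod R I)"
    using v w by (auto simp: free_bimod_simps PiE_iff)
next
  fix v assume v: "v \<in> carrier (free_bimod R I)"
  have "finite {i \<in> I. (\<lambda>i\<in>I. \<ominus> v i) i \<noteq> \<zero>}"
    by (rule finite_subset[of _ "{i \<in> I. v i \<noteq> \<zero>}"]) (use v in \<open>auto simp: free_bimod_simps\<close>)
  then show "(\<lambda>i\<in>I. \<ominus> v i) \<in> carrier (free_bimod R I)"
    using v by (auto simp: free_bimod_simps PiE_iff)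
next
  show "\<zero>\<^bsub>free_bimod R I\<^esub> \<in> carrier (free_bimod R I)"
    by (auto simp: free_bimod_simps PiE_iff cong: conj_cong)
qed (auto simp: free_bimod_simps PiE_iff)

text \<open>Let \<open>i\<close> be a linear section of \<open>p: F \<rightarrow> \<Sigma>\<close>, where \<open>F\<close> is free on \<open>I\<close>. The images under \<open>i\<close> of finitely
  many generators live on a finite set \<open>J\<close> of coordinates, hence so does every \<open>i x\<close>. The images under
  \<open>p\<close> of the unit vectors \<open>\<delta> j\<close> and the coordinates of \<open>i\<close>, for \<open>j \<in> J\<close>, form a dual basis.\<close>

lemma ex_dual_basis:
  fixes \<Sigma> :: "('l, 'a, 's, 'z) bimod_scheme"
  assumes \<Sigma>: "right_module A \<Sigma>" and fg: "finitely_generated_right A \<Sigma>" and proj: "projective_right A \<Sigma>"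
  shows "\<exists>n e \<phi>. is_dual_basis A \<Sigma> n e \<phi>"
proof -
  interpret U: right_module A \<Sigma> by (rule \<Sigma>)
  obtain I :: "'s set" and i p where i: "i \<in> right_linear A \<Sigma> (free_bimod A I)"
    and p: "p \<in> right_linear A (free_bimod A I) \<Sigma>" and pi: "\<And>x. x \<in> carrier \<Sigma> \<Longrightarrow> p (i x) = x"
    using proj unfolding projective_right_def by blast
  obtain G where G: "finite G" "G \<subseteq> carrier \<Sigma>"
    and gen: "\<And>x. x \<in> carrier \<Sigma> \<Longrightarrow>
      \<exists>a. a \<in> G \<rightarrow> carrier A \<and> x = (\<Oplus>\<^bsub>\<Sigma>\<^esub>g\<in>G. g \<triangleleft>\<^bsub>\<Sigma>\<^esub> a g)"
    using fg unfolding finitely_generated_right_def by blast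
  interpret F: abelian_group "free_bimod A I" by (rule U.S.abelian_group_free_bimod)
  note ii = right_linearD(2-)[OF i] and ps = right_linearD(2-)[OF p]
  define J where "J = (\<Union>g\<in>G. {j \<in> I. i g j \<noteq> \<zero>\<^bsub>A\<^esub>})"
  have ic: "i x j \<in> carrier A" if "x \<in> carrier \<Sigma>" "j \<in> I" for x j
    using ii(1)[OF that(1)] that(2) by (auto simp: free_bimod_simps)
  have finJ: "finite J" unfolding J_def
    using G ii(1) by (auto simp: free_bimod_simps)
  have JI: "J \<subseteq> I" by (auto simp: J_def)
  have supp: "i x j = \<zero>\<^bsub>A\<^esub>" if x: "x \<in> carrier \<Sigma>" and j: "j \<in> I - J" for x j
  proof -
    obtain a where a: "a \<in> G \<rightarrow> carrier A" "x = (\<Oplus>\<^bsub>\<Sigma>\<^esub>g\<in>G. g \<triangleleft>\<^bsub>\<Sigma>\<^esub> a g)"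
      using gen[OF x] by blast
    have h: "(\<lambda>x. i x j) \<in> additive_maps \<Sigma> A"
      by (rule additive_mapsI) (use j in \<open>simp_all add: ic ii free_bimod_simps\<close>)
    have "i x j = (\<Oplus>\<^bsub>A\<^esub>g\<in>G. i (g \<triangleleft>\<^bsub>\<Sigma>\<^esub> a g) j)"
      unfolding a(2)
      by (rule additive_maps_finsum[OF U.M.abelian_group_axioms U.S.abelian_group_axioms h G(1)])
        (use a(1) G(2) in \<open>auto intro!: U.rsm_closed\<close>)
    also have "\<dots> = (\<Oplus>\<^bsub>A\<^esub>g\<in>G. \<zero>\<^bsub>A\<^esub>)"
    proof (rule U.S.finsum_cong')
      fix g assume g: "g \<in> G"
      then have "i g j = \<zero>\<^bsub>A\<^esub>" using j by (auto simp: J_def)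
      then show "i (g \<triangleleft>\<^bsub>\<Sigma>\<^esub> a g) j = \<zero>\<^bsub>A\<^esub>"
        using Pi_mem[OF a(1) g] subsetD[OF G(2) g] j by (simp add: ii(3) free_bimod_simps)
    qed auto
    finally show ?thesis by simp
  qed
  define \<delta> where "\<delta> = (\<lambda>j. \<lambda>k\<in>I. if k = j then \<one>\<^bsub>A\<^esub> else \<zero>\<^bsub>A\<^esub>)"
  have \<delta>: "\<delta> j \<in> carrier (free_bimod A I)" for j
  proof -
    have "{k \<in> I. \<delta> j k \<noteq> \<zero>\<^bsub>A\<^esub>} \<subseteq> {j}" by (auto simp: \<delta>_def)
    then have "finite {k \<in> I. \<delta> j k \<noteq> \<zero>\<^bsub>A\<^esub>}" using finite_subset by blast
    then show ?thesis by (simp add: free_bimod_simps) (auto simp: \<delta>_def PiE_iff)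
  qed
  have expand: "p v = (\<Oplus>\<^bsub>\<Sigma>\<^esub>j\<in>K. p (\<delta> j) \<triangleleft>\<^bsub>\<Sigma>\<^esub> v j)"
    if "finite K" "K \<subseteq> I" "v \<in> carrier (free_bimod A I)" "\<forall>k\<in>I - K. v k = \<zero>\<^bsub>A\<^esub>" for K v
    using that
  proof (induction K arbitrary: v rule: finite_induct)
    case empty
    then have "v = \<zero>\<^bsub>free_bimod A I\<^esub>"
      by (auto simp: free_bimod_simps PiE_iff intro!: extensionalityI[of _ I])
    then show ?case
      using additive_maps_zero[OF F.abelian_group_axioms U.M.abelian_group_axioms right_linear_additive[OF p]]
      by simp
  next
    case (insert j K)
    define w where "w = (\<lambda>k\<in>I. if k = j then \<zero>\<^bsub>A\<^esub> else v k)"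
    have vc: "v k \<in> carrier A" if "k \<in> I" for k
      using insert.prems(2) that by (auto simp: free_bimod_simps)
    have "finite {k \<in> I. w k \<noteq> \<zero>\<^bsub>A\<^esub>}"
      by (rule finite_subset[of _ "{k \<in> I. v k \<noteq> \<zero>\<^bsub>A\<^esub>}"])
        (use insert.prems(2) in \<open>auto simp: w_def free_bimod_simps\<close>)
    then have w: "w \<in> carrier (free_bimod A I)"
      by (simp add: free_bimod_simps) (auto simp: w_def PiE_iff vc)
    have wK: "\<forall>k\<in>I - K. w k = \<zero>\<^bsub>A\<^esub>" using insert.prems(3) by (auto simp: w_def)
    have j: "j \<in> I" using insert.prems by blast
    have "v = (\<delta> j \<triangleleft>\<^bsub>free_bimod A I\<^esub> v j) \<oplus>\<^bsub>free_bimod A I\<^esub> w"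
      using insert.prems(2) j vc
      by (auto simp: free_bimod_simps \<delta>_def w_def PiE_iff intro!: extensionalityI[of _ I])
    moreover have "\<delta> j \<triangleleft>\<^bsub>free_bimod A I\<^esub> v j \<in> carrier (free_bimod A I)"
    proof -
      have "finite {k \<in> I. (\<delta> j \<triangleleft>\<^bsub>free_bimod A I\<^esub> v j) k \<noteq> \<zero>\<^bsub>A\<^esub>}"
        by (rule finite_subset[of _ "{j}"]) (use j vc in \<open>auto simp: \<delta>_def free_bimod_simps\<close>)
      then show ?thesis using j vc by (simp add: free_bimod_simps) (auto simp: \<delta>_def PiE_iff)
    qed
    ultimately have "p v = p (\<delta> j) \<triangleleft>\<^bsub>\<Sigma>\<^esub> v j \<oplus>\<^bsub>\<Sigma>\<^esub> p w"
      using ps(2)[of "\<delta> j \<triangleleft>\<^bsub>free_bimod A I\<^esub> v j" w] ps(3)[OF vc[OF j] \<delta>] w by simp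
    also have "p w = (\<Oplus>\<^bsub>\<Sigma>\<^esub>k\<in>K. p (\<delta> k) \<triangleleft>\<^bsub>\<Sigma>\<^esub> w k)"
      using insert.IH[OF _ w wK] insert.prems by blast
    also have "\<dots> = (\<Oplus>\<^bsub>\<Sigma>\<^esub>k\<in>K. p (\<delta> k) \<triangleleft>\<^bsub>\<Sigma>\<^esub> v k)"
      using insert.hyps insert.prems(1)
      by (intro U.M.finsum_cong') (auto simp: w_def intro!: U.rsm_closed ps(1) \<delta> vc)
    finally show ?case
      using insert.hyps insert.prems(1)
      by (subst U.M.finsum_insert) (auto intro!: U.rsm_closed ps(1) \<delta> vc)
  qed
  obtain h where h: "bij_betw h {0..<card J} J" using ex_bij_betw_nat_finite[OF finJ] by blast
  have hi: "inj_on h {..<card J}" "h ` {..<card J} = J"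
    using h by (simp_all add: bij_betw_def lessThan_atLeast0)
  have hI: "h k \<in> I" if "k < card J" for k using hi(2) JI that by auto
  define e where "e = (\<lambda>k. p (\<delta> (h k)))"
  define \<phi> where "\<phi> = (\<lambda>k. \<lambda>u\<in>carrier \<Sigma>. i u (h k))"
  have "is_dual_basis A \<Sigma> (card J) e \<phi>"
    unfolding is_dual_basis_def
  proof (intro conjI allI impI ballI)
    show "e k \<in> carrier \<Sigma>" for k by (simp add: e_def ps \<delta>)
    show "\<phi> k \<in> carrier (right_dual A \<Sigma>)" if "k < card J" for k
      using hI[OF that]
      by (auto simp: right_dual_def \<phi>_def U.rsm_closed ic ii free_bimod_simps intro!: right_linearI)
    fix u assume u: "u \<in> carrier \<Sigma>"
    have "u = p (i u)" using pi[OF u] by simp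
    also have "\<dots> = (\<Oplus>\<^bsub>\<Sigma>\<^esub>j\<in>h ` {..<card J}. p (\<delta> j) \<triangleleft>\<^bsub>\<Sigma>\<^esub> i u j)"
      unfolding hi(2) by (rule expand[OF finJ JI ii(1)[OF u]]) (use supp u in blast)
    also have "\<dots> = (\<Oplus>\<^bsub>\<Sigma>\<^esub>k\<in>{..<card J}. e k \<triangleleft>\<^bsub>\<Sigma>\<^esub> \<phi> k u)"
      unfolding e_def \<phi>_def using u JI hi(2)
      by (subst U.M.finsum_reindex[OF _ hi(1)]) (auto intro!: U.rsm_closed ps(1) \<delta> ic)
    finally show "u = (\<Oplus>\<^bsub>\<Sigma>\<^esub>k\<in>{..<card J}. e k \<triangleleft>\<^bsub>\<Sigma>\<^esub> \<phi> k u)" .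
  qed
  then show ?thesis by blast
qed

section \<open>Comodules and the ring of left linear functionals\<close>

text \<open>A right comodule. The substructures are made available under the prefixes \<open>C\<close> (the bimodule
  \<open>C\<close>), \<open>U\<close> (the right module \<open>\<Sigma>\<close>), and juxtapositions of these for tensor products.\<close>

locale comodule_data =
  fixes A :: "('a, 'k) ring_scheme" and C :: "('a, 'a, 'c, 'z) bimod_scheme"
    and \<Delta> :: "'c \<Rightarrow> (('c \<times> 'c) \<Rightarrow>\<^sub>0 int) set" and \<epsilon> :: "'c \<Rightarrow> 'a"
    and \<Sigma> :: "('l, 'a, 's, 'y) bimod_scheme" and \<rho> :: "'s \<Rightarrow> (('s \<times> 'c) \<Rightarrow>\<^sub>0 int) set"
  assumes comodule: "right_comodule A C \<Delta> \<epsilon> \<Sigma> \<rho>"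
begin

lemma coring: "coring A C \<Delta> \<epsilon>"
  using comodule by (simp add: right_comodule_def)

lemma bimodule_C: "bimodule A A C"
  using coring by (simp add: coring_def)

lemma right_module_\<Sigma>: "right_module A \<Sigma>"
  using comodule by (simp add: right_comodule_def)

sublocale C: bimodule A A C by (rule bimodule_C)
sublocale U: right_module A \<Sigma> by (rule right_module_\<Sigma>)
sublocale reg: bimodule A A "regular_bimod A" by (rule C.R.bimodule_regular)

lemmas UG = U.M.abelian_group_axioms and CG = C.M.abelian_group_axioms

sublocale CC: tensor_pair A C C by unfold_locales
sublocale UC: tensor_pair A \<Sigma> C by unfold_locales

text \<open>The bimodule \<open>\<Sigma> \<otimes>\<^sub>A C\<close> and its pure tensors.\<close>

abbreviation \<Sigma>C where "\<Sigma>C \<equiv> tensor A \<Sigma> C"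
abbreviation tens where "tens \<equiv> pure_tensor A \<Sigma> C"

lemma left_module_CC: "left_module A (tensor A C C)"
  by (rule left_module_tensor[OF bimodule_C C.left_module_axioms])

lemma right_module_UC: "right_module A \<Sigma>C"
  by (rule right_module_tensor[OF right_module_\<Sigma> bimodule_C])

sublocale U_CC: tensor_pair A \<Sigma> "tensor A C C"
  by (rule tensor_pair.intro[OF right_module_\<Sigma> left_module_CC])
sublocale UC_C: tensor_pair A "\<Sigma>C" C
  by (rule tensor_pair.intro[OF right_module_UC C.left_module_axioms])

lemma comult_left: "\<Delta> \<in> left_linear A C (tensor A C C)"
  and comult_right: "\<Delta> \<in> right_linear A C (tensor A C C)"
  and counit_left: "\<epsilon> \<in> left_linear A C (regular_bimod A)"
  and counit_right: "\<epsilon> \<in> right_linear A C (regular_bimod A)"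
  using coring.comult_bilinear[OF coring] coring.counit_bilinear[OF coring]
  by (simp_all add: bilinear_def)

lemma coact_right: "\<rho> \<in> right_linear A \<Sigma> \<Sigma>C"
  using right_comodule.coact_linear[OF comodule] .

lemmas comult_simps = left_linearD(2-)[OF comult_left] right_linear_rsm[OF comult_right]
lemmas coact_simps = right_linearD(2-)[OF coact_right]
lemmas counit_simps = left_linearD(2-)[OF counit_left, simplified] right_linear_rsm[OF counit_right, simplified]

lemmas CC_lsm = tensor_lsm_additive(2)[OF bimodule_C C.left_module_axioms]
    additive_maps_closed[OF tensor_lsm_additive(1)[OF bimodule_C C.left_module_axioms]]
    additive_maps_add[OF tensor_lsm_additive(1)[OF bimodule_C C.left_module_axioms]]
lemmas \<Sigma>C_rsm = tensor_rsm_additive(2)[OF right_module_\<Sigma> bimodule_C]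
    additive_maps_closed[OF tensor_rsm_additive(1)[OF right_module_\<Sigma> bimodule_C]]
    additive_maps_add[OF tensor_rsm_additive(1)[OF right_module_\<Sigma> bimodule_C]]

text \<open>Coassociativity, in the form in which it is used: \<open>u\<^sub>0 \<otimes> u\<^sub>1\<^sub>1 \<otimes> u\<^sub>1\<^sub>2\<close> and \<open>u\<^sub>0\<^sub>0 \<otimes> u\<^sub>0\<^sub>1 \<otimes> u\<^sub>1\<close>
  cannot be told apart by maps that are additive in three variables and balanced in both places.\<close>

definition trilinear where
  "trilinear P b \<longleftrightarrow> (\<forall>v\<in>carrier \<Sigma>. balanced A C C P (b v)) \<and>
     (\<forall>y\<in>carrier C. balanced A \<Sigma> C P (\<lambda>v x. b v x y))"

lemma trilinearD:
  assumes "trilinear P b"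
  shows "v \<in> carrier \<Sigma> \<Longrightarrow> balanced A C C P (b v)"
    and "y \<in> carrier C \<Longrightarrow> balanced A \<Sigma> C P (\<lambda>v x. b v x y)"
  using assms by (simp_all add: trilinear_def)

text \<open>A trilinear map factors through \<open>\<Sigma> \<otimes> (C \<otimes> C)\<close>, and through \<open>(\<Sigma> \<otimes> C) \<otimes> C\<close>.\<close>

lemma balanced_lift_right:
  assumes P: "abelian_group P" and b: "trilinear P b"
  shows "balanced A \<Sigma> (tensor A C C) P (\<lambda>v w. tensor_lift P (b v) w)"
proof -
  interpret P: abelian_group P by (rule P)
  note bv = trilinearD(1)[OF b] and bx = trilinearD(2)[OF b]
  note lift = CC.tensor_lift_additive[OF P bv]
  note simps = additive_maps_closed[OF lift] additive_maps_add[OF lift] CC.tensor_lift_pure[OF P bv]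
    balanced_closed[OF bv] balanced_left[OF bx] balanced_middle[OF bx] U.rsm_closed C.lsm_closed
    CC_lsm
  show ?thesis
  proof (rule balancedI)
    fix v v' w assume v: "v \<in> carrier \<Sigma>" "v' \<in> carrier \<Sigma>" and w: "w \<in> carrier (tensor A C C)"
    show "tensor_lift P (b (v \<oplus>\<^bsub>\<Sigma>\<^esub> v')) w = tensor_lift P (b v) w \<oplus>\<^bsub>P\<^esub> tensor_lift P (b v') w"
      using w v by (induction rule: CC.tensor_induct) (simp_all add: simps P.a_ac)
  next
    fix v a w assume v: "v \<in> carrier \<Sigma>" "a \<in> carrier A" and w: "w \<in> carrier (tensor A C C)"
    show "tensor_lift P (b (v \<triangleleft>\<^bsub>\<Sigma>\<^esub> a)) w = tensor_lift P (b v) (a \<triangleright>\<^bsub>tensor A C C\<^esub> w)"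
      using w v by (induction rule: CC.tensor_induct) (simp_all add: simps)
  qed (simp_all add: simps)
qed

lemma balanced_lift_left:
  assumes P: "abelian_group P" and b: "trilinear P b"
  shows "balanced A \<Sigma>C C P (\<lambda>z c. tensor_lift P (\<lambda>v x. b v x c) z)"
proof -
  interpret P: abelian_group P by (rule P)
  note bv = trilinearD(1)[OF b] and bx = trilinearD(2)[OF b]
  note lift = UC.tensor_lift_additive[OF P bx]
  note simps = additive_maps_closed[OF lift] additive_maps_add[OF lift] UC.tensor_lift_pure[OF P bx]
    balanced_closed[OF bx] balanced_right[OF bv] balanced_middle[OF bv] C.rsm_closed C.lsm_closed
    \<Sigma>C_rsm
  show ?thesis
  proof (rule balancedI)
    fix z c c' assume c: "c \<in> carrier C" "c' \<in> carrier C" and z: "z \<in> carrier \<Sigma>C"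
    show "tensor_lift P (\<lambda>v x. b v x (c \<oplus>\<^bsub>C\<^esub> c')) z
        = tensor_lift P (\<lambda>v x. b v x c) z \<oplus>\<^bsub>P\<^esub> tensor_lift P (\<lambda>v x. b v x c') z"
      using z c by (induction rule: UC.tensor_induct) (simp_all add: simps P.a_ac)
  next
    fix z a c assume c: "a \<in> carrier A" "c \<in> carrier C" and z: "z \<in> carrier \<Sigma>C"
    show "tensor_lift P (\<lambda>v x. b v x c) (z \<triangleleft>\<^bsub>\<Sigma>C\<^esub> a)
        = tensor_lift P (\<lambda>v x. b v x (a \<triangleright>\<^bsub>C\<^esub> c)) z"
      using z c by (induction rule: UC.tensor_induct) (simp_all add: simps)
  qed (simp_all add: simps)
qed

lemma balanced_comult:
  assumes P: "abelian_group P" and b: "trilinear P b"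
  shows "balanced A \<Sigma> C P (\<lambda>v c. tensor_lift P (b v) (\<Delta> c))"
  by (rule balancedI) (simp_all add: comult_simps balancedD[OF balanced_lift_right[OF P b]])

lemma trilinear_pure_tensor:
  "trilinear (tensor A \<Sigma> (tensor A C C))
     (\<lambda>m n p. pure_tensor A \<Sigma> (tensor A C C) m (pure_tensor A C C n p))"
  unfolding trilinear_def
proof (intro conjI ballI)
  show "balanced A C C (tensor A \<Sigma> (tensor A C C))
      (\<lambda>n p. pure_tensor A \<Sigma> (tensor A C C) m (pure_tensor A C C n p))" if "m \<in> carrier \<Sigma>" for m
    by (rule balanced_comp[OF CC.balanced_pure_tensor balanced_additive_right[OF U_CC.balanced_pure_tensor that]])
  show "balanced A \<Sigma> C (tensor A \<Sigma> (tensor A C C))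
      (\<lambda>m n. pure_tensor A \<Sigma> (tensor A C C) m (pure_tensor A C C n p))" if "p \<in> carrier C" for p
    using that
    by (intro balancedI) (simp_all add: balancedD[OF U_CC.balanced_pure_tensor] balancedD[OF CC.balanced_pure_tensor]
        tensor_lsm_additive(2)[OF bimodule_C C.left_module_axioms])
qed

lemma coassoc_lift:
  assumes P: "abelian_group P" and b: "trilinear P b" and u: "u \<in> carrier \<Sigma>"
  shows "tensor_lift P (\<lambda>v c. tensor_lift P (b v) (\<Delta> c)) (\<rho> u)
    = tensor_lift P (\<lambda>v c. tensor_lift P (\<lambda>w x. b w x c) (\<rho> v)) (\<rho> u)"
proof -
  \<comment> \<open>\<open>G\<close> and \<open>G'\<close> are the two factorizations of \<open>b\<close>, and \<open>\<beta>\<close> induces the associativity isomorphism.\<close>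
  let ?UCC = "tensor A \<Sigma> (tensor A C C)"
  define G where "G = (\<lambda>v w. tensor_lift P (b v) w)"
  define G' where "G' = (\<lambda>z c. tensor_lift P (\<lambda>w x. b w x c) z)"
  define \<beta> where "\<beta> = (\<lambda>z p. tensor_lift ?UCC
    (\<lambda>m n. pure_tensor A \<Sigma> (tensor A C C) m (pure_tensor A C C n p)) z)"
  have G: "balanced A \<Sigma> (tensor A C C) P G" unfolding G_def by (rule balanced_lift_right[OF P b])
  have G': "balanced A \<Sigma>C C P G'" unfolding G'_def by (rule balanced_lift_left[OF P b])
  have \<beta>: "balanced A \<Sigma>C C ?UCC \<beta>" unfolding \<beta>_def
    by (rule balanced_lift_left[OF U_CC.abelian_group_tensor trilinear_pure_tensor])
  note ru = coact_simps(1)[OF u]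
  have q1: "balanced A \<Sigma> C ?UCC (\<lambda>x y. pure_tensor A \<Sigma> (tensor A C C) x (\<Delta> y))"
    by (rule balancedI) (simp_all add: comult_simps balancedD[OF U_CC.balanced_pure_tensor])
  have q2: "balanced A \<Sigma> C (tensor A \<Sigma>C C) (\<lambda>x y. pure_tensor A \<Sigma>C C (\<rho> x) y)"
    by (rule balancedI) (simp_all add: coact_simps balancedD[OF UC_C.balanced_pure_tensor])
  define \<zeta> where "\<zeta> = tensor_map A \<Sigma>C C \<rho> (\<lambda>x. x) (\<rho> u)"
  have \<zeta>: "\<zeta> \<in> carrier (tensor A \<Sigma>C C)"
    unfolding \<zeta>_def tensor_map_eq_lift[OF UC_C.tensor_pair_axioms UC.tensor_pair_axioms q2 ru]
    by (rule UC.tensor_lift_closed[OF UC_C.abelian_group_tensor q2 ru])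
  have "tensor_lift P (\<lambda>v c. tensor_lift P (b v) (\<Delta> c)) (\<rho> u)
    = tensor_lift P G (tensor_map A \<Sigma> (tensor A C C) (\<lambda>x. x) \<Delta> (\<rho> u))"
    by (subst tensor_lift_tensor_map[OF U_CC.tensor_pair_axioms UC.tensor_pair_axioms P q1 G])
      (simp_all add: comult_simps ru G_def)
  also have "tensor_map A \<Sigma> (tensor A C C) (\<lambda>x. x) \<Delta> (\<rho> u) = tensor_lift ?UCC \<beta> \<zeta>"
    using right_comodule.coact_coassoc[OF comodule u] by (simp add: \<zeta>_def \<beta>_def tensor_assoc_def)
  also have "tensor_lift P G (tensor_lift ?UCC \<beta> \<zeta>) = tensor_lift P (\<lambda>z p. tensor_lift P G (\<beta> z p)) \<zeta>"
    by (rule UC_C.additive_tensor_lift[OF U_CC.abelian_group_tensor P \<beta> U_CC.tensor_lift_additive[OF P G] \<zeta>])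
  also have "\<dots> = tensor_lift P G' \<zeta>"
  proof (rule UC_C.tensor_lift_cong[OF P balanced_comp[OF \<beta> U_CC.tensor_lift_additive[OF P G]] _ \<zeta>])
    fix z p assume z: "z \<in> carrier \<Sigma>C" and p: "p \<in> carrier C"
    have "tensor_lift P G (\<beta> z p)
      = tensor_lift P (\<lambda>m n. tensor_lift P G (pure_tensor A \<Sigma> (tensor A C C) m (pure_tensor A C C n p))) z"
      unfolding \<beta>_def
      by (rule UC.additive_tensor_lift[OF U_CC.abelian_group_tensor P trilinearD(2)[OF trilinear_pure_tensor p]
            U_CC.tensor_lift_additive[OF P G] z])
    also have "\<dots> = G' z p"
      unfolding G'_def
      by (rule UC.tensor_lift_cong[OF P balanced_comp[OF trilinearD(2)[OF trilinear_pure_tensor p] U_CC.tensor_lift_additive[OF P G]] _ z])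
        (simp add: U_CC.tensor_lift_pure[OF P G] CC.pure_tensor_closed p,
          simp add: G_def CC.tensor_lift_pure[OF P trilinearD(1)[OF b]] p)
    finally show "tensor_lift P G (\<beta> z p) = G' z p" .
  qed
  also have "\<dots> = tensor_lift P (\<lambda>v c. G' (\<rho> v) c) (\<rho> u)"
    unfolding \<zeta>_def
    by (rule tensor_lift_tensor_map[OF UC_C.tensor_pair_axioms UC.tensor_pair_axioms P q2 G'])
      (simp_all add: coact_simps ru)
  finally show ?thesis by (simp add: G'_def)
qed

text \<open>The action \<open>u \<cdot> f = u\<^sub>0 f(u\<^sub>1)\<close>.\<close>

abbreviation act where "act f u \<equiv> tensor_lift \<Sigma> (\<lambda>v c. v \<triangleleft>\<^bsub>\<Sigma>\<^esub> f c) (\<rho> u)"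

text \<open>The elements of \<open>\<^sup>*C\<close>, without the requirement to be \<open>undefined\<close> outside of \<open>C\<close>.\<close>

abbreviation dual where "dual \<equiv> left_linear A C (regular_bimod A)"

lemma dualD:
  assumes "f \<in> dual"
  shows "c \<in> carrier C \<Longrightarrow> f c \<in> carrier A"
    and "\<lbrakk>c \<in> carrier C; d \<in> carrier C\<rbrakk> \<Longrightarrow> f (c \<oplus>\<^bsub>C\<^esub> d) = f c \<oplus>\<^bsub>A\<^esub> f d"
    and "\<lbrakk>a \<in> carrier A; c \<in> carrier C\<rbrakk> \<Longrightarrow> f (a \<triangleright>\<^bsub>C\<^esub> c) = a \<otimes>\<^bsub>A\<^esub> f c"
  using left_linearD[OF assms] by simp_all

lemma balanced_act: "f \<in> dual \<Longrightarrow> balanced A \<Sigma> C \<Sigma> (\<lambda>v c. v \<triangleleft>\<^bsub>\<Sigma>\<^esub> f c)"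
  by (rule balancedI) (simp_all add: dualD U.rsm_closed U.rsm_l_distr U.rsm_r_distr U.rsm_assoc)

lemma act_closed: "\<lbrakk>f \<in> dual; u \<in> carrier \<Sigma>\<rbrakk> \<Longrightarrow> act f u \<in> carrier \<Sigma>"
  by (rule UC.tensor_lift_closed[OF UG balanced_act]) (simp_all add: coact_simps)

lemma act_add:
  "\<lbrakk>f \<in> dual; u \<in> carrier \<Sigma>; v \<in> carrier \<Sigma>\<rbrakk> \<Longrightarrow> act f (u \<oplus>\<^bsub>\<Sigma>\<^esub> v) = act f u \<oplus>\<^bsub>\<Sigma>\<^esub> act f v"
  by (simp add: coact_simps
      additive_maps_add[OF UC.tensor_lift_additive[OF UG balanced_act]])

text \<open>\<open>C\<close> is a right comodule over itself. Its action of \<open>\<^sup>*C\<close> is \<open>hit f c = c\<^sub>1 f(c\<^sub>2)\<close>, so that all facts about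
  \<open>act\<close> specialize to \<open>hit\<close>.\<close>

lemma self_comodule: "comodule_data A C \<Delta> \<epsilon> C \<Delta>"
  using coring comult_right coring.coassoc[OF coring] coring.counit_right[OF coring] C.right_module_axioms
  by (intro comodule_data.intro right_comodule.intro right_comodule_axioms.intro) auto

abbreviation hit where "hit f c \<equiv> coring_hit C \<Delta> f c"

lemma hit_closed: "\<lbrakk>f \<in> dual; c \<in> carrier C\<rbrakk> \<Longrightarrow> hit f c \<in> carrier C"
  unfolding coring_hit_def by (rule comodule_data.act_closed[OF self_comodule])

lemma hit_add:
  "\<lbrakk>f \<in> dual; c \<in> carrier C; d \<in> carrier C\<rbrakk> \<Longrightarrow> hit f (c \<oplus>\<^bsub>C\<^esub> d) = hit f c \<oplus>\<^bsub>C\<^esub> hit f d"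
  unfolding coring_hit_def by (rule comodule_data.act_add[OF self_comodule])

lemma balanced_hit: "f \<in> dual \<Longrightarrow> balanced A C C C (\<lambda>v c. v \<triangleleft>\<^bsub>C\<^esub> f c)"
  by (rule comodule_data.balanced_act[OF self_comodule])

lemma hit_lsm:
  assumes f: "f \<in> dual" and a: "a \<in> carrier A" and c: "c \<in> carrier C"
  shows "hit f (a \<triangleright>\<^bsub>C\<^esub> c) = a \<triangleright>\<^bsub>C\<^esub> hit f c"
proof -
  note lift = CC.tensor_lift_additive[OF CG balanced_hit[OF f]]
  have "tensor_lift C (\<lambda>v c. v \<triangleleft>\<^bsub>C\<^esub> f c) (a \<triangleright>\<^bsub>tensor A C C\<^esub> z)
    = a \<triangleright>\<^bsub>C\<^esub> tensor_lift C (\<lambda>v c. v \<triangleleft>\<^bsub>C\<^esub> f c) z" if "z \<in> carrier (tensor A C C)" for z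
    using that a
    by (induction rule: CC.tensor_induct)
     (simp_all add: CC_lsm
    CC.tensor_lift_pure[OF CG balanced_hit[OF f]]
    additive_maps_add[OF lift] additive_maps_closed[OF lift] C.lsm_r_distr C.lsm_rsm C.lsm_closed dualD[OF f])
  then show ?thesis using a c unfolding coring_hit_def by (simp add: comult_simps)
qed

lemma balanced_comp_hit:
  assumes "f \<in> dual" "balanced A \<Sigma> C P b"
  shows "balanced A \<Sigma> C P (\<lambda>v c. b v (hit f c))"
  by (rule balancedI)
    (simp_all add: hit_closed[OF assms(1)] hit_add[OF assms(1)] hit_lsm[OF assms(1)] balancedD[OF assms(2)])

text \<open>\<open>\<rho>(u \<cdot> f) = u\<^sub>0 \<otimes> u\<^sub>1 f(u\<^sub>2)\<close>.\<close>

lemma coact_act: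
  assumes f: "f \<in> dual" and u: "u \<in> carrier \<Sigma>"
  shows "\<rho> (act f u) = tensor_lift \<Sigma>C (\<lambda>v c. tens v (hit f c)) (\<rho> u)"
proof -
  let ?T = "\<Sigma>C"
  note ru = coact_simps(1)[OF u]
  note P = UC.abelian_group_tensor
  define b where "b = (\<lambda>v x y. tens v (x \<triangleleft>\<^bsub>C\<^esub> f y))"
  have b: "trilinear ?T b"
    unfolding trilinear_def
  proof (intro conjI ballI)
    show "balanced A C C ?T (b v)" if "v \<in> carrier \<Sigma>" for v
      unfolding b_def
      by (rule balanced_comp[OF balanced_hit[OF f] balanced_additive_right[OF UC.balanced_pure_tensor that]])
    show "balanced A \<Sigma> C ?T (\<lambda>v x. b v x y)" if "y \<in> carrier C" for y
      using that unfolding b_def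
      by (intro balancedI)
        (simp_all add: balancedD[OF UC.balanced_pure_tensor] C.rsm_closed C.rsm_l_distr C.lsm_rsm dualD[OF f])
  qed
  have "\<rho> (act f u) = tensor_lift ?T (\<lambda>v c. \<rho> (v \<triangleleft>\<^bsub>\<Sigma>\<^esub> f c)) (\<rho> u)"
    by (rule UC.additive_tensor_lift[OF UG P balanced_act[OF f]
          right_linear_additive[OF coact_right] ru])
  also have "\<dots> = tensor_lift ?T (\<lambda>v c. tensor_lift ?T (\<lambda>w x. b w x c) (\<rho> v)) (\<rho> u)"
    by (rule UC.tensor_lift_cong[OF P balanced_comp[OF balanced_act[OF f] right_linear_additive[OF coact_right]] _ ru])
      (simp add: coact_simps dualD[OF f] tensor_rsm(2)[OF right_module_\<Sigma> bimodule_C] b_def)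
  also have "\<dots> = tensor_lift ?T (\<lambda>v c. tensor_lift ?T (b v) (\<Delta> c)) (\<rho> u)"
    by (rule coassoc_lift[OF P b u, symmetric])
  also have "\<dots> = tensor_lift ?T (\<lambda>v c. tens v (hit f c)) (\<rho> u)"
  proof (rule UC.tensor_lift_cong[OF P balanced_comult[OF P b] _ ru])
    fix v c assume v: "v \<in> carrier \<Sigma>" and c: "c \<in> carrier C"
    show "tensor_lift ?T (b v) (\<Delta> c) = tens v (hit f c)"
      unfolding b_def coring_hit_def
      by (rule CC.additive_tensor_lift[OF CG P balanced_hit[OF f]
            balanced_additive_right[OF UC.balanced_pure_tensor v], symmetric])
        (simp add: comult_simps c)
  qed
  finally show ?thesis .
qed

text \<open>\<open>b((u \<cdot> f)\<^sub>0, (u \<cdot> f)\<^sub>1) = b(u\<^sub>0, u\<^sub>1 f(u\<^sub>2))\<close>.\<close>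

lemma lift_coact_act:
  assumes f: "f \<in> dual" and u: "u \<in> carrier \<Sigma>" and P: "abelian_group P" and b: "balanced A \<Sigma> C P b"
  shows "tensor_lift P b (\<rho> (act f u)) = tensor_lift P (\<lambda>v c. b v (hit f c)) (\<rho> u)"
proof -
  note ru = coact_simps(1)[OF u]
  note q = balanced_comp_hit[OF f UC.balanced_pure_tensor]
  have "tensor_lift P b (\<rho> (act f u))
    = tensor_lift P (\<lambda>v c. tensor_lift P b (tens v (hit f c))) (\<rho> u)"
    unfolding coact_act[OF f u]
    by (rule UC.additive_tensor_lift[OF UC.abelian_group_tensor P q UC.tensor_lift_additive[OF P b] ru])
  also have "\<dots> = tensor_lift P (\<lambda>v c. b v (hit f c)) (\<rho> u)"
    by (rule UC.tensor_lift_cong[OF P balanced_comp[OF q UC.tensor_lift_additive[OF P b]] _ ru])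
      (simp add: UC.tensor_lift_pure[OF P b] hit_closed f)
  finally show ?thesis .
qed

text \<open>The ring \<open>\<^sup>*C\<close>, whose product is \<open>f # g = g \<circ> hit f\<close>.\<close>

abbreviation S where "S \<equiv> left_dual_ring A C \<Delta> \<epsilon>"

lemma S_simps:
  "carrier S = dual \<inter> extensional (carrier C)" "f \<otimes>\<^bsub>S\<^esub> g = (\<lambda>c\<in>carrier C. g (hit f c))"
  "\<one>\<^bsub>S\<^esub> = (\<lambda>c\<in>carrier C. \<epsilon> c)" "\<zero>\<^bsub>S\<^esub> = (\<lambda>c\<in>carrier C. \<zero>\<^bsub>A\<^esub>)"
  "f \<oplus>\<^bsub>S\<^esub> g = (\<lambda>c\<in>carrier C. f c \<oplus>\<^bsub>A\<^esub> g c)"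
  by (simp_all add: left_dual_ring_def)

lemma act_cong:
  assumes "f \<in> dual" "u \<in> carrier \<Sigma>" "\<And>c. c \<in> carrier C \<Longrightarrow> f c = g c"
  shows "act f u = act g u"
  by (rule UC.tensor_lift_cong[OF UG balanced_act[OF assms(1)]])
    (simp_all add: assms coact_simps)

lemma act_act:
  assumes f: "f \<in> dual" and g: "g \<in> dual" and u: "u \<in> carrier \<Sigma>"
  shows "act g (act f u) = act (f \<otimes>\<^bsub>S\<^esub> g) u"
  unfolding lift_coact_act[OF f u UG balanced_act[OF g]]
  by (rule UC.tensor_lift_cong[OF UG balanced_comp_hit[OF f balanced_act[OF g]]])
    (simp_all add: S_simps coact_simps u)

lemma act_counit: "u \<in> carrier \<Sigma> \<Longrightarrow> act \<one>\<^bsub>S\<^esub> u = u"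
  using act_cong[OF counit_left, of u "\<one>\<^bsub>S\<^esub>"] right_comodule.coact_counit[OF comodule]
  by (simp add: S_simps)

lemma act_plus:
  assumes f: "f \<in> dual" and g: "g \<in> dual" and u: "u \<in> carrier \<Sigma>"
  shows "act (f \<oplus>\<^bsub>S\<^esub> g) u = act f u \<oplus>\<^bsub>\<Sigma>\<^esub> act g u"
proof -
  note ru = coact_simps(1)[OF u]
  note b = balanced_act[OF f] balanced_act[OF g]
  show ?thesis
    unfolding UC.tensor_lift_plus[OF UG b ru, symmetric]
    by (rule sym, rule UC.tensor_lift_cong[OF UG
          UC.balanced_plus[OF UG b] _ ru])
      (simp add: S_simps dualD[OF f] dualD[OF g] U.rsm_r_distr)
qed

lemma hit_hit:
  "\<lbrakk>f \<in> dual; g \<in> dual; c \<in> carrier C\<rbrakk> \<Longrightarrow> hit g (hit f c) = hit (f \<otimes>\<^bsub>S\<^esub> g) c"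
  unfolding coring_hit_def by (rule comodule_data.act_act[OF self_comodule])

lemma hit_counit: "c \<in> carrier C \<Longrightarrow> hit \<one>\<^bsub>S\<^esub> c = c"
  unfolding coring_hit_def by (rule comodule_data.act_counit[OF self_comodule])

lemma hit_plus:
  "\<lbrakk>f \<in> dual; g \<in> dual; c \<in> carrier C\<rbrakk> \<Longrightarrow> hit (f \<oplus>\<^bsub>S\<^esub> g) c = hit f c \<oplus>\<^bsub>C\<^esub> hit g c"
  unfolding coring_hit_def by (rule comodule_data.act_plus[OF self_comodule])

text \<open>\<open>\<epsilon>(c\<^sub>1 f(c\<^sub>2)) = f(\<epsilon>(c\<^sub>1) c\<^sub>2) = f(c)\<close>.\<close>

lemma counit_hit:
  assumes f: "f \<in> dual" and c: "c \<in> carrier C"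
  shows "\<epsilon> (hit f c) = f c"
proof -
  have dc: "\<Delta> c \<in> carrier (tensor A C C)" using c by (simp add: comult_simps)
  have b: "balanced A C C C (\<lambda>x y. \<epsilon> x \<triangleright>\<^bsub>C\<^esub> y)"
    by (rule balancedI) (simp_all add: counit_simps C.lsm_closed C.lsm_l_distr C.lsm_r_distr C.lsm_assoc)
  have reg: "abelian_group (regular_bimod A)" by (rule reg.M.abelian_group_axioms)
  have "\<epsilon> (hit f c) = tensor_lift (regular_bimod A) (\<lambda>x y. \<epsilon> (x \<triangleleft>\<^bsub>C\<^esub> f y)) (\<Delta> c)"
    unfolding coring_hit_def
    by (rule CC.additive_tensor_lift[OF CG reg balanced_hit[OF f]
          left_linear_additive[OF counit_left] dc])
  also have "\<dots> = tensor_lift (regular_bimod A) (\<lambda>x y. f (\<epsilon> x \<triangleright>\<^bsub>C\<^esub> y)) (\<Delta> c)"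
    by (rule CC.tensor_lift_cong[OF reg balanced_comp[OF balanced_hit[OF f] left_linear_additive[OF counit_left]] _ dc])
      (simp add: counit_simps dualD[OF f])
  also have "\<dots> = f (tensor_lift C (\<lambda>x y. \<epsilon> x \<triangleright>\<^bsub>C\<^esub> y) (\<Delta> c))"
    by (rule CC.additive_tensor_lift[OF CG reg b left_linear_additive[OF f] dc, symmetric])
  also have "\<dots> = f c" using coring.counit_left[OF coring c] by simp
  finally show ?thesis .
qed

lemma mult_dual: "\<lbrakk>f \<in> dual; g \<in> dual\<rbrakk> \<Longrightarrow> f \<otimes>\<^bsub>S\<^esub> g \<in> dual"
  unfolding S_simps
  by (rule left_linearI) (simp_all add: hit_closed hit_add hit_lsm dualD C.lsm_closed)

lemma ring_S: "ring S"
proof (rule ringI)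
  note p = left_linear_pointwise[OF C.left_module_axioms reg.left_module_axioms, simplified]
  show "abelian_group S"
    by (rule abelian_group_pointwise[OF reg.M.abelian_group_axioms, where X = "carrier C"])
      (use p in \<open>auto simp: S_simps dualD\<close>)
  have one: "\<one>\<^bsub>S\<^esub> \<in> dual" unfolding S_simps
    by (rule left_linearI) (simp_all add: counit_simps C.lsm_closed)
  show "monoid S"
  proof (rule monoidI)
    fix f g h assume fgh: "f \<in> carrier S" "g \<in> carrier S" "h \<in> carrier S"
    show "f \<otimes>\<^bsub>S\<^esub> g \<in> carrier S"
      using fgh mult_dual[of f g] by (simp add: S_simps)
    show "f \<otimes>\<^bsub>S\<^esub> g \<otimes>\<^bsub>S\<^esub> h = f \<otimes>\<^bsub>S\<^esub> (g \<otimes>\<^bsub>S\<^esub> h)"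
      using fgh unfolding S_simps(2)[of "f \<otimes>\<^bsub>S\<^esub> g" h] S_simps(2)[of f "g \<otimes>\<^bsub>S\<^esub> h"]
      by (intro restrict_ext) (simp add: S_simps(1) S_simps(2)[of g h] hit_closed flip: hit_hit)
  next
    show "\<one>\<^bsub>S\<^esub> \<in> carrier S" using one by (simp add: S_simps)
  next
    fix f assume f: "f \<in> carrier S"
    then show "\<one>\<^bsub>S\<^esub> \<otimes>\<^bsub>S\<^esub> f = f" "f \<otimes>\<^bsub>S\<^esub> \<one>\<^bsub>S\<^esub> = f"
      unfolding S_simps(2)
      by (auto intro!: extensionalityI[of _ "carrier C"] simp: hit_counit[unfolded S_simps(3)] S_simps(1,3) hit_closed counit_hit)
  qed
next
  fix f g h assume fgh: "f \<in> carrier S" "g \<in> carrier S" "h \<in> carrier S"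
  show "(f \<oplus>\<^bsub>S\<^esub> g) \<otimes>\<^bsub>S\<^esub> h = f \<otimes>\<^bsub>S\<^esub> h \<oplus>\<^bsub>S\<^esub> g \<otimes>\<^bsub>S\<^esub> h"
    using fgh unfolding S_simps(2) S_simps(5)[of "restrict _ _"]
    by (intro restrict_ext) (simp add: S_simps(1) hit_plus hit_closed dualD)
  show "h \<otimes>\<^bsub>S\<^esub> (f \<oplus>\<^bsub>S\<^esub> g) = h \<otimes>\<^bsub>S\<^esub> f \<oplus>\<^bsub>S\<^esub> h \<otimes>\<^bsub>S\<^esub> g"
    using fgh unfolding S_simps(2,5)
    by (intro restrict_ext) (simp add: S_simps(1) hit_closed)
qed

text \<open>\<open>\<Sigma>\<close> with evaluation of endomorphisms on the left and the action of \<open>\<^sup>*C\<close> on the right.\<close>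

abbreviation B where "B \<equiv> comodule_bimod \<Sigma> \<rho>"

lemma B_simps:
  "carrier B = carrier \<Sigma>" "\<zero>\<^bsub>B\<^esub> = \<zero>\<^bsub>\<Sigma>\<^esub>" "u \<oplus>\<^bsub>B\<^esub> v = u \<oplus>\<^bsub>\<Sigma>\<^esub> v" "t \<triangleright>\<^bsub>B\<^esub> u = t u" "u \<triangleleft>\<^bsub>B\<^esub> f = act f u"
  by (simp_all add: comodule_bimod_def)

lemma right_module_B: "right_module S B"
proof (intro right_module.intro right_module_axioms.intro ring_S)
  show "abelian_group B"
    using UG abelian_groupE[OF UG]
    by (intro abelian_groupI) (auto simp: B_simps)
qed (simp_all add: B_simps act_closed act_add act_act act_counit act_plus, simp_all add: S_simps(1) act_closed act_add act_act act_plus)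

section \<open>Colinear endomorphisms\<close>

text \<open>The colinear endomorphisms of \<open>\<Sigma>\<close> are considered inside the ring \<open>endos\<close> of all \<open>A\<close>-linear ones.\<close>

abbreviation T where "T \<equiv> right_colinear_maps A C \<Sigma> \<rho> \<Sigma> \<rho>"

abbreviation endos where "endos \<equiv> endo_ring \<Sigma> (right_linear A \<Sigma> \<Sigma> \<inter> extensional (carrier \<Sigma>))"

sublocale endos: ring endos by (rule ring_endomorphisms[OF right_module_\<Sigma>])

lemma balanced_map_left:
  assumes "t \<in> right_linear A \<Sigma> \<Sigma>" "balanced A \<Sigma> C P b"
  shows "balanced A \<Sigma> C P (\<lambda>v c. b (t v) c)"
  by (rule balancedI) (simp_all add: right_linearD[OF assms(1)] balancedD[OF assms(2)])

lemma T_iff: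
  "t \<in> T \<longleftrightarrow> t \<in> right_linear A \<Sigma> \<Sigma> \<inter> extensional (carrier \<Sigma>) \<and>
     (\<forall>u\<in>carrier \<Sigma>. \<rho> (t u) = tensor_lift \<Sigma>C (\<lambda>v c. tens (t v) c) (\<rho> u))"
  using tensor_map_eq_lift[OF UC.tensor_pair_axioms UC.tensor_pair_axioms
      balanced_map_left[OF _ UC.balanced_pure_tensor]]
  by (auto simp: right_colinear_maps_def coact_simps)

text \<open>\<open>b((t u)\<^sub>0, (t u)\<^sub>1) = b(t u\<^sub>0, u\<^sub>1)\<close>.\<close>

lemma lift_coact_colinear:
  assumes t: "t \<in> T" and u: "u \<in> carrier \<Sigma>" and P: "abelian_group P" and b: "balanced A \<Sigma> C P b"
  shows "tensor_lift P b (\<rho> (t u)) = tensor_lift P (\<lambda>v c. b (t v) c) (\<rho> u)"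
proof -
  have tl: "t \<in> right_linear A \<Sigma> \<Sigma>" using t by (simp add: T_iff)
  have "\<rho> (t u) = tensor_map A \<Sigma> C t (\<lambda>c. c) (\<rho> u)"
    using t u by (simp add: right_colinear_maps_def)
  then show ?thesis
    using tensor_lift_tensor_map[OF UC.tensor_pair_axioms UC.tensor_pair_axioms P
        balanced_map_left[OF tl UC.balanced_pure_tensor] b, of "\<rho> u"] u
    by (simp add: coact_simps right_linear_closed[OF tl])
qed

text \<open>Both sides \<open>h u t\<close> and \<open>h' u t\<close> of the colinearity condition at \<open>u\<close> are additive in \<open>t\<close>, which gives
  closure under the additive operations.\<close>

lemma ring_T: "ring (T_ring A C \<Sigma> \<rho>)"
  unfolding T_ring_def
proof (rule ring_endo_ring[OF UG])
  let ?P = "\<Sigma>C"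
  define h h' where "h = (\<lambda>u (t :: 's \<Rightarrow> 's). \<rho> (t u))" and
    "h' = (\<lambda>u (t :: 's \<Rightarrow> 's). tensor_lift ?P (\<lambda>v c. tens (t v) c) (\<rho> u))"
  have E: "t \<in> carrier endos \<longleftrightarrow> t \<in> right_linear A \<Sigma> \<Sigma> \<inter> extensional (carrier \<Sigma>)" for t
    by simp
  have lin: "t \<in> right_linear A \<Sigma> \<Sigma>" if "t \<in> carrier endos" for t using that by simp
  have h: "h u \<in> additive_maps endos ?P" if u: "u \<in> carrier \<Sigma>" for u
    using u unfolding h_def
    by (intro additive_mapsI) (auto simp: coact_simps right_linearD)
  note b = balanced_map_left[OF lin UC.balanced_pure_tensor]
  have h': "h' u \<in> additive_maps endos ?P" if u: "u \<in> carrier \<Sigma>" for u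
  proof (rule additive_mapsI)
    note ru = coact_simps(1)[OF u]
    fix s assume s: "s \<in> carrier endos"
    show "h' u s \<in> carrier ?P" unfolding h'_def
      by (rule UC.tensor_lift_closed[OF UC.abelian_group_tensor b[OF s] ru])
    fix t assume t: "t \<in> carrier endos"
    show "h' u (s \<oplus>\<^bsub>endos\<^esub> t) = h' u s \<oplus>\<^bsub>?P\<^esub> h' u t"
      unfolding h'_def UC.tensor_lift_plus[OF UC.abelian_group_tensor b[OF s] b[OF t] ru, symmetric]
      by (rule UC.tensor_lift_cong[OF UC.abelian_group_tensor b[OF endos.a_closed[OF s t]] _ ru])
        (use s t in \<open>auto simp: UC.pure_tensor_add_left right_linear_closed\<close>)
  qed
  have T: "t \<in> T \<longleftrightarrow> t \<in> carrier endos \<and> (\<forall>u\<in>carrier \<Sigma>. h u t = h' u t)" for t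
    by (simp add: T_iff h_def h'_def)
  note EA = endos.abelian_group_axioms and PA = UC.abelian_group_tensor
  interpret P: abelian_group ?P by (rule PA)
  show "T \<subseteq> additive_maps \<Sigma> \<Sigma> \<inter> extensional (carrier \<Sigma>)"
    by (auto simp: T_iff right_linear_additive)
  have "\<zero>\<^bsub>endos\<^esub> \<in> T"
    unfolding T by (simp add: additive_maps_zero[OF EA PA h] additive_maps_zero[OF EA PA h'] del: endo_ring_simps)
  then show "(\<lambda>u\<in>carrier \<Sigma>. \<zero>\<^bsub>\<Sigma>\<^esub>) \<in> T" by simp
  fix s assume s: "s \<in> T"
  then have sE: "s \<in> carrier endos" and sh: "\<forall>u\<in>carrier \<Sigma>. h u s = h' u s" by (auto simp: T)
  have "\<ominus>\<^bsub>endos\<^esub> s \<in> T"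
    unfolding T using sE sh
    by (simp add: additive_maps_minus[OF EA PA h] additive_maps_minus[OF EA PA h'] del: endo_ring_simps)
  moreover have "\<ominus>\<^bsub>endos\<^esub> s = (\<lambda>u\<in>carrier \<Sigma>. \<ominus>\<^bsub>\<Sigma>\<^esub> s u)"
    by (rule endos.minus_equality)
      (use sE right_linear_pointwise(3)[OF right_module_\<Sigma> right_module_\<Sigma>, of s] in
        \<open>auto simp: U.M.l_neg right_linear_closed intro!: restrict_ext\<close>)
  ultimately show "(\<lambda>u\<in>carrier \<Sigma>. \<ominus>\<^bsub>\<Sigma>\<^esub> s u) \<in> T" by simp
  fix t assume t: "t \<in> T"
  then have tE: "t \<in> carrier endos" and th: "\<forall>u\<in>carrier \<Sigma>. h u t = h' u t" by (auto simp: T)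
  have "s \<oplus>\<^bsub>endos\<^esub> t \<in> T"
    unfolding T using sE sh tE th
    by (simp add: additive_maps_add[OF h] additive_maps_add[OF h'] endos.a_closed del: endo_ring_simps)
  then show "(\<lambda>u\<in>carrier \<Sigma>. s u \<oplus>\<^bsub>\<Sigma>\<^esub> t u) \<in> T" by simp
  have st: "compose (carrier \<Sigma>) s t \<in> carrier endos" using endos.m_closed[OF sE tE] by simp
  have "\<rho> (s (t u)) = tensor_lift ?P (\<lambda>v c. tens (compose (carrier \<Sigma>) s t v) c) (\<rho> u)"
    if u: "u \<in> carrier \<Sigma>" for u
  proof -
    note ru = coact_simps(1)[OF u]
    have tu: "t u \<in> carrier \<Sigma>" using right_linear_closed[OF lin[OF tE] u] .
    have "\<rho> (s (t u)) = tensor_lift ?P (\<lambda>v c. tens (s v) c) (\<rho> (t u))"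
      using s tu by (simp add: T_iff)
    also have "\<dots> = tensor_lift ?P (\<lambda>v c. tens (s (t v)) c) (\<rho> u)"
      by (rule lift_coact_colinear[OF t u PA b[OF sE]])
    also have "\<dots> = tensor_lift ?P (\<lambda>v c. tens (compose (carrier \<Sigma>) s t v) c) (\<rho> u)"
      by (rule UC.tensor_lift_cong[OF PA balanced_map_left[OF lin[OF tE] b[OF sE]] _ ru]) (simp add: compose_def)
    finally show ?thesis .
  qed
  then show "compose (carrier \<Sigma>) s t \<in> T"
    using st by (simp add: T_iff) (simp add: compose_def)
next
  have "tensor_lift \<Sigma>C (\<lambda>v c. tens ((\<lambda>u\<in>carrier \<Sigma>. u) v) c) (\<rho> u) = \<rho> u"
    if u: "u \<in> carrier \<Sigma>" for u
  proof -
    note ru = coact_simps(1)[OF u]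
    show ?thesis
      using UC.tensor_lift_cong[OF UC.abelian_group_tensor UC.balanced_pure_tensor _ ru,
          of "\<lambda>v c. tens ((\<lambda>u\<in>carrier \<Sigma>. u) v) c"]
      by (simp add: UC.tensor_lift_pure_tensor[OF ru])
  qed
  then show "(\<lambda>u\<in>carrier \<Sigma>. u) \<in> T"
    using endos.one_closed by (simp add: T_iff)
qed

lemma T_act:
  assumes t: "t \<in> T" and f: "f \<in> dual" and u: "u \<in> carrier \<Sigma>"
  shows "t (act f u) = act f (t u)"
proof -
  note ru = coact_simps(1)[OF u]
  have tl: "t \<in> right_linear A \<Sigma> \<Sigma>" using t by (simp add: T_iff)
  have "t (act f u) = tensor_lift \<Sigma> (\<lambda>v c. t (v \<triangleleft>\<^bsub>\<Sigma>\<^esub> f c)) (\<rho> u)"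
    by (rule UC.additive_tensor_lift[OF UG UG balanced_act[OF f]
          right_linear_additive[OF tl] ru])
  also have "\<dots> = tensor_lift \<Sigma> (\<lambda>v c. t v \<triangleleft>\<^bsub>\<Sigma>\<^esub> f c) (\<rho> u)"
    by (rule UC.tensor_lift_cong[OF UG
          balanced_comp[OF balanced_act[OF f] right_linear_additive[OF tl]] _ ru])
      (simp add: right_linear_rsm[OF tl] dualD[OF f])
  also have "\<dots> = act f (t u)"
    by (rule lift_coact_colinear[OF t u UG balanced_act[OF f], symmetric])
  finally show ?thesis .
qed

lemma T_subset_endos: "T \<subseteq> right_linear S B B \<inter> extensional (carrier \<Sigma>)"
proof
  fix t assume t: "t \<in> T"
  then have tl: "t \<in> right_linear A \<Sigma> \<Sigma>" "t \<in> extensional (carrier \<Sigma>)" by (simp_all add: T_iff)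
  show "t \<in> right_linear S B B \<inter> extensional (carrier \<Sigma>)"
    by (intro IntI right_linearI) (simp_all add: B_simps right_linearD[OF tl(1)] tl(2) T_act[OF t] S_simps(1))
qed

text \<open>Right multiplication \<open>f a\<close> of a functional by an element of \<open>A\<close>.\<close>

lemma scale_dual:
  assumes "f \<in> dual" "a \<in> carrier A"
  shows "(\<lambda>c. f c \<otimes>\<^bsub>A\<^esub> a) \<in> dual"
  by (rule left_linearI) (simp_all add: dualD[OF assms(1)] assms(2) C.R.l_distr C.R.m_assoc)

lemma act_scale:
  assumes f: "f \<in> dual" and a: "a \<in> carrier A" and u: "u \<in> carrier \<Sigma>"
  shows "act (\<lambda>c. f c \<otimes>\<^bsub>A\<^esub> a) u = act f u \<triangleleft>\<^bsub>\<Sigma>\<^esub> a"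
proof -
  have h: "(\<lambda>v. v \<triangleleft>\<^bsub>\<Sigma>\<^esub> a) \<in> additive_maps \<Sigma> \<Sigma>"
    by (rule additive_mapsI) (simp_all add: a U.rsm_closed U.rsm_l_distr)
  note ru = coact_simps(1)[OF u]
  have "act f u \<triangleleft>\<^bsub>\<Sigma>\<^esub> a = tensor_lift \<Sigma> (\<lambda>v c. v \<triangleleft>\<^bsub>\<Sigma>\<^esub> f c \<triangleleft>\<^bsub>\<Sigma>\<^esub> a) (\<rho> u)"
    by (rule UC.additive_tensor_lift[OF UG UG balanced_act[OF f] h ru])
  also have "\<dots> = act (\<lambda>c. f c \<otimes>\<^bsub>A\<^esub> a) u"
    by (rule UC.tensor_lift_cong[OF UG balanced_comp[OF balanced_act[OF f] h] _ ru])
      (simp add: U.rsm_assoc dualD[OF f] a)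
  finally show ?thesis by simp
qed

text \<open>The action of \<open>A\<close> is recovered from that of \<open>\<^sup>*C\<close>, so \<open>\<^sup>*C\<close>-linear maps are \<open>A\<close>-linear.\<close>

lemma act_counit_scale:
  "\<lbrakk>a \<in> carrier A; u \<in> carrier \<Sigma>\<rbrakk> \<Longrightarrow> act (\<lambda>c. \<epsilon> c \<otimes>\<^bsub>A\<^esub> a) u = u \<triangleleft>\<^bsub>\<Sigma>\<^esub> a"
  using act_scale[OF counit_left] right_comodule.coact_counit[OF comodule] by simp

lemma dual_module_context_eq: "dual_module_context A C \<Delta> \<epsilon> \<Sigma> \<rho> = module_context S B"
  by (simp add: dual_module_context_def module_context_def T_tilde_ring_def Q_tilde_bimod_def hom_bimod_def
      endo_ring_def B_simps(1-3) Let_def)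

lemma ring1_dual_module_context:
  "ring1 (dual_module_context A C \<Delta> \<epsilon> \<Sigma> \<rho>) = endo_ring \<Sigma> (right_linear S B B \<inter> extensional (carrier \<Sigma>))"
  by (simp add: dual_module_context_def T_tilde_ring_def)

end

section \<open>The dual comodule\<close>

text \<open>A comodule with the dual basis that enters the definition of the left coaction on \<open>\<Sigma>\<^sup>*\<close>.\<close>

locale dual_comodule = comodule_data A C \<Delta> \<epsilon> \<Sigma> \<rho> for A C \<Delta> \<epsilon> \<Sigma> \<rho> +
  fixes n :: nat and e \<phi>
  assumes basis: "is_dual_basis A \<Sigma> n e \<phi>"
    and choice: "(SOME (n, e, \<phi>). is_dual_basis A \<Sigma> n e \<phi>) = (n, e, \<phi>)"
begin

abbreviation D where "D \<equiv> right_dual A \<Sigma>"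

lemma D_simps:
  "carrier D = right_linear A \<Sigma> (regular_bimod A) \<inter> extensional (carrier \<Sigma>)"
  "\<zero>\<^bsub>D\<^esub> = (\<lambda>u\<in>carrier \<Sigma>. \<zero>\<^bsub>A\<^esub>)" "f \<oplus>\<^bsub>D\<^esub> g = (\<lambda>u\<in>carrier \<Sigma>. f u \<oplus>\<^bsub>A\<^esub> g u)"
  "a \<triangleright>\<^bsub>D\<^esub> f = (\<lambda>u\<in>carrier \<Sigma>. a \<otimes>\<^bsub>A\<^esub> f u)" "f \<triangleleft>\<^bsub>D\<^esub> t = compose (carrier \<Sigma>) f t"
  by (simp_all add: right_dual_def)

lemma DD:
  assumes "f \<in> carrier D"
  shows "u \<in> carrier \<Sigma> \<Longrightarrow> f u \<in> carrier A"
    and "\<lbrakk>u \<in> carrier \<Sigma>; v \<in> carrier \<Sigma>\<rbrakk> \<Longrightarrow> f (u \<oplus>\<^bsub>\<Sigma>\<^esub> v) = f u \<oplus>\<^bsub>A\<^esub> f v"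
    and "\<lbrakk>a \<in> carrier A; u \<in> carrier \<Sigma>\<rbrakk> \<Longrightarrow> f (u \<triangleleft>\<^bsub>\<Sigma>\<^esub> a) = f u \<otimes>\<^bsub>A\<^esub> a"
    and "f \<in> extensional (carrier \<Sigma>)"
  using assms right_linearD[of f A \<Sigma> "regular_bimod A"] by (simp_all add: D_simps)

lemma abelian_group_D: "abelian_group D"
  using right_linear_pointwise[OF right_module_\<Sigma> reg.right_module_axioms]
  by (intro abelian_group_pointwise[OF reg.M.abelian_group_axioms, where X = "carrier \<Sigma>"])
    (auto simp: D_simps right_linear_closed[of _ A \<Sigma> "regular_bimod A", simplified])

lemma left_module_D: "left_module A D"
proof (intro left_module.intro left_module_axioms.intro abelian_group_D C.R.ring_axioms)
  show "a \<triangleright>\<^bsub>D\<^esub> f \<in> carrier D" if "a \<in> carrier A" "f \<in> carrier D" for a f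
    unfolding D_simps(1,4)
    by (intro IntI right_linearI) (simp_all add: DD[OF that(2)] that(1) U.rsm_closed C.R.r_distr C.R.m_assoc)
  show "\<one>\<^bsub>A\<^esub> \<triangleright>\<^bsub>D\<^esub> f = f" if "f \<in> carrier D" for f
    using DD[OF that] by (auto simp: D_simps(4) intro!: extensionalityI[of _ "carrier \<Sigma>"])
qed (simp_all add: D_simps(3,4) DD C.R.l_distr C.R.r_distr C.R.m_assoc cong: restrict_cong)

sublocale D: left_module A D by (rule left_module_D)
sublocale CD: tensor_pair A C D by unfold_locales

lemma basisD:
  "i < n \<Longrightarrow> e i \<in> carrier \<Sigma>" "i < n \<Longrightarrow> \<phi> i \<in> carrier D"
  "u \<in> carrier \<Sigma> \<Longrightarrow> u = (\<Oplus>\<^bsub>\<Sigma>\<^esub>i\<in>{..<n}. e i \<triangleleft>\<^bsub>\<Sigma>\<^esub> \<phi> i u)"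
  using basis by (simp_all add: is_dual_basis_def)

text \<open>\<open>ev u\<close> maps \<open>c \<otimes> f\<close> to \<open>c f(u)\<close>, and \<open>pair f\<close> maps \<open>v \<otimes> c\<close> to \<open>f(v) c\<close>.\<close>

abbreviation ev where "ev u \<equiv> tensor_lift C (\<lambda>c f. c \<triangleleft>\<^bsub>C\<^esub> f u)"
abbreviation pair where "pair f \<equiv> tensor_lift C (\<lambda>v c. f v \<triangleright>\<^bsub>C\<^esub> c)"

lemma balanced_ev: "u \<in> carrier \<Sigma> \<Longrightarrow> balanced A C D C (\<lambda>c f. c \<triangleleft>\<^bsub>C\<^esub> f u)"
  by (rule balancedI) (simp_all add: D_simps(3,4) DD C.rsm_closed C.rsm_l_distr C.rsm_r_distr C.rsm_assoc)

lemma balanced_pair: "f \<in> carrier D \<Longrightarrow> balanced A \<Sigma> C C (\<lambda>v c. f v \<triangleright>\<^bsub>C\<^esub> c)"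
  by (rule balancedI) (simp_all add: DD C.lsm_closed C.lsm_l_distr C.lsm_r_distr C.lsm_assoc)

lemmas ev_additive = CD.tensor_lift_additive[OF CG balanced_ev]
lemmas ev_pure = CD.tensor_lift_pure[OF CG balanced_ev]
lemmas pair_additive = UC.tensor_lift_additive[OF CG balanced_pair]
lemmas pair_pure = UC.tensor_lift_pure[OF CG balanced_pair]

lemma pair_rsm:
  assumes f: "f \<in> carrier D" and z: "z \<in> carrier \<Sigma>C" and a: "a \<in> carrier A"
  shows "pair f (z \<triangleleft>\<^bsub>\<Sigma>C\<^esub> a) = pair f z \<triangleleft>\<^bsub>C\<^esub> a"
  using z a
  by (induction rule: UC.tensor_induct)
   (simp_all add: \<Sigma>C_rsm pair_pure f C.rsm_closed
    additive_maps_add[OF pair_additive[OF f]] additive_maps_closed[OF pair_additive[OF f]]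
    C.rsm_l_distr C.lsm_rsm DD[OF f])

lemma pair_coact_closed: "\<lbrakk>f \<in> carrier D; u \<in> carrier \<Sigma>\<rbrakk> \<Longrightarrow> pair f (\<rho> u) \<in> carrier C"
  by (simp add: additive_maps_closed[OF pair_additive] coact_simps)

lemma dual_coaction_eq:
  "dual_coaction A C \<Sigma> \<rho> f
    = (\<Oplus>\<^bsub>tensor A C D\<^esub>i\<in>{..<n}. pure_tensor A C D (pair f (\<rho> (e i))) (\<phi> i))"
  by (simp add: dual_coaction_def choice)

lemma dual_coaction_closed:
  assumes f: "f \<in> carrier D"
  shows "dual_coaction A C \<Sigma> \<rho> f \<in> carrier (tensor A C D)"
proof -
  interpret P: abelian_group "tensor A C D" by (rule CD.abelian_group_tensor)
  show ?thesis unfolding dual_coaction_eq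
    by (rule P.finsum_closed) (auto intro!: CD.pure_tensor_closed pair_coact_closed f basisD)
qed

text \<open>The coaction of \<open>\<Sigma>\<^sup>*\<close> is determined by \<open>f\<^sub>-\<^sub>1 f\<^sub>0(u) = f(u\<^sub>0) u\<^sub>1\<close>.\<close>

lemma ev_dual_coaction:
  assumes f: "f \<in> carrier D" and u: "u \<in> carrier \<Sigma>"
  shows "ev u (dual_coaction A C \<Sigma> \<rho> f) = pair f (\<rho> u)"
proof -
  have pc: "(\<lambda>v. pair f (\<rho> v)) \<in> additive_maps \<Sigma> C"
    by (rule additive_maps_comp[OF right_linear_additive[OF coact_right] pair_additive[OF f]])
  have "ev u (dual_coaction A C \<Sigma> \<rho> f)
    = (\<Oplus>\<^bsub>C\<^esub>i\<in>{..<n}. ev u (pure_tensor A C D (pair f (\<rho> (e i))) (\<phi> i)))"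
    unfolding dual_coaction_eq
    by (rule additive_maps_finsum[OF CD.abelian_group_tensor CG ev_additive[OF u]])
      (auto intro!: CD.pure_tensor_closed pair_coact_closed f basisD)
  also have "\<dots> = (\<Oplus>\<^bsub>C\<^esub>i\<in>{..<n}. pair f (\<rho> (e i \<triangleleft>\<^bsub>\<Sigma>\<^esub> \<phi> i u)))"
    by (rule C.M.finsum_cong')
      (auto simp: ev_pure u pair_coact_closed f basisD(1,2) coact_simps DD U.rsm_closed C.rsm_closed pair_rsm)
  also have "\<dots> = pair f (\<rho> (\<Oplus>\<^bsub>\<Sigma>\<^esub>i\<in>{..<n}. e i \<triangleleft>\<^bsub>\<Sigma>\<^esub> \<phi> i u))"
    by (rule additive_maps_finsum[OF UG CG pc, symmetric])
      (auto simp: basisD(1,2) DD u U.rsm_closed)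
  finally show ?thesis using basisD(3)[OF u] by simp
qed

text \<open>Since \<open>\<Sigma>\<close> is finitely generated projective, \<open>C \<otimes>\<^sub>A \<Sigma>\<^sup>*\<close> embeds into \<open>Hom\<^sub>A(\<Sigma>, C)\<close>.\<close>

lemma ev_reconstruct:
  assumes z: "z \<in> carrier (tensor A C D)"
  shows "z = (\<Oplus>\<^bsub>tensor A C D\<^esub>i\<in>{..<n}. pure_tensor A C D (ev (e i) z) (\<phi> i))"
proof -
  let ?T = "tensor A C D"
  interpret P: abelian_group ?T by (rule CD.abelian_group_tensor)
  have evc: "ev (e i) z \<in> carrier C" if "i < n" "z \<in> carrier ?T" for i z
    using additive_maps_closed[OF ev_additive[OF basisD(1)[OF that(1)]] that(2)] .
  show ?thesis using z
  proof (induction rule: CD.tensor_induct)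
    case (pure c f)
    have c: "f (e i) \<triangleright>\<^bsub>D\<^esub> \<phi> i \<in> carrier D" if "i < n" for i
      using that by (simp add: D.lsm_closed DD pure basisD)
    have sc: "(\<Oplus>\<^bsub>D\<^esub>i\<in>{..<n}. f (e i) \<triangleright>\<^bsub>D\<^esub> \<phi> i) \<in> carrier D"
      by (rule D.M.finsum_closed) (use c in auto)
    have "f = (\<Oplus>\<^bsub>D\<^esub>i\<in>{..<n}. f (e i) \<triangleright>\<^bsub>D\<^esub> \<phi> i)"
    proof (rule extensionalityI[OF DD(4)[OF pure(2)] DD(4)[OF sc]])
      fix u assume u: "u \<in> carrier \<Sigma>"
      have "(\<Oplus>\<^bsub>D\<^esub>i\<in>{..<n}. f (e i) \<triangleright>\<^bsub>D\<^esub> \<phi> i) u = (\<Oplus>\<^bsub>A\<^esub>i\<in>{..<n}. (f (e i) \<triangleright>\<^bsub>D\<^esub> \<phi> i) u)"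
        by (rule finsum_pointwise[OF abelian_group_D C.R.abelian_group_axioms _ _ u])
          (use c u in \<open>auto simp: DD D_simps(3)\<close>)
      also have "\<dots> = (\<Oplus>\<^bsub>A\<^esub>i\<in>{..<n}. f (e i \<triangleleft>\<^bsub>\<Sigma>\<^esub> \<phi> i u))"
        by (rule C.R.finsum_cong') (auto simp: D_simps(4) u DD pure basisD(1,2) U.rsm_closed)
      also have "\<dots> = f (\<Oplus>\<^bsub>\<Sigma>\<^esub>i\<in>{..<n}. e i \<triangleleft>\<^bsub>\<Sigma>\<^esub> \<phi> i u)"
        by (rule additive_maps_finsum[OF UG C.R.abelian_group_axioms, symmetric])
          (auto intro!: additive_mapsI simp: DD pure basisD(1,2) U.rsm_closed u)
      finally show "f u = (\<Oplus>\<^bsub>D\<^esub>i\<in>{..<n}. f (e i) \<triangleright>\<^bsub>D\<^esub> \<phi> i) u" using basisD(3)[OF u] by simp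
    qed
    then have "pure_tensor A C D c f = pure_tensor A C D c (\<Oplus>\<^bsub>D\<^esub>i\<in>{..<n}. f (e i) \<triangleright>\<^bsub>D\<^esub> \<phi> i)" by simp
    also have "\<dots> = (\<Oplus>\<^bsub>?T\<^esub>i\<in>{..<n}. pure_tensor A C D c (f (e i) \<triangleright>\<^bsub>D\<^esub> \<phi> i))"
      by (rule additive_maps_finsum[OF abelian_group_D CD.abelian_group_tensor
            balanced_additive_right[OF CD.balanced_pure_tensor pure(1)]]) (use c in auto)
    also have "\<dots> = (\<Oplus>\<^bsub>?T\<^esub>i\<in>{..<n}. pure_tensor A C D (ev (e i) (pure_tensor A C D c f)) (\<phi> i))"
      by (rule P.finsum_cong')
        (auto simp: ev_pure pure basisD(1,2) DD C.rsm_closed CD.pure_tensor_closed CD.pure_tensor_middle D.lsm_closed)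
    finally show ?case .
  next
    case (add z z')
    have "(\<Oplus>\<^bsub>?T\<^esub>i\<in>{..<n}. pure_tensor A C D (ev (e i) (z \<oplus>\<^bsub>?T\<^esub> z')) (\<phi> i))
      = (\<Oplus>\<^bsub>?T\<^esub>i\<in>{..<n}. pure_tensor A C D (ev (e i) z) (\<phi> i)
          \<oplus>\<^bsub>?T\<^esub> pure_tensor A C D (ev (e i) z') (\<phi> i))"
      by (rule P.finsum_cong')
        (auto simp: additive_maps_add[OF ev_additive] evc basisD(1,2) add(1,2) CD.pure_tensor_add_left CD.pure_tensor_closed)
    also have "\<dots> = z \<oplus>\<^bsub>?T\<^esub> z'"
      using add(1,2)
      by (subst P.finsum_addf) (auto simp: evc basisD(2) CD.pure_tensor_closed simp flip: add(3,4))
    finally show ?case by simp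
  qed
qed

lemma ev_inject:
  assumes "z \<in> carrier (tensor A C D)" "z' \<in> carrier (tensor A C D)"
    and "\<And>u. u \<in> carrier \<Sigma> \<Longrightarrow> ev u z = ev u z'"
  shows "z = z'"
proof -
  interpret P: abelian_group "tensor A C D" by (rule CD.abelian_group_tensor)
  have evc: "ev (e i) z' \<in> carrier C" if "i < n" for i
    using additive_maps_closed[OF ev_additive[OF basisD(1)[OF that]] assms(2)] .
  have "(\<Oplus>\<^bsub>tensor A C D\<^esub>i\<in>{..<n}. pure_tensor A C D (ev (e i) z) (\<phi> i))
    = (\<Oplus>\<^bsub>tensor A C D\<^esub>i\<in>{..<n}. pure_tensor A C D (ev (e i) z') (\<phi> i))"
    by (rule P.finsum_cong') (auto simp: assms(3) basisD(1,2) evc CD.pure_tensor_closed)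
  then show ?thesis using ev_reconstruct[OF assms(1)] ev_reconstruct[OF assms(2)] by simp
qed

text \<open>The left colinear maps \<open>C \<rightarrow> \<Sigma>\<^sup>*\<close>.\<close>

abbreviation Q where "Q \<equiv> left_colinear_maps A C C \<Delta> D (dual_coaction A C \<Sigma> \<rho>)"

lemma qD:
  assumes "q \<in> left_linear A C D"
  shows "c \<in> carrier C \<Longrightarrow> q c \<in> carrier D"
    and "\<lbrakk>c \<in> carrier C; u \<in> carrier \<Sigma>\<rbrakk> \<Longrightarrow> q c u \<in> carrier A"
    and "\<lbrakk>c \<in> carrier C; d \<in> carrier C; u \<in> carrier \<Sigma>\<rbrakk> \<Longrightarrow> q (c \<oplus>\<^bsub>C\<^esub> d) u = q c u \<oplus>\<^bsub>A\<^esub> q d u"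
    and "\<lbrakk>a \<in> carrier A; c \<in> carrier C; u \<in> carrier \<Sigma>\<rbrakk> \<Longrightarrow> q (a \<triangleright>\<^bsub>C\<^esub> c) u = a \<otimes>\<^bsub>A\<^esub> q c u"
    and "\<lbrakk>c \<in> carrier C; u \<in> carrier \<Sigma>; v \<in> carrier \<Sigma>\<rbrakk> \<Longrightarrow> q c (u \<oplus>\<^bsub>\<Sigma>\<^esub> v) = q c u \<oplus>\<^bsub>A\<^esub> q c v"
    and "\<lbrakk>c \<in> carrier C; a \<in> carrier A; u \<in> carrier \<Sigma>\<rbrakk> \<Longrightarrow> q c (u \<triangleleft>\<^bsub>\<Sigma>\<^esub> a) = q c u \<otimes>\<^bsub>A\<^esub> a"
  using left_linearD[OF assms] by (simp_all add: DD D_simps(3,4))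

lemma q_dual: "\<lbrakk>q \<in> left_linear A C D; u \<in> carrier \<Sigma>\<rbrakk> \<Longrightarrow> (\<lambda>c. q c u) \<in> dual"
  by (rule left_linearI) (simp_all add: qD)

text \<open>The elements of \<open>Q\<close> are the left \<open>A\<close>-linear maps \<open>q\<close> with \<open>q(c)(u\<^sub>0) u\<^sub>1 = c\<^sub>1 q(c\<^sub>2)(u)\<close>.\<close>

lemma Q_iff:
  "q \<in> Q \<longleftrightarrow> q \<in> left_linear A C D \<inter> extensional (carrier C) \<and>
     (\<forall>c\<in>carrier C. \<forall>u\<in>carrier \<Sigma>. pair (q c) (\<rho> u) = hit (\<lambda>d. q d u) c)"
proof -
  have "dual_coaction A C \<Sigma> \<rho> (q c) = tensor_map A C D (\<lambda>c. c) q (\<Delta> c)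
      \<longleftrightarrow> (\<forall>u\<in>carrier \<Sigma>. pair (q c) (\<rho> u) = hit (\<lambda>d. q d u) c)"
    if q: "q \<in> left_linear A C D" and c: "c \<in> carrier C" for c
  proof -
    have dc: "\<Delta> c \<in> carrier (tensor A C C)" using c by (simp add: comult_simps)
    have b: "balanced A C C (tensor A C D) (\<lambda>x y. pure_tensor A C D x (q y))"
      by (rule balancedI) (simp_all add: left_linearD[OF q] balancedD[OF CD.balanced_pure_tensor])
    have t: "tensor_map A C D (\<lambda>c. c) q (\<Delta> c) \<in> carrier (tensor A C D)"
      unfolding tensor_map_eq_lift[OF CD.tensor_pair_axioms CC.tensor_pair_axioms b dc]
      by (rule CC.tensor_lift_closed[OF CD.abelian_group_tensor b dc])
    have evt: "ev u (tensor_map A C D (\<lambda>c. c) q (\<Delta> c)) = hit (\<lambda>d. q d u) c" if u: "u \<in> carrier \<Sigma>" for u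
      unfolding coring_hit_def
      by (rule tensor_lift_tensor_map[OF CD.tensor_pair_axioms CC.tensor_pair_axioms CG b
            balanced_ev[OF u] _ _ dc]) (simp_all add: qD[OF q])
    show ?thesis
      using ev_inject[OF dual_coaction_closed[OF qD(1)[OF q c]] t]
        ev_dual_coaction[OF qD(1)[OF q c]] evt by auto
  qed
  then show ?thesis by (auto simp: left_colinear_maps_def)
qed

text \<open>\<open>Q\<close> as a bimodule.\<close>

abbreviation Qb where "Qb \<equiv> Q_bimod A C \<Delta> \<Sigma> \<rho>"

lemma Qb_simps:
  "carrier Qb = Q" "\<zero>\<^bsub>Qb\<^esub> = (\<lambda>c\<in>carrier C. \<zero>\<^bsub>D\<^esub>)" "q \<oplus>\<^bsub>Qb\<^esub> q' = (\<lambda>c\<in>carrier C. q c \<oplus>\<^bsub>D\<^esub> q' c)"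
  "f \<triangleright>\<^bsub>Qb\<^esub> q = (\<lambda>c\<in>carrier C. q (hit f c))"
  "q \<triangleleft>\<^bsub>Qb\<^esub> t = (\<lambda>c\<in>carrier C. compose (carrier \<Sigma>) (q c) t)"
  by (simp_all add: Q_bimod_def)

lemma QD:
  assumes "q \<in> Q"
  shows "q \<in> left_linear A C D" "q \<in> extensional (carrier C)"
    "\<lbrakk>c \<in> carrier C; u \<in> carrier \<Sigma>\<rbrakk> \<Longrightarrow> pair (q c) (\<rho> u) = hit (\<lambda>d. q d u) c"
  using assms by (simp_all add: Q_iff)

lemma hit_cong:
  assumes "f \<in> dual" "c \<in> carrier C" "\<And>c. c \<in> carrier C \<Longrightarrow> f c = g c"
  shows "hit f c = hit g c"
  unfolding coring_hit_def by (rule comodule_data.act_cong[OF self_comodule assms])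

text \<open>Both sides of the condition on elements of \<open>Q\<close> are additive in \<open>q\<close>.\<close>

lemma pair_additive_left:
  assumes z: "z \<in> carrier \<Sigma>C"
  shows "(\<lambda>f. pair f z) \<in> additive_maps D C"
proof (rule additive_mapsI)
  fix f assume f: "f \<in> carrier D"
  show "pair f z \<in> carrier C" by (rule additive_maps_closed[OF pair_additive[OF f] z])
  fix g assume g: "g \<in> carrier D"
  note b = balanced_pair[OF f] balanced_pair[OF g]
  show "pair (f \<oplus>\<^bsub>D\<^esub> g) z = pair f z \<oplus>\<^bsub>C\<^esub> pair g z"
    unfolding UC.tensor_lift_plus[OF CG b z, symmetric]
    by (rule UC.tensor_lift_cong[OF CG balanced_pair[OF D.M.a_closed[OF f g]] _ z])
      (simp add: D_simps(3) C.lsm_l_distr DD[OF f] DD[OF g])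
qed

lemma hit_additive_left: "c \<in> carrier C \<Longrightarrow> (\<lambda>f. hit f c) \<in> additive_maps S C"
  by (rule additive_mapsI) (simp_all add: S_simps(1) hit_closed hit_plus)

text \<open>The functional \<open>c \<mapsto> q(c)(u)\<close>.\<close>

abbreviation slice where "slice q u \<equiv> (\<lambda>c\<in>carrier C. q c u)"

lemma slice_S: "\<lbrakk>q \<in> left_linear A C D; u \<in> carrier \<Sigma>\<rbrakk> \<Longrightarrow> slice q u \<in> carrier S"
  unfolding S_simps by (intro IntI left_linearI) (simp_all add: qD C.lsm_closed)

lemma Q_iff_slice:
  "q \<in> Q \<longleftrightarrow> q \<in> left_linear A C D \<inter> extensional (carrier C) \<and>
     (\<forall>c\<in>carrier C. \<forall>u\<in>carrier \<Sigma>. pair (q c) (\<rho> u) = hit (slice q u) c)"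
  using hit_cong[OF q_dual, of q _ _ "slice q _"] by (auto simp: Q_iff)

lemma S_minus:
  assumes f: "f \<in> carrier S" and c: "c \<in> carrier C"
  shows "(\<ominus>\<^bsub>S\<^esub> f) c = \<ominus>\<^bsub>A\<^esub> f c"
proof -
  have h: "(\<lambda>f. f c) \<in> additive_maps S A"
    by (rule additive_mapsI) (use c in \<open>auto simp: S_simps dualD\<close>)
  show ?thesis
    by (rule additive_maps_minus[OF ring.is_abelian_group[OF ring_S] C.R.abelian_group_axioms h f])
qed

lemma D_minus: "\<lbrakk>f \<in> carrier D; u \<in> carrier \<Sigma>\<rbrakk> \<Longrightarrow> (\<ominus>\<^bsub>D\<^esub> f) u = \<ominus>\<^bsub>A\<^esub> f u"
  by (rule additive_maps_minus[OF abelian_group_D C.R.abelian_group_axioms, where h = "\<lambda>f. f u"])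
    (auto intro!: additive_mapsI simp: DD D_simps(3))

lemma abelian_group_Qb: "abelian_group Qb"
proof (rule abelian_group_pointwise[OF abelian_group_D, where X = "carrier C"])
  note p = left_linear_pointwise[OF C.left_module_axioms left_module_D]
  interpret S: ring S by (rule ring_S)
  note CG = CG and SG = S.abelian_group_axioms
  have ru: "\<rho> u \<in> carrier \<Sigma>C" if "u \<in> carrier \<Sigma>" for u
    using that by (simp add: coact_simps)
  have "hit (slice (\<lambda>c\<in>carrier C. \<zero>\<^bsub>D\<^esub>) u) c = \<zero>\<^bsub>C\<^esub>" if "u \<in> carrier \<Sigma>" "c \<in> carrier C" for u c
  proof -
    have "slice (\<lambda>c\<in>carrier C. \<zero>\<^bsub>D\<^esub>) u = \<zero>\<^bsub>S\<^esub>"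
      using that by (auto simp: S_simps D_simps(2) intro!: restrict_ext)
    then show ?thesis using additive_maps_zero[OF SG CG hit_additive_left[OF that(2)]] by simp
  qed
  then show "\<zero>\<^bsub>Qb\<^esub> \<in> carrier Qb"
    using p(1) additive_maps_zero[OF abelian_group_D CG pair_additive_left[OF ru]]
    by (simp add: Qb_simps(1,2) Q_iff_slice)
  fix q assume "q \<in> carrier Qb"
  then have q: "q \<in> Q" by (simp add: Qb_simps)
  note ql = QD(1)[OF q]
  have qs: "pair (q c) (\<rho> u) = hit (slice q u) c" if "u \<in> carrier \<Sigma>" "c \<in> carrier C" for u c
    using q that by (simp add: Q_iff_slice)
  show "(\<lambda>c\<in>carrier C. \<ominus>\<^bsub>D\<^esub> q c) \<in> carrier Qb"
  proof -
    have "pair (\<ominus>\<^bsub>D\<^esub> q c) (\<rho> u) = hit (slice (\<lambda>c\<in>carrier C. \<ominus>\<^bsub>D\<^esub> q c) u) c"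
      if "u \<in> carrier \<Sigma>" "c \<in> carrier C" for u c
    proof -
      have "slice (\<lambda>c\<in>carrier C. \<ominus>\<^bsub>D\<^esub> q c) u = \<ominus>\<^bsub>S\<^esub> slice q u"
      proof (rule extensionalityI[of _ "carrier C"])
        show "\<ominus>\<^bsub>S\<^esub> slice q u \<in> extensional (carrier C)"
          using S.a_inv_closed[OF slice_S[OF ql that(1)]] by (simp add: S_simps(1))
      qed (use that in \<open>simp_all add: S_minus[OF slice_S[OF ql that(1)]] D_minus qD[OF ql]\<close>)
      then show ?thesis
        using that additive_maps_minus[OF SG CG hit_additive_left slice_S[OF ql], of c u]
          additive_maps_minus[OF abelian_group_D CG pair_additive_left[OF ru] qD(1)[OF ql], of u c]
        by (simp add: qs)
    qed
    then show ?thesis using p(3)[OF ql] by (simp add: Qb_simps(1) Q_iff_slice)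
  qed
  fix q' assume "q' \<in> carrier Qb"
  then have q': "q' \<in> Q" by (simp add: Qb_simps)
  note ql' = QD(1)[OF q']
  have qs': "pair (q' c) (\<rho> u) = hit (slice q' u) c" if "u \<in> carrier \<Sigma>" "c \<in> carrier C" for u c
    using q' that by (simp add: Q_iff_slice)
  show "q \<oplus>\<^bsub>Qb\<^esub> q' \<in> carrier Qb"
  proof -
    have "pair (q c \<oplus>\<^bsub>D\<^esub> q' c) (\<rho> u) = hit (slice (\<lambda>c\<in>carrier C. q c \<oplus>\<^bsub>D\<^esub> q' c) u) c"
      if "u \<in> carrier \<Sigma>" "c \<in> carrier C" for u c
    proof -
      have "slice (\<lambda>c\<in>carrier C. q c \<oplus>\<^bsub>D\<^esub> q' c) u = slice q u \<oplus>\<^bsub>S\<^esub> slice q' u"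
        using that by (auto simp: D_simps(3) S_simps intro!: restrict_ext)
      then show ?thesis
        using that additive_maps_add[OF hit_additive_left slice_S[OF ql] slice_S[OF ql'], of c u u]
          additive_maps_add[OF pair_additive_left[OF ru] qD(1)[OF ql] qD(1)[OF ql'], of u c c]
        by (simp add: qs qs')
    qed
    then show ?thesis using p(2)[OF ql ql'] by (simp add: Qb_simps(1,3) Q_iff_slice)
  qed
next
  show "q c \<in> carrier D" if "q \<in> carrier Qb" "c \<in> carrier C" for q c
    using that QD(1)[of q] qD(1) by (simp add: Qb_simps)
  show "carrier Qb \<subseteq> extensional (carrier C)" using QD(2) by (auto simp: Qb_simps)
qed (simp_all add: Qb_simps)

text \<open>\<open>(f \<cdot> q)(c) = q(hit f c)\<close>, so the condition at \<open>c\<close> is the one for \<open>q\<close> at \<open>hit f c\<close>.\<close>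

lemma Q_lsm:
  assumes f: "f \<in> dual" and q: "q \<in> Q"
  shows "f \<triangleright>\<^bsub>Qb\<^esub> q \<in> Q"
  unfolding Q_iff
proof (intro conjI IntI ballI)
  note ql = QD(1)[OF q]
  show "f \<triangleright>\<^bsub>Qb\<^esub> q \<in> left_linear A C D"
    unfolding Qb_simps
    by (rule left_linearI) (simp_all add: left_linearD[OF ql] hit_closed f hit_add hit_lsm C.lsm_closed)
  show "f \<triangleright>\<^bsub>Qb\<^esub> q \<in> extensional (carrier C)" by (simp add: Qb_simps)
  fix c u assume c: "c \<in> carrier C" and u: "u \<in> carrier \<Sigma>"
  have "pair ((f \<triangleright>\<^bsub>Qb\<^esub> q) c) (\<rho> u) = hit (\<lambda>d. q d u) (hit f c)"
    using c u f QD(3)[OF q] by (simp add: Qb_simps hit_closed)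
  also have "\<dots> = hit (f \<otimes>\<^bsub>S\<^esub> (\<lambda>d. q d u)) c"
    by (rule hit_hit[OF f q_dual[OF ql u] c])
  also have "\<dots> = hit (\<lambda>d. (f \<triangleright>\<^bsub>Qb\<^esub> q) d u) c"
    by (rule hit_cong[OF mult_dual[OF f q_dual[OF ql u]] c]) (simp add: S_simps Qb_simps)
  finally show "pair ((f \<triangleright>\<^bsub>Qb\<^esub> q) c) (\<rho> u) = hit (\<lambda>d. (f \<triangleright>\<^bsub>Qb\<^esub> q) d u) c" .
qed

text \<open>Colinearity of \<open>t\<close> turns the condition for \<open>q \<cdot> t\<close> at \<open>u\<close> into the one for \<open>q\<close> at \<open>t u\<close>.\<close>

lemma Q_rsm:
  assumes t: "t \<in> T" and q: "q \<in> Q"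
  shows "q \<triangleleft>\<^bsub>Qb\<^esub> t \<in> Q"
  unfolding Q_iff
proof (intro conjI IntI ballI)
  note ql = QD(1)[OF q]
  have tl: "t \<in> right_linear A \<Sigma> \<Sigma>" using t by (simp add: T_iff)
  note ts = right_linearD[OF tl]
  show "q \<triangleleft>\<^bsub>Qb\<^esub> t \<in> left_linear A C D"
    unfolding Qb_simps
  proof (rule left_linearI)
    show "(\<lambda>c\<in>carrier C. compose (carrier \<Sigma>) (q c) t) c \<in> carrier D" if "c \<in> carrier C" for c
      unfolding D_simps
      by (intro IntI right_linearI) (use that in \<open>simp_all add: compose_def qD[OF ql] ts U.rsm_closed\<close>)
  qed (simp_all add: D_simps(3,4) compose_def qD[OF ql] ts C.lsm_closed cong: restrict_cong)
  show "q \<triangleleft>\<^bsub>Qb\<^esub> t \<in> extensional (carrier C)" by (simp add: Qb_simps)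
  fix c u assume c: "c \<in> carrier C" and u: "u \<in> carrier \<Sigma>"
  note ru = coact_simps(1)[OF u]
  note b = balanced_pair[OF qD(1)[OF ql c]]
  have "pair ((q \<triangleleft>\<^bsub>Qb\<^esub> t) c) (\<rho> u) = tensor_lift C (\<lambda>v d. q c (t v) \<triangleright>\<^bsub>C\<^esub> d) (\<rho> u)"
    by (rule sym, rule UC.tensor_lift_cong[OF CG balanced_map_left[OF tl b] _ ru])
      (simp add: Qb_simps compose_def c)
  also have "\<dots> = pair (q c) (\<rho> (t u))"
    by (rule lift_coact_colinear[OF t u CG b, symmetric])
  also have "\<dots> = hit (\<lambda>d. q d (t u)) c"
    by (rule QD(3)[OF q c ts(2)[OF u]])
  also have "\<dots> = hit (\<lambda>d. (q \<triangleleft>\<^bsub>Qb\<^esub> t) d u) c"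
    by (rule hit_cong[OF q_dual[OF ql ts(2)[OF u]] c]) (simp add: Qb_simps compose_def u)
  finally show "pair ((q \<triangleleft>\<^bsub>Qb\<^esub> t) c) (\<rho> u) = hit (\<lambda>d. (q \<triangleleft>\<^bsub>Qb\<^esub> t) d u) c" .
qed

section \<open>The comparison map\<close>

text \<open>\<open>g(u\<^sub>0 f(u\<^sub>1)) = f(g(u\<^sub>0) u\<^sub>1)\<close>.\<close>

lemma dual_pair:
  assumes f: "f \<in> dual" and g: "g \<in> carrier D" and u: "u \<in> carrier \<Sigma>"
  shows "g (act f u) = f (pair g (\<rho> u))"
proof -
  note ru = coact_simps(1)[OF u]
  have ga: "g \<in> additive_maps \<Sigma> (regular_bimod A)" and fa: "f \<in> additive_maps C (regular_bimod A)"
    using right_linear_additive[of g A \<Sigma> "regular_bimod A"] left_linear_additive[OF f] g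
    by (simp_all only: D_simps(1) Int_iff)
  note R = reg.M.abelian_group_axioms
  have "g (act f u) = tensor_lift (regular_bimod A) (\<lambda>v c. g (v \<triangleleft>\<^bsub>\<Sigma>\<^esub> f c)) (\<rho> u)"
    by (rule UC.additive_tensor_lift[OF UG R balanced_act[OF f] ga ru])
  also have "\<dots> = tensor_lift (regular_bimod A) (\<lambda>v c. f (g v \<triangleright>\<^bsub>C\<^esub> c)) (\<rho> u)"
    by (rule UC.tensor_lift_cong[OF R balanced_comp[OF balanced_act[OF f] ga] _ ru])
      (simp add: DD[OF g] dualD[OF f])
  also have "\<dots> = f (pair g (\<rho> u))"
    by (rule UC.additive_tensor_lift[OF CG R balanced_pair[OF g] fa ru, symmetric])
  finally show ?thesis .
qed

abbreviation \<alpha> where "\<alpha> \<equiv> alpha_map C \<Sigma>"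

lemma alpha_apply: "u \<in> carrier \<Sigma> \<Longrightarrow> \<alpha> q u = slice q u"
  by (simp add: alpha_map_def)

text \<open>The bimodule of \<open>\<^sup>*C\<close>-linear maps \<open>\<Sigma> \<rightarrow> \<^sup>*C\<close>.\<close>

abbreviation Qt where "Qt \<equiv> hom_bimod S B"

text \<open>\<open>\<^sup>*C\<close>-linearity of \<open>\<alpha> q\<close> results from applying functionals to the defining equation of \<open>Q\<close>.\<close>

lemma alpha_closed:
  assumes q: "q \<in> Q"
  shows "\<alpha> q \<in> carrier Qt"
  unfolding hom_bimod_simps
proof (intro IntI right_linearI)
  note ql = QD(1)[OF q]
  fix u assume "u \<in> carrier B"
  then have u: "u \<in> carrier \<Sigma>" by (simp add: B_simps)
  show "\<alpha> q u \<in> carrier (regular_bimod S)" using slice_S[OF ql u] u by (simp add: alpha_apply)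
  show "\<alpha> q (u \<oplus>\<^bsub>B\<^esub> v) = \<alpha> q u \<oplus>\<^bsub>regular_bimod S\<^esub> \<alpha> q v" if "v \<in> carrier B" for v
    using that u by (simp add: B_simps alpha_apply S_simps qD[OF ql] cong: restrict_cong)
  show "\<alpha> q (u \<triangleleft>\<^bsub>B\<^esub> f) = \<alpha> q u \<triangleleft>\<^bsub>regular_bimod S\<^esub> f" if "f \<in> carrier S" for f
  proof -
    have f: "f \<in> dual" using that by (simp add: S_simps)
    have "q c (act f u) = f (hit (slice q u) c)" if c: "c \<in> carrier C" for c
      using dual_pair[OF f qD(1)[OF ql c] u] q c u by (simp add: Q_iff_slice)
    then show ?thesis
      using u f by (simp add: B_simps alpha_apply act_closed S_simps(2) cong: restrict_cong)
  qed
qed (simp add: alpha_map_def B_simps)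

lemma alpha_additive: "\<alpha> \<in> additive_maps Qb Qt"
proof (rule additive_mapsI)
  fix q assume q: "q \<in> carrier Qb"
  show "\<alpha> q \<in> carrier Qt" using q alpha_closed by (simp add: Qb_simps)
  fix q' assume q': "q' \<in> carrier Qb"
  show "\<alpha> (q \<oplus>\<^bsub>Qb\<^esub> q') = \<alpha> q \<oplus>\<^bsub>Qt\<^esub> \<alpha> q'"
    by (simp add: alpha_map_def Qb_simps(3) hom_bimod_simps(3) B_simps(1) S_simps(5) D_simps(3) cong: restrict_cong)
qed

lemma alpha_inj: "inj_on \<alpha> Q"
proof (rule inj_onI)
  fix q q' assume q: "q \<in> Q" and q': "q' \<in> Q" and eq: "\<alpha> q = \<alpha> q'"
  show "q = q'"
  proof (rule extensionalityI[OF QD(2)[OF q] QD(2)[OF q']])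
    fix c assume c: "c \<in> carrier C"
    show "q c = q' c"
    proof (rule extensionalityI[OF DD(4)[OF qD(1)[OF QD(1)[OF q] c]] DD(4)[OF qD(1)[OF QD(1)[OF q'] c]]])
      fix u assume u: "u \<in> carrier \<Sigma>"
      have "\<alpha> q u c = \<alpha> q' u c" using eq by simp
      then show "q c u = q' c u" using u c by (simp add: alpha_apply)
    qed
  qed
qed

lemma alpha_lsm: "\<lbrakk>f \<in> carrier S; q \<in> Q\<rbrakk> \<Longrightarrow> \<alpha> (f \<triangleright>\<^bsub>Qb\<^esub> q) = f \<triangleright>\<^bsub>Qt\<^esub> \<alpha> q"
  by (simp add: alpha_map_def Qb_simps(4) hom_bimod_simps(4) B_simps(1) S_simps(1,2) hit_closed cong: restrict_cong)

lemma alpha_rsm: "\<lbrakk>q \<in> Q; t \<in> T\<rbrakk> \<Longrightarrow> \<alpha> (q \<triangleleft>\<^bsub>Qb\<^esub> t) = \<alpha> q \<triangleleft>\<^bsub>Qt\<^esub> t"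
  by (simp add: alpha_map_def Qb_simps(5) hom_bimod_simps(5) B_simps(1) compose_def T_iff
      right_linear_closed[of t A \<Sigma> \<Sigma>] cong: restrict_cong)

section \<open>The connecting map with values in the colinear endomorphisms\<close>

text \<open>\<open>\<tau>(u \<otimes> q)(v) = u\<^sub>0 q(u\<^sub>1)(v)\<close> is colinear in \<open>v\<close>: \<open>u\<^sub>0 \<otimes> u\<^sub>1 q(u\<^sub>2)(v)\<close> and
  \<open>u\<^sub>0 q(u\<^sub>1)(v\<^sub>0) \<otimes> v\<^sub>1\<close> agree by the defining property of \<open>Q\<close>.\<close>

lemma tau_colinear:
  assumes q: "q \<in> Q" and u: "u \<in> carrier \<Sigma>"
  shows "(\<lambda>v\<in>carrier \<Sigma>. act (\<lambda>c. q c v) u) \<in> T"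
  unfolding T_iff
proof (intro conjI ballI IntI)
  note ql = QD(1)[OF q]
  note ru = coact_simps(1)[OF u]
  have tc: "act (\<lambda>c. q c v) u \<in> carrier \<Sigma>" if "v \<in> carrier \<Sigma>" for v
    using act_closed[OF q_dual[OF ql that] u] .
  let ?t = "\<lambda>v\<in>carrier \<Sigma>. act (\<lambda>c. q c v) u"
  show lin: "?t \<in> right_linear A \<Sigma> \<Sigma>"
  proof (rule right_linearI)
    fix v w assume v: "v \<in> carrier \<Sigma>" and w: "w \<in> carrier \<Sigma>"
    have "act (\<lambda>c. q c (v \<oplus>\<^bsub>\<Sigma>\<^esub> w)) u = act ((\<lambda>c. q c v) \<oplus>\<^bsub>S\<^esub> (\<lambda>c. q c w)) u"
      using v w by (intro act_cong q_dual[OF ql] u) (simp_all add: S_simps qD[OF ql])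
    also have "\<dots> = act (\<lambda>c. q c v) u \<oplus>\<^bsub>\<Sigma>\<^esub> act (\<lambda>c. q c w) u"
      by (rule act_plus[OF q_dual[OF ql v] q_dual[OF ql w] u])
    finally show "?t (v \<oplus>\<^bsub>\<Sigma>\<^esub> w) = ?t v \<oplus>\<^bsub>\<Sigma>\<^esub> ?t w" using v w by simp
  next
    fix a v assume a: "a \<in> carrier A" and v: "v \<in> carrier \<Sigma>"
    have "act (\<lambda>c. q c (v \<triangleleft>\<^bsub>\<Sigma>\<^esub> a)) u = act (\<lambda>c. q c v \<otimes>\<^bsub>A\<^esub> a) u"
      using v a by (intro act_cong q_dual[OF ql] u) (simp_all add: qD[OF ql] U.rsm_closed)
    also have "\<dots> = act (\<lambda>c. q c v) u \<triangleleft>\<^bsub>\<Sigma>\<^esub> a"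
      by (rule act_scale[OF q_dual[OF ql v] a u])
    finally show "?t (v \<triangleleft>\<^bsub>\<Sigma>\<^esub> a) = ?t v \<triangleleft>\<^bsub>\<Sigma>\<^esub> a" using v a by (simp add: U.rsm_closed)
  qed (simp add: tc)
  fix v assume v: "v \<in> carrier \<Sigma>"
  note rv = coact_simps(1)[OF v]
  let ?P = "\<Sigma>C"
  note PA = UC.abelian_group_tensor
  define b where "b = (\<lambda>x c w d. tens x (q c w \<triangleright>\<^bsub>C\<^esub> d))"
  have b: "balanced A \<Sigma> C ?P (b x c)" if "x \<in> carrier \<Sigma>" "c \<in> carrier C" for x c
    unfolding b_def
    by (rule balanced_comp[OF balanced_pair[OF qD(1)[OF ql that(2)]]
          balanced_additive_right[OF UC.balanced_pure_tensor that(1)]])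
  have b_eq: "b x c w d = tens (x \<triangleleft>\<^bsub>\<Sigma>\<^esub> q c w) d"
    if "x \<in> carrier \<Sigma>" "c \<in> carrier C" "w \<in> carrier \<Sigma>" "d \<in> carrier C" for x c w d
    using that by (simp add: b_def UC.pure_tensor_middle qD[OF ql])
  have b': "balanced A \<Sigma> C ?P (\<lambda>x c. b x c w d)" if "w \<in> carrier \<Sigma>" "d \<in> carrier C" for w d
    by (rule balanced_cong[OF balanced_comp[OF balanced_act[OF q_dual[OF ql that(1)]]
          balanced_additive_left[OF UC.balanced_pure_tensor that(2)]]])
      (simp_all add: b_eq that right_module_\<Sigma> C.left_module_axioms)
  note bh = balanced_comp_hit[OF q_dual[OF ql v] UC.balanced_pure_tensor]
  have "\<rho> (?t v) = tensor_lift ?P (\<lambda>x c. tens x (hit (\<lambda>d. q d v) c)) (\<rho> u)"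
    using coact_act[OF q_dual[OF ql v] u] v by simp
  also have "\<dots> = tensor_lift ?P (\<lambda>x c. tensor_lift ?P (b x c) (\<rho> v)) (\<rho> u)"
  proof (rule UC.tensor_lift_cong[OF PA bh _ ru])
    fix x c assume x: "x \<in> carrier \<Sigma>" and c: "c \<in> carrier C"
    show "tens x (hit (\<lambda>d. q d v) c) = tensor_lift ?P (b x c) (\<rho> v)"
      unfolding QD(3)[OF q c v, symmetric] b_def
      by (rule UC.additive_tensor_lift[OF CG PA balanced_pair[OF qD(1)[OF ql c]]
            balanced_additive_right[OF UC.balanced_pure_tensor x] rv])
  qed
  also have "\<dots> = tensor_lift ?P (\<lambda>w d. tensor_lift ?P (\<lambda>x c. b x c w d) (\<rho> u)) (\<rho> v)"
    by (rule tensor_lift_swap[OF UC.tensor_pair_axioms UC.tensor_pair_axioms PA b b' ru rv])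
  also have "\<dots> = tensor_lift ?P (\<lambda>w d. tens (?t w) d) (\<rho> v)"
  proof (rule sym, rule UC.tensor_lift_cong[OF PA balanced_map_left[OF lin UC.balanced_pure_tensor] _ rv])
    fix w d assume w: "w \<in> carrier \<Sigma>" and d: "d \<in> carrier C"
    have "tens (?t w) d
      = tensor_lift ?P (\<lambda>x c. tens (x \<triangleleft>\<^bsub>\<Sigma>\<^esub> q c w) d) (\<rho> u)"
      using w UC.additive_tensor_lift[OF UG PA balanced_act[OF q_dual[OF ql w]]
          balanced_additive_left[OF UC.balanced_pure_tensor d] ru] by simp
    also have "\<dots> = tensor_lift ?P (\<lambda>x c. b x c w d) (\<rho> u)"
      by (rule sym, rule UC.tensor_lift_cong[OF PA b'[OF w d] _ ru]) (simp add: b_eq w d)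
    finally show "tens (?t w) d = tensor_lift ?P (\<lambda>x c. b x c w d) (\<rho> u)" .
  qed
  finally show "\<rho> (?t v) = tensor_lift ?P (\<lambda>w d. tens (?t w) d) (\<rho> v)" .
qed simp

lemma bimod21_dual_module_context:
  "bimod21 (dual_module_context A C \<Delta> \<epsilon> \<Sigma> \<rho>) = Qt"
  by (simp add: dual_module_context_eq module_context_def Let_def)

lemma morita_morphism_alpha:
  "morita_morphism (comodule_context A C \<Delta> \<epsilon> \<Sigma> \<rho>) (dual_module_context A C \<Delta> \<epsilon> \<Sigma> \<rho>)
     (\<lambda>t. t) (\<lambda>f. f) (\<lambda>u. u) \<alpha>"
proof -
  let ?Y = "dual_module_context A C \<Delta> \<epsilon> \<Sigma> \<rho>"
  have Y: "ring2 ?Y = S" "bimod12 ?Y = B" "bimod21 ?Y = Qt"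
    by (simp_all add: dual_module_context_eq module_context_def Let_def)
  note R = ring1_dual_module_context
  note M = morita_context_module[OF right_module_B B_simps(4), folded dual_module_context_eq]
  have "morita_morphism \<lparr>ring1 = T_ring A C \<Sigma> \<rho>, ring2 = ring2 ?Y, bimod12 = bimod12 ?Y, bimod21 = Qb,
      conn1 = tensor_lift (T_ring A C \<Sigma> \<rho>) (\<lambda>u q. \<lambda>v\<in>carrier \<Sigma>. act (\<lambda>c. q c v) u),
      conn2 = tensor_lift (ring2 ?Y) (\<lambda>q u. \<lambda>c\<in>carrier C. q c u)\<rparr> ?Y (\<lambda>t. t) (\<lambda>f. f) (\<lambda>u. u) \<alpha>"
  proof (rule morita_morphism_subcontext[OF M(1) ring_T _ _ _ _ abelian_group_Qb], unfold Y Qb_simps(1))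
    show "carrier (T_ring A C \<Sigma> \<rho>) \<subseteq> carrier (ring1 ?Y)"
      using T_subset_endos by (simp add: R T_ring_def)
    show "add (T_ring A C \<Sigma> \<rho>) = add (ring1 ?Y)" "mult (T_ring A C \<Sigma> \<rho>) = mult (ring1 ?Y)"
      "\<one>\<^bsub>T_ring A C \<Sigma> \<rho>\<^esub> = \<one>\<^bsub>ring1 ?Y\<^esub>"
      unfolding R T_ring_def by (simp_all add: endo_ring_def)
    show "f \<triangleright>\<^bsub>Qb\<^esub> q \<in> Q" if "f \<in> carrier S" "q \<in> Q" for f q
      using that Q_lsm by (simp add: S_simps(1))
    show "q \<triangleleft>\<^bsub>Qb\<^esub> t \<in> Q" if "q \<in> Q" "t \<in> carrier (T_ring A C \<Sigma> \<rho>)" for q t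
      using that Q_rsm by (simp add: T_ring_def)
    show "\<alpha> (q \<triangleleft>\<^bsub>Qb\<^esub> t) = \<alpha> q \<triangleleft>\<^bsub>Qt\<^esub> t" if "q \<in> Q" "t \<in> carrier (T_ring A C \<Sigma> \<rho>)" for q t
      using that alpha_rsm by (simp add: T_ring_def)
    fix u q assume "u \<in> carrier B" and q: "q \<in> Q"
    then have u: "u \<in> carrier \<Sigma>" by (simp add: B_simps)
    note uq = M(2,3)[of u "\<alpha> q", unfolded B_simps(1), OF u alpha_closed[OF q]]
    show "(\<lambda>v\<in>carrier \<Sigma>. act (\<lambda>c. q c v) u) \<in> carrier (T_ring A C \<Sigma> \<rho>)"
      using tau_colinear[OF q u] by (simp add: T_ring_def)
    show "(\<lambda>v\<in>carrier \<Sigma>. act (\<lambda>c. q c v) u) = conn1 ?Y (pure_tensor S B Qt u (\<alpha> q))"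
      unfolding uq(1)
    proof (rule restrict_ext)
      fix v assume v: "v \<in> carrier \<Sigma>"
      show "act (\<lambda>c. q c v) u = u \<triangleleft>\<^bsub>B\<^esub> \<alpha> q v"
        unfolding B_simps(5) alpha_apply[OF v]
        by (rule act_cong[OF q_dual[OF QD(1)[OF q] v] u]) simp
    qed
    show "slice q u = conn2 ?Y (pure_tensor (ring1 ?Y) Qt B (\<alpha> q) u)"
      unfolding uq(2) using u by (simp add: alpha_apply)
  qed (use alpha_additive alpha_inj alpha_lsm in \<open>simp_all add: Qb_simps(1)\<close>)
  then show ?thesis by (simp add: Y comodule_context_def)
qed

end

section \<open>Locally projective corings\<close>

context comodule_data
begin

text \<open>Local projectivity makes \<open>\<^sup>*C\<close> separate the elements of \<open>C\<close>.\<close>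

lemma dual_separates:
  assumes lp: "locally_projective_left A C" and c: "c \<in> carrier C" and d: "d \<in> carrier C"
    and eq: "\<And>f. f \<in> carrier S \<Longrightarrow> f c = f d"
  shows "c = d"
proof -
  obtain m :: nat and f x where fx: "\<And>i. i < m \<Longrightarrow> f i \<in> carrier S \<and> x i \<in> carrier C"
    and s: "\<And>y. y \<in> {c, d} \<Longrightarrow> y = (\<Oplus>\<^bsub>C\<^esub>i\<in>{..<m}. f i y \<triangleright>\<^bsub>C\<^esub> x i)"
  proof -
    have "finite {c, d} \<and> {c, d} \<subseteq> carrier C" using c d by simp
    then show ?thesis
      using lp[unfolded locally_projective_left_def, rule_format, of "{c, d}"] that
      unfolding S_simps(1) by blast
  qed
  have "(\<Oplus>\<^bsub>C\<^esub>i\<in>{..<m}. f i c \<triangleright>\<^bsub>C\<^esub> x i) = (\<Oplus>\<^bsub>C\<^esub>i\<in>{..<m}. f i d \<triangleright>\<^bsub>C\<^esub> x i)"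
  proof (rule C.M.finsum_cong')
    show "(\<lambda>i. f i d \<triangleright>\<^bsub>C\<^esub> x i) \<in> {..<m} \<rightarrow> carrier C"
      using fx d by (auto intro!: C.lsm_closed dualD(1)[of "f _"] simp: S_simps(1))
    show "f i c \<triangleright>\<^bsub>C\<^esub> x i = f i d \<triangleright>\<^bsub>C\<^esub> x i" if "i \<in> {..<m}" for i
      using eq[of "f i"] fx[of i] that by simp
  qed simp
  then show ?thesis using s[of c] s[of d] by simp
qed

text \<open>The map \<open>v \<otimes> c \<mapsto> v f(c)\<close>; for locally projective \<open>C\<close> these maps separate the elements of \<open>\<Sigma> \<otimes>\<^sub>A C\<close>.\<close>

abbreviation contract where "contract f \<equiv> tensor_lift \<Sigma> (\<lambda>v c. v \<triangleleft>\<^bsub>\<Sigma>\<^esub> f c)"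

lemmas contract_additive = UC.tensor_lift_additive[OF UG balanced_act]
lemmas contract_pure = UC.tensor_lift_pure[OF UG balanced_act]

text \<open>\<open>z\<close> can be recovered from its contractions whenever the \<open>f i\<close> and \<open>x i\<close> are a local dual basis for
  the set \<open>X\<close>. Every \<open>z\<close> has a finite such \<open>X\<close>: the right-hand factors of a sum of pure tensors.\<close>

definition recovers :: "'c set \<Rightarrow> (('s \<times> 'c) \<Rightarrow>\<^sub>0 int) set \<Rightarrow> bool" where
  "recovers X z \<longleftrightarrow> (\<forall>(m::nat) f x. (\<forall>i<m. f i \<in> dual \<and> x i \<in> carrier C) \<longrightarrow>
     (\<forall>d\<in>X. d = (\<Oplus>\<^bsub>C\<^esub>i\<in>{..<m}. f i d \<triangleright>\<^bsub>C\<^esub> x i)) \<longrightarrow>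
     z = (\<Oplus>\<^bsub>\<Sigma>C\<^esub>i\<in>{..<m}. tens (contract (f i) z) (x i)))"

lemma recoversD:
  assumes "recovers X z" "\<And>i. i < m \<Longrightarrow> f i \<in> dual" "\<And>i. i < m \<Longrightarrow> x i \<in> carrier C"
    and "\<And>d. d \<in> X \<Longrightarrow> d = (\<Oplus>\<^bsub>C\<^esub>i\<in>{..<m::nat}. f i d \<triangleright>\<^bsub>C\<^esub> x i)"
  shows "z = (\<Oplus>\<^bsub>\<Sigma>C\<^esub>i\<in>{..<m}. tens (contract (f i) z) (x i))"
  using assms(1)[unfolded recovers_def, rule_format, of m f x] assms(2-) by blast

lemma ex_recovers:
  assumes z: "z \<in> carrier \<Sigma>C"
  shows "\<exists>X. finite X \<and> X \<subseteq> carrier C \<and> recovers X z"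
proof -
  show ?thesis using z
  proof (induction rule: UC.tensor_induct)
    case (pure v c)
    have R: "recovers {c} (tens v c)"
      unfolding recovers_def
    proof (intro allI impI)
      fix m :: nat and f x
      assume "\<forall>i<m. f i \<in> dual \<and> x i \<in> carrier C"
      then have fx: "f i \<in> dual" "x i \<in> carrier C" if "i < m" for i using that by auto
      assume "\<forall>d\<in>{c}. d = (\<Oplus>\<^bsub>C\<^esub>i\<in>{..<m}. f i d \<triangleright>\<^bsub>C\<^esub> x i)"
      then have "tens v c = tens v (\<Oplus>\<^bsub>C\<^esub>i\<in>{..<m}. f i c \<triangleright>\<^bsub>C\<^esub> x i)"
        by simp
      also have "\<dots> = (\<Oplus>\<^bsub>\<Sigma>C\<^esub>i\<in>{..<m}. tens v (f i c \<triangleright>\<^bsub>C\<^esub> x i))"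
        by (rule additive_maps_finsum[OF CG UC.abelian_group_tensor
              balanced_additive_right[OF UC.balanced_pure_tensor pure(1)]])
          (simp_all add: C.lsm_closed dualD(1)[OF fx(1)] fx(2) pure)
      also have "\<dots> = (\<Oplus>\<^bsub>\<Sigma>C\<^esub>i\<in>{..<m}.
          tens (contract (f i) (tens v c)) (x i))"
        by (rule UC_C.L.M.finsum_cong')
          (auto simp: contract_pure fx pure UC.pure_tensor_middle dualD(1)[OF fx(1)] UC.pure_tensor_closed
            U.rsm_closed C.lsm_closed)
      finally show "tens v c = (\<Oplus>\<^bsub>\<Sigma>C\<^esub>i\<in>{..<m}.
          tens (contract (f i) (tens v c)) (x i))" .
    qed
    show ?case using R pure(2) by (intro exI[of _ "{c}"]) simp
  next
    case (add z z')
    obtain X X' where X: "finite X" "X \<subseteq> carrier C" "recovers X z" and X': "finite X'" "X' \<subseteq> carrier C" "recovers X' z'"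
      using add(3,4) by blast
    have R: "recovers (X \<union> X') (z \<oplus>\<^bsub>\<Sigma>C\<^esub> z')"
      unfolding recovers_def
    proof (intro allI impI)
      fix m :: nat and f x
      assume fx': "\<forall>i<m. f i \<in> dual \<and> x i \<in> carrier C"
      then have fx: "f i \<in> dual" "x i \<in> carrier C" if "i < m" for i using that by auto
      assume s: "\<forall>d\<in>X \<union> X'. d = (\<Oplus>\<^bsub>C\<^esub>i\<in>{..<m}. f i d \<triangleright>\<^bsub>C\<^esub> x i)"
      let ?F = "\<lambda>z i. tens (contract (f i) z) (x i)"
      have c: "?F z i \<in> carrier \<Sigma>C" if "i < m" "z \<in> carrier \<Sigma>C" for i z
        using that by (simp add: UC.pure_tensor_closed additive_maps_closed[OF contract_additive] fx)
      have "z = (\<Oplus>\<^bsub>\<Sigma>C\<^esub>i\<in>{..<m}. ?F z i)" "z' = (\<Oplus>\<^bsub>\<Sigma>C\<^esub>i\<in>{..<m}. ?F z' i)"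
        by (rule recoversD[OF X(3)] recoversD[OF X'(3)]; use fx s in blast)+
      then have "z \<oplus>\<^bsub>\<Sigma>C\<^esub> z'
        = (\<Oplus>\<^bsub>\<Sigma>C\<^esub>i\<in>{..<m}. ?F z i) \<oplus>\<^bsub>\<Sigma>C\<^esub> (\<Oplus>\<^bsub>\<Sigma>C\<^esub>i\<in>{..<m}. ?F z' i)"
        by (rule arg_cong2)
      also have "\<dots> = (\<Oplus>\<^bsub>\<Sigma>C\<^esub>i\<in>{..<m}. ?F z i \<oplus>\<^bsub>\<Sigma>C\<^esub> ?F z' i)"
        using c add(1,2) by (intro UC_C.L.M.finsum_addf[symmetric]) auto
      also have "\<dots> = (\<Oplus>\<^bsub>\<Sigma>C\<^esub>i\<in>{..<m}. ?F (z \<oplus>\<^bsub>\<Sigma>C\<^esub> z') i)"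
        using c add(1,2)
        by (intro UC_C.L.M.finsum_cong')
          (auto simp: additive_maps_add[OF contract_additive] additive_maps_closed[OF contract_additive] fx
            UC.pure_tensor_add_left UC.pure_tensor_closed U.M.a_closed)
      finally show "z \<oplus>\<^bsub>\<Sigma>C\<^esub> z' = (\<Oplus>\<^bsub>\<Sigma>C\<^esub>i\<in>{..<m}. ?F (z \<oplus>\<^bsub>\<Sigma>C\<^esub> z') i)" .
    qed
    show ?case using R X(1,2) X'(1,2) by (intro exI[of _ "X \<union> X'"]) simp
  qed
qed

lemma contract_separates:
  assumes lp: "locally_projective_left A C"
    and z: "z \<in> carrier \<Sigma>C" and z': "z' \<in> carrier \<Sigma>C"
    and eq: "\<And>f. f \<in> dual \<Longrightarrow> contract f z = contract f z'"
  shows "z = z'"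
proof -
  obtain X where X: "finite X" "X \<subseteq> carrier C" "recovers X z" using ex_recovers[OF z] by blast
  obtain X' where X': "finite X'" "X' \<subseteq> carrier C" "recovers X' z'" using ex_recovers[OF z'] by blast
  have "finite (X \<union> X') \<and> X \<union> X' \<subseteq> carrier C" using X X' by simp
  then obtain m :: nat and f x where fx: "\<forall>i<m. f i \<in> dual \<inter> extensional (carrier C) \<and> x i \<in> carrier C"
    and s: "\<forall>d\<in>X \<union> X'. d = (\<Oplus>\<^bsub>C\<^esub>i\<in>{..<m}. f i d \<triangleright>\<^bsub>C\<^esub> x i)"
    using lp[unfolded locally_projective_left_def, rule_format, of "X \<union> X'"] by blast
  have fx': "f i \<in> dual" "x i \<in> carrier C" if "i < m" for i using fx that by auto
  have "z = (\<Oplus>\<^bsub>\<Sigma>C\<^esub>i\<in>{..<m}. tens (contract (f i) z) (x i))"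
    "z' = (\<Oplus>\<^bsub>\<Sigma>C\<^esub>i\<in>{..<m}. tens (contract (f i) z') (x i))"
    by (rule recoversD[OF X(3)] recoversD[OF X'(3)]; use fx' s in blast)+
  moreover have "(\<Oplus>\<^bsub>\<Sigma>C\<^esub>i\<in>{..<m}. tens (contract (f i) z) (x i))
    = (\<Oplus>\<^bsub>\<Sigma>C\<^esub>i\<in>{..<m}. tens (contract (f i) z') (x i))"
    by (rule UC_C.L.M.finsum_cong')
      (auto simp: eq fx' z' UC.pure_tensor_closed additive_maps_closed[OF contract_additive])
  ultimately show ?thesis by simp
qed

lemma counit_scale_S:
  "a \<in> carrier A \<Longrightarrow> (\<lambda>c\<in>carrier C. \<epsilon> c \<otimes>\<^bsub>A\<^esub> a) \<in> carrier S"
  unfolding S_simps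
  by (intro IntI left_linearI) (simp_all add: counit_simps C.lsm_closed C.R.l_distr C.R.m_assoc)

lemma act_counit_scale_S:
  assumes "a \<in> carrier A" "u \<in> carrier \<Sigma>"
  shows "act (\<lambda>c\<in>carrier C. \<epsilon> c \<otimes>\<^bsub>A\<^esub> a) u = u \<triangleleft>\<^bsub>\<Sigma>\<^esub> a"
  using act_cong[OF scale_dual[OF counit_left assms(1)] assms(2), of "\<lambda>c\<in>carrier C. \<epsilon> c \<otimes>\<^bsub>A\<^esub> a"]
    act_counit_scale[OF assms] by simp

text \<open>If \<open>t\<close> is \<open>\<^sup>*C\<close>-linear, then \<open>\<rho>(t u)\<close> and \<open>t u\<^sub>0 \<otimes> u\<^sub>1\<close> have the same contractions, by \<open>t(u \<cdot> f) = t u \<cdot> f\<close>.\<close>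

lemma endos_eq_T:
  assumes lp: "locally_projective_left A C"
  shows "right_linear S B B \<inter> extensional (carrier \<Sigma>) = T"
proof (rule equalityI[OF _ T_subset_endos], rule subsetI)
  fix t assume "t \<in> right_linear S B B \<inter> extensional (carrier \<Sigma>)"
  then have t: "t \<in> right_linear S B B" and te: "t \<in> extensional (carrier \<Sigma>)" by auto
  note ts = right_linearD(2-)[OF t, unfolded B_simps]
  have tl: "t \<in> right_linear A \<Sigma> \<Sigma>"
  proof (intro right_linearI ts(1,2))
    show "t (u \<triangleleft>\<^bsub>\<Sigma>\<^esub> a) = t u \<triangleleft>\<^bsub>\<Sigma>\<^esub> a" if "a \<in> carrier A" "u \<in> carrier \<Sigma>" for a u
      using ts(3)[OF counit_scale_S[OF that(1)] that(2)]
      unfolding act_counit_scale_S[OF that] act_counit_scale_S[OF that(1) ts(1)[OF that(2)]] .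
  qed
  have "\<rho> (t u) = tensor_lift \<Sigma>C (\<lambda>v c. tens (t v) c) (\<rho> u)"
    if u: "u \<in> carrier \<Sigma>" for u
  proof (rule contract_separates[OF lp])
    note ru = coact_simps(1)[OF u]
    note b = balanced_map_left[OF tl UC.balanced_pure_tensor]
    show "\<rho> (t u) \<in> carrier \<Sigma>C" using ts(1)[OF u] by (simp add: coact_simps)
    show "tensor_lift \<Sigma>C (\<lambda>v c. tens (t v) c) (\<rho> u) \<in> carrier \<Sigma>C"
      by (rule UC.tensor_lift_closed[OF UC.abelian_group_tensor b ru])
    fix f assume f: "f \<in> dual"
    define f' where "f' = restrict f (carrier C)"
    have f': "f' \<in> carrier S"
      unfolding S_simps f'_def by (intro IntI left_linearI) (simp_all add: dualD[OF f] C.lsm_closed)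
    note UG = UG
    have "act f (t u) = act f' (t u)"
      by (rule act_cong[OF f ts(1)[OF u]]) (simp add: f'_def)
    also have "\<dots> = t (act f' u)" using ts(3)[OF f' u] by simp
    also have "act f' u = act f u"
      by (rule act_cong[OF f u, symmetric]) (simp add: f'_def)
    also have "t (act f u) = tensor_lift \<Sigma> (\<lambda>v c. t (v \<triangleleft>\<^bsub>\<Sigma>\<^esub> f c)) (\<rho> u)"
      by (rule UC.additive_tensor_lift[OF UG UG balanced_act[OF f] right_linear_additive[OF tl] ru])
    also have "\<dots> = tensor_lift \<Sigma> (\<lambda>v c. contract f (tens (t v) c)) (\<rho> u)"
      by (rule UC.tensor_lift_cong[OF UG balanced_comp[OF balanced_act[OF f] right_linear_additive[OF tl]] _ ru])
        (simp add: contract_pure[OF f] ts(1) right_linear_rsm[OF tl] dualD[OF f])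
    also have "\<dots> = contract f (tensor_lift \<Sigma>C (\<lambda>v c. tens (t v) c) (\<rho> u))"
      by (rule UC.additive_tensor_lift[OF UC.abelian_group_tensor UG b contract_additive[OF f] ru, symmetric])
    finally show "act f (t u) = \<dots>" .
  qed
  then show "t \<in> T" using tl te by (simp add: T_iff)
qed

end

context dual_comodule
begin

text \<open>The preimage of \<open>k\<close> is \<open>q(c)(u) = k(u)(c)\<close>. It is \<open>A\<close>-linear in \<open>u\<close> because \<open>u a = u \<cdot> (\<epsilon> a)\<close>. The condition on
  elements of \<open>Q\<close> is an equation in \<open>C\<close>, which holds after applying any functional \<open>f\<close>, since
  \<open>k(u \<cdot> f) = k(u) # f\<close>.\<close>

lemma alpha_surj:
  assumes lp: "locally_projective_left A C" and k: "k \<in> carrier Qt"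
  shows "k \<in> \<alpha> ` Q"
proof
  have kl: "k \<in> right_linear S B (regular_bimod S)" and ke: "k \<in> extensional (carrier \<Sigma>)"
    using k by (simp_all add: hom_bimod_simps B_simps)
  note ks = right_linearD(2-)[OF kl, unfolded B_simps regular_bimod_simps]
  have kd: "k u \<in> dual" "k u \<in> extensional (carrier C)" if "u \<in> carrier \<Sigma>" for u
    using ks(1)[OF that] by (simp_all add: S_simps)
  define q where "q = (\<lambda>c\<in>carrier C. \<lambda>u\<in>carrier \<Sigma>. k u c)"
  have kr: "k (u \<triangleleft>\<^bsub>\<Sigma>\<^esub> a) c = k u c \<otimes>\<^bsub>A\<^esub> a"
    if "u \<in> carrier \<Sigma>" "a \<in> carrier A" "c \<in> carrier C" for u a c
    using ks(3)[OF counit_scale_S[OF that(2)] that(1)] that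
    unfolding act_counit_scale_S[OF that(2,1)]
    by (simp add: S_simps(2) hit_closed counit_hit kd)
  have qc: "q c \<in> carrier D" if "c \<in> carrier C" for c
    unfolding D_simps(1) q_def
    using that
    by (intro IntI right_linearI) (simp_all add: dualD[OF kd(1)] ks(2) S_simps(5) kr U.rsm_closed)
  have ql: "q \<in> left_linear A C D"
    by (rule left_linearI, rule qc)
      (auto simp: q_def D_simps(3,4) dualD[OF kd(1)] C.lsm_closed intro!: restrict_ext)
  have "pair (q c) (\<rho> u) = hit (\<lambda>d. q d u) c" if c: "c \<in> carrier C" and u: "u \<in> carrier \<Sigma>" for c u
  proof (rule dual_separates[OF lp pair_coact_closed[OF qc[OF c] u] hit_closed[OF q_dual[OF ql u] c]])
    fix f assume f: "f \<in> carrier S"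
    then have fd: "f \<in> dual" by (simp add: S_simps)
    have "f (pair (q c) (\<rho> u)) = q c (act f u)"
      by (rule dual_pair[OF fd qc[OF c] u, symmetric])
    also have "\<dots> = f (hit (k u) c)"
      using ks(3)[OF f u] c u by (simp add: q_def act_closed fd S_simps(2))
    also have "hit (k u) c = hit (\<lambda>d. q d u) c"
      by (rule hit_cong[OF kd(1)[OF u] c]) (simp add: q_def u)
    finally show "f (pair (q c) (\<rho> u)) = f (hit (\<lambda>d. q d u) c)" .
  qed
  then show "q \<in> Q" using ql by (simp add: Q_iff) (simp add: q_def)
  show "k = \<alpha> q"
  proof (rule extensionalityI[OF ke])
    fix u assume u: "u \<in> carrier \<Sigma>"
    show "k u = \<alpha> q u"
      unfolding alpha_apply[OF u]
      by (rule extensionalityI[OF kd(2)[OF u]]) (auto simp: q_def u)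
  qed (simp add: alpha_map_def)
qed

lemma morita_isomorphism_alpha:
  assumes lp: "locally_projective_left A C"
  shows "morita_isomorphism (comodule_context A C \<Delta> \<epsilon> \<Sigma> \<rho>) (dual_module_context A C \<Delta> \<epsilon> \<Sigma> \<rho>)
     (\<lambda>t. t) (\<lambda>f. f) (\<lambda>u. u) \<alpha>"
  unfolding morita_isomorphism_def
proof (intro conjI morita_morphism_alpha)
  show "bij_betw (\<lambda>t. t) (carrier (ring1 (comodule_context A C \<Delta> \<epsilon> \<Sigma> \<rho>)))
      (carrier (ring1 (dual_module_context A C \<Delta> \<epsilon> \<Sigma> \<rho>)))"
    by (simp add: ring1_dual_module_context comodule_context_def T_ring_def endos_eq_T[OF lp] bij_betw_def)
  show "bij_betw \<alpha> (carrier (bimod21 (comodule_context A C \<Delta> \<epsilon> \<Sigma> \<rho>)))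
      (carrier (bimod21 (dual_module_context A C \<Delta> \<epsilon> \<Sigma> \<rho>)))"
    using alpha_inj alpha_surj[OF lp] alpha_closed
    by (auto simp: bimod21_dual_module_context comodule_context_def Qb_simps(1) bij_betw_def)
qed (simp_all add: comodule_context_def dual_module_context_def bij_betw_def)

end

theorem proposition4p7:
  fixes A :: "'a ring" and C :: "('a, 'a, 'c) bimod" and \<Sigma> :: "('l, 'a, 's) bimod"
    and \<Delta> :: "'c \<Rightarrow> (('c \<times> 'c) \<Rightarrow>\<^sub>0 int) set" and \<epsilon> :: "'c \<Rightarrow> 'a"
    and \<rho> :: "'s \<Rightarrow> (('s \<times> 'c) \<Rightarrow>\<^sub>0 int) set"
  assumes "ring A" and "coring A C \<Delta> \<epsilon>" and "right_comodule A C \<Delta> \<epsilon> \<Sigma> \<rho>"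
    and "finitely_generated_right A \<Sigma>" and "projective_right A \<Sigma>"
  shows "morita_morphism (comodule_context A C \<Delta> \<epsilon> \<Sigma> \<rho>) (dual_module_context A C \<Delta> \<epsilon> \<Sigma> \<rho>)
           (\<lambda>t. t) (\<lambda>f. f) (\<lambda>u. u) (alpha_map C \<Sigma>) \<and>
         (locally_projective_left A C \<longrightarrow>
         morita_isomorphism (comodule_context A C \<Delta> \<epsilon> \<Sigma> \<rho>) (dual_module_context A C \<Delta> \<epsilon> \<Sigma> \<rho>)
           (\<lambda>t. t) (\<lambda>f. f) (\<lambda>u. u) (alpha_map C \<Sigma>))"
proof -
  interpret comodule_data A C \<Delta> \<epsilon> \<Sigma> \<rho>
    by (rule comodule_data.intro[OF assms(3)])
  define basis where "basis = (SOME (n, e, \<phi>). is_dual_basis A \<Sigma> n e \<phi>)"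
  obtain n e \<phi> where b: "basis = (n, e, \<phi>)" by (cases basis)
  have "case basis of (n, e, \<phi>) \<Rightarrow> is_dual_basis A \<Sigma> n e \<phi>"
    unfolding basis_def
    by (rule someI_ex) (use ex_dual_basis[OF right_module_\<Sigma> assms(4,5)] in auto)
  then interpret dual_comodule A C \<Delta> \<epsilon> \<Sigma> \<rho> n e \<phi>
    by unfold_locales (use b in \<open>simp_all add: basis_def\<close>)
  show ?thesis using morita_morphism_alpha morita_isomorphism_alpha by blast
qed

end
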